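(* Let $\alpha>0$, $M=[\alpha]+1$, and let $f:\mathbb{R}^d\to\mathbb{R}$ be a bounded function with wavelet coefficients $c^{(i)}_{j,k}$. (1) If there exists $C>0$ such that for every integer $j\ge 0$, $$\max\Big(\sup_{\ell\ge j}\|c^{(\cdot)}_{\ell,\cdot}\|_\infty,\; 2^{-jM}\sup_{0\le \ell\le j}\big(2^{\ell M}\|c^{(\cdot)}_{\ell,\cdot}\|_\infty\big)\Big)\ge C\,2^{-j\alpha},\qquad ( * )$$ then $f\in UI^\alpha(\mathbb{R}^d)$. (2) Conversely, if $f$ is uniformly Hölderian and if for every $\beta>1$ the function $f$ belongs to $UI^\alpha_\beta(\mathbb{R}^d)$, then there exists $C>0$ such that $( * )$ holds for every integer $j\ge 0$.
   Context: Finite differences: $\Delta_h^1 f(x)=f(x+h)-f(x)$ and $\Delta_h^M f=\Delta_h^{M-1}\Delta_h^1 f$. For $\alpha\ge 0$, $[\alpha]$ is the largest integer $\le\alpha$, and $M=[\alpha]+1$. The $M$-modulus of smoothness of a bounded $f:\mathbb{R}^d\to\mathbb{R}$ is $\omega_f^M(r)=\sup_{|h|\le r}\sup_{x\in\mathbb{R}^d}|\Delta_h^M f(x)|$. $f\in UI^\alpha_\beta(\mathbb{R}^d)$ ($\alpha\ge 0$, $\beta\in\mathbb{R}$, $f$ bounded) means: there exist $C,R>0$ such that $\omega_f^{M}(r)\ge C r^\alpha|\log r|^\beta$ for all $0<r\le R$, where $M=[\alpha]+1$; $UI^\alpha=UI^\alpha_0$. A bounded function $f$ is uniformly Hölderian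 if for some $\alpha'>0$ there are $C,R>0$ with $\omega_f^{[\alpha']+1}(r)\le C r^{\alpha'}$ for all $0<r\le R$. Wavelets: $\phi,\psi$ are the scaling function and wavelet of a multiresolution analysis of $L^2(\mathbb{R})$, and $\phi$, $\psi^{(i)}$ ($i\in\{0,1\}^d\setminus\{0\}$) are the associated tensor product functions on $\mathbb{R}^d$ (each $\psi^{(i)}$ is a product $\Psi^{(1)}(x_1)\cdots\Psi^{(d)}(x_d)$ with each factor equal to the one-dimensional $\phi$ or $\psi$, at least one factor being $\psi$), so that $\{\phi(x-k)\}_{k\in\mathbb{Z}^d}\cup\{\psi^{(i)}(2^jx-k): i, k\in\mathbb{Z}^d, j\ge 0\}$ is an orthogonal basis of $L^2(\mathbb{R}^d)$. The wavelets belong to $C^\gamma$ with $\gamma$ sufficiently large, taken here as $\gamma>M$, and the derivatives $\partial^s\phi$, $\partial^s\psi^{(i)}$, $|s|\le\gamma$, have fast decay. The wavelet coefficients of a bounded $f$ are $c^{(i)}_{j,k}=2^{dj}\int_{\mathbb{R}^d}f(x)\psi^{(i)}(2^jx-k)\,dx$ for $j\ge 0$ ($L^\infty$ normalization), and $\|c^{(\cdot)}_{j,\cdot}\|_\infty=\sup_i\sup_{k\in\mathbb{Z}^d}|c^{(i)}_{j,k}|$. *)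

theory Defs
  imports "HOL-Analysis.Analysis"
begin

section \<open>Finite differences, moduli of smoothness, uniform irregularity\<close>

primrec fin_diff :: "real^'d \<Rightarrow> nat \<Rightarrow> (real^'d \<Rightarrow> real) \<Rightarrow> real^'d \<Rightarrow> real" where
  "fin_diff h 0 f = f"
| "fin_diff h (Suc M) f = fin_diff h M (\<lambda>x. f (x + h) - f x)"

text \<open>The suprema below are real-valued; they are only used for bounded \<open>f\<close> and \<open>r > 0\<close>,
  where the sets are nonempty and bounded above.\<close>

definition modulus :: "nat \<Rightarrow> (real^'d \<Rightarrow> real) \<Rightarrow> real \<Rightarrow> real" where
  "modulus M f r = (SUP h\<in>{h. norm h \<le> r}. SUP x. \<bar>fin_diff h M f x\<bar>)"

text \<open>The convention \<open>0 powr \<beta> = 0\<close> only matters at \<open>r = 1\<close>, and the existentially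
  quantified \<open>R\<close> can be taken smaller than \<open>1\<close>; in particular \<open>\<bar>ln r\<bar> powr 0 = 1\<close>
  for \<open>0 < r < 1\<close>.\<close>

definition UI_log :: "real \<Rightarrow> real \<Rightarrow> (real^'d \<Rightarrow> real) set" where
  "UI_log \<alpha> \<beta> = {f. bounded (range f) \<and>
     (\<exists>C>0. \<exists>R>0. \<forall>r. 0 < r \<and> r \<le> R \<longrightarrow>
        modulus (nat \<lfloor>\<alpha>\<rfloor> + 1) f r \<ge> C * r powr \<alpha> * \<bar>ln r\<bar> powr \<beta>)}"

definition UI :: "real \<Rightarrow> (real^'d \<Rightarrow> real) set" where
  "UI \<alpha> = UI_log \<alpha> 0"

definition uniformly_Hoelderian :: "(real^'d \<Rightarrow> real) \<Rightarrow> bool" where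
  "uniformly_Hoelderian f \<longleftrightarrow> bounded (range f) \<and>
     (\<exists>\<alpha>'>0. \<exists>C>0. \<exists>R>0. \<forall>r. 0 < r \<and> r \<le> R \<longrightarrow>
        modulus (nat \<lfloor>\<alpha>'\<rfloor> + 1) f r \<le> C * r powr \<alpha>')"

section \<open>Multiresolution analyses of the real line\<close>

text \<open>Elements of \<open>L\<^sup>2(\<real>)\<close> are represented by functions; equality is almost everywhere
  equality.\<close>

definition L2 :: "(real \<Rightarrow> real) set" where
  "L2 = {g. g \<in> borel_measurable lebesgue \<and> integrable lebesgue (\<lambda>x. (g x)\<^sup>2)}"

definition l2_inner :: "(real \<Rightarrow> real) \<Rightarrow> (real \<Rightarrow> real) \<Rightarrow> real" where
  "l2_inner g h = (\<integral>x. g x * h x \<partial>lebesgue)"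

definition l2_norm :: "(real \<Rightarrow> real) \<Rightarrow> real" where
  "l2_norm g = sqrt (l2_inner g g)"

definition l2_closure :: "(real \<Rightarrow> real) set \<Rightarrow> (real \<Rightarrow> real) set" where
  "l2_closure S = {g \<in> L2. \<forall>\<epsilon>>0. \<exists>h\<in>S. l2_norm (\<lambda>x. g x - h x) < \<epsilon>}"

definition lin_span :: "('i \<Rightarrow> real \<Rightarrow> real) \<Rightarrow> (real \<Rightarrow> real) set" where
  "lin_span e = {g. \<exists>A a. finite A \<and> g = (\<lambda>x. \<Sum>k\<in>A. a k * e k x)}"

definition closed_subspace_L2 :: "(real \<Rightarrow> real) set \<Rightarrow> bool" where
  "closed_subspace_L2 S \<longleftrightarrow> (\<lambda>x. 0) \<in> S \<and>
     (\<forall>g\<in>S. \<forall>h\<in>S. (\<lambda>x. g x + h x) \<in> S) \<and>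
     (\<forall>a. \<forall>g\<in>S. (\<lambda>x. a * g x) \<in> S) \<and>
     S \<subseteq> L2 \<and> l2_closure S = S"

definition orthogonal_basis_of :: "('i \<Rightarrow> real \<Rightarrow> real) \<Rightarrow> (real \<Rightarrow> real) set \<Rightarrow> bool" where
  "orthogonal_basis_of e S \<longleftrightarrow>
     (\<forall>k. e k \<in> L2 \<and> l2_norm (e k) \<noteq> 0) \<and>
     (\<forall>k l. k \<noteq> l \<longrightarrow> l2_inner (e k) (e l) = 0) \<and>
     l2_closure (lin_span e) = S"

text \<open>The normalization of \<open>\<phi>\<close> and \<open>\<psi>\<close> is left free: the translates are orthogonal, with
  arbitrary nonzero norm.\<close>

definition multiresolution_analysis :: "(int \<Rightarrow> (real \<Rightarrow> real) set) \<Rightarrow> (real \<Rightarrow> real) \<Rightarrow> bool" where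
  "multiresolution_analysis V \<phi> \<longleftrightarrow>
     (\<forall>j. closed_subspace_L2 (V j)) \<and>
     (\<forall>j. V j \<subseteq> V (j + 1)) \<and>
     (\<forall>j g. g \<in> V j \<longleftrightarrow> (\<lambda>x. g (2 * x)) \<in> V (j + 1)) \<and>
     (\<Inter>j. V j) = {g \<in> L2. AE x in lebesgue. g x = 0} \<and>
     l2_closure (\<Union>j. V j) = L2 \<and>
     orthogonal_basis_of (\<lambda>k::int. \<lambda>x. \<phi> (x - of_int k)) (V 0)"

text \<open>The translates of the wavelet span the orthogonal complement of \<open>V 0\<close> in \<open>V 1\<close>.\<close>

definition scaling_function_and_wavelet :: "(real \<Rightarrow> real) \<Rightarrow> (real \<Rightarrow> real) \<Rightarrow> bool" where
  "scaling_function_and_wavelet \<phi> \<psi> \<longleftrightarrow>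
     (\<exists>V. multiresolution_analysis V \<phi> \<and>
        orthogonal_basis_of (\<lambda>k::int. \<lambda>x. \<psi> (x - of_int k))
          {g \<in> V 1. \<forall>h\<in>V 0. l2_inner g h = 0})"

section \<open>Tensor product wavelets, regularity and decay\<close>

text \<open>The index \<open>i \<in> {0,1}\<^sup>d\<close> is a vector of truth values: the factor in direction \<open>m\<close> is
  \<open>\<psi>\<close> if \<open>i $ m\<close> and \<open>\<phi>\<close> otherwise. Hence \<open>i = 0\<close> yields the \<open>d\<close>-dimensional scaling
  function and the indices in \<open>wavelet_indices\<close> yield the wavelets.\<close>

definition tensor :: "(real \<Rightarrow> real) \<Rightarrow> (real \<Rightarrow> real) \<Rightarrow> bool^'d \<Rightarrow> real^'d \<Rightarrow> real" where
  "tensor \<phi> \<psi> i x = (\<Prod>m\<in>UNIV. (if i $ m then \<psi> else \<phi>) (x $ m))"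

definition wavelet_indices :: "(bool^'d) set" where
  "wavelet_indices = {i. \<exists>m. i $ m}"

definition partial_deriv :: "'d \<Rightarrow> (real^'d \<Rightarrow> real) \<Rightarrow> real^'d \<Rightarrow> real" where
  "partial_deriv m g x = deriv (\<lambda>t. g (x + t *\<^sub>R axis m 1)) 0"

text \<open>A multi-index \<open>s\<close> is given as the list of the directions of differentiation, so that
  \<open>|s|\<close> is the length of the list.\<close>

fun partial_derivs :: "'d list \<Rightarrow> (real^'d \<Rightarrow> real) \<Rightarrow> real^'d \<Rightarrow> real" where
  "partial_derivs [] g = g"
| "partial_derivs (m # s) g = partial_derivs s (partial_deriv m g)"

primrec C_k :: "nat \<Rightarrow> (real^'d \<Rightarrow> real) \<Rightarrow> bool" where
  "C_k 0 g \<longleftrightarrow> continuous_on UNIV g"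
| "C_k (Suc n) g \<longleftrightarrow> continuous_on UNIV g \<and>
     (\<forall>m x. (\<lambda>t. g (x + t *\<^sub>R axis m 1)) differentiable (at 0)) \<and>
     (\<forall>m. C_k n (partial_deriv m g))"

text \<open>For non-integer \<open>\<gamma>\<close> this is the usual Hoelder class. For integer \<open>\<gamma>\<close> the last condition
  has exponent \<open>0\<close>: it says that the derivatives of order \<open>\<gamma>\<close> have bounded oscillation,
  which is automatic if they decay fast.\<close>

definition C_gamma :: "real \<Rightarrow> (real^'d \<Rightarrow> real) \<Rightarrow> bool" where
  "C_gamma \<gamma> g \<longleftrightarrow> C_k (nat \<lfloor>\<gamma>\<rfloor>) g \<and>
     (\<forall>s. length s = nat \<lfloor>\<gamma>\<rfloor> \<longrightarrow>
        (\<exists>C. \<forall>x y. \<bar>partial_derivs s g x - partial_derivs s g y\<bar>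
               \<le> C * norm (x - y) powr (\<gamma> - of_int \<lfloor>\<gamma>\<rfloor>)))"

definition fast_decay :: "(real^'d \<Rightarrow> real) \<Rightarrow> bool" where
  "fast_decay g \<longleftrightarrow> (\<forall>N::nat. \<exists>C. \<forall>x. \<bar>g x\<bar> \<le> C / (1 + norm x) ^ N)"

definition regular_wavelets ::
    "'d::finite itself \<Rightarrow> real \<Rightarrow> (real \<Rightarrow> real) \<Rightarrow> (real \<Rightarrow> real) \<Rightarrow> bool" where
  "regular_wavelets _ \<gamma> \<phi> \<psi> \<longleftrightarrow>
     scaling_function_and_wavelet \<phi> \<psi> \<and>
     (\<forall>i :: bool^'d. C_gamma \<gamma> (tensor \<phi> \<psi> i) \<and>
        (\<forall>s. real (length s) \<le> \<gamma> \<longrightarrow> fast_decay (partial_derivs s (tensor \<phi> \<psi> i))))"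

section \<open>Wavelet coefficients\<close>

definition wavelet_coeff ::
    "(real \<Rightarrow> real) \<Rightarrow> (real \<Rightarrow> real) \<Rightarrow> (real^'d \<Rightarrow> real) \<Rightarrow> bool^'d \<Rightarrow> nat \<Rightarrow> int^'d \<Rightarrow> real" where
  "wavelet_coeff \<phi> \<psi> f i j k =
     2 ^ (CARD('d) * j) *
     (\<integral>x. f x * tensor \<phi> \<psi> i (2 ^ j *\<^sub>R x - (\<chi> m. of_int (k $ m))) \<partial>lebesgue)"

definition coeff_norm ::
    "(real \<Rightarrow> real) \<Rightarrow> (real \<Rightarrow> real) \<Rightarrow> (real^'d \<Rightarrow> real) \<Rightarrow> nat \<Rightarrow> real" where
  "coeff_norm \<phi> \<psi> f j = (SUP i\<in>wavelet_indices. SUP k. \<bar>wavelet_coeff \<phi> \<psi> f i j k\<bar>)"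

definition coeff_lower_bound ::
    "(real \<Rightarrow> real) \<Rightarrow> (real \<Rightarrow> real) \<Rightarrow> nat \<Rightarrow> real \<Rightarrow> (real^'d \<Rightarrow> real) \<Rightarrow> bool" where
  "coeff_lower_bound \<phi> \<psi> M \<alpha> f \<longleftrightarrow>
     (\<exists>C>0. \<forall>j::nat.
        max (SUP l\<in>{j..}. coeff_norm \<phi> \<psi> f l)
            (2 powr (- real (j * M)) * (SUP l\<in>{0..j}. 2 ^ (l * M) * coeff_norm \<phi> \<psi> f l))
        \<ge> C * 2 powr (- (real j * \<alpha>)))"

end

theory Submission
  imports Defs "HOL-Real_Asymp.Real_Asymp"
begin

text \<open>A wavelet has vanishing moments, so in one direction it is the \<open>M\<close>-th derivative of a rapidly
  decaying function. Hence a coefficient at level \<open>l\<close> is bounded by the \<open>M\<close>-th modulus of smoothness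
  at \<open>2\<^sup>-\<^sup>l\<close>; as the modulus is monotone and grows by at most \<open>2\<^sup>M\<close> when its argument doubles, both
  terms of the maximum at level \<open>j\<close> are bounded by the modulus at \<open>2\<^sup>-\<^sup>j\<close>. This is part (1).

  Conversely, \<open>f\<close> is its projection on the coarsest space, plus the wavelet layers of the levels below
  \<open>L\<close>, plus a remainder that is at most of the order of \<open>2\<^sup>-\<^sup>L\<^sup>a\<close> if \<open>f\<close> is Hoelder continuous of
  exponent \<open>a\<close>. The \<open>M\<close>-th difference with step \<open>h\<close> of the layer \<open>l\<close> is at most a constant times the
  norm of its coefficients times the minimum of \<open>1\<close> and \<open>(2\<^sup>l |h|)\<^sup>M\<close>. If the maximum at level \<open>j\<close> is
  less than \<open>2\<^sup>-\<^sup>j\<^sup>\<alpha>\<close>, each of these layers contributes \<open>O(2\<^sup>-\<^sup>j\<^sup>\<alpha>)\<close> for \<open>|h| \<le> 2\<^sup>-\<^sup>j\<close>, and with \<open>L\<close>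
  proportional to \<open>j\<close> the modulus at \<open>2\<^sup>-\<^sup>j\<close> is \<open>O(j 2\<^sup>-\<^sup>j\<^sup>\<alpha>)\<close>, against the lower bound of the order
  of \<open>j\<^sup>2 2\<^sup>-\<^sup>j\<^sup>\<alpha>\<close> that \<open>\<beta> = 2\<close> provides. So the maximum is large at all large levels, and
  it then vanishes at no level.\<close>

section \<open>Finite differences\<close>

text \<open>Since \<open>f\<close> is only bounded, the L2 theory does not apply to it directly. The
  projections are therefore written as integral operators whose kernels are products of
  one-dimensional kernels; they converge absolutely on bounded functions, and a two-scale identity
  between kernels replaces the orthogonal decomposition of the spaces. Two facts on wavelets that
  are not among the hypotheses have to be derived from the multiresolution analysis: the vanishing
  moments of \<psi>, and that the coarse kernel has integral 1, which is what makes the remainder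
  small. Regularity is assumed for tensor products only and has to be read off for \<phi> and \<psi>
  themselves.

  The Hoelder hypothesis may concern differences of high order, whereas the remainder estimate needs
  first differences; Marchaud's argument lowers the order once the exponent has been reduced below
  1. In part (1) the obstacle is that \<open>f\<close> cannot be differentiated: the derivatives are
  taken instead of correlations of \<open>f\<close> with translated primitives of the wavelet, which
  are differentiable in the translation parameter.\<close>

primrec fdiff :: "'a::real_vector \<Rightarrow> nat \<Rightarrow> ('a \<Rightarrow> real) \<Rightarrow> 'a \<Rightarrow> real" where
  "fdiff h 0 f = f"
| "fdiff h (Suc M) f = fdiff h M (\<lambda>x. f (x + h) - f x)"

text \<open>Differences are needed on the real line as well as in R^d: along lines in space, and in
  the translation parameter of a correlation. Hence the copy of \<open>fin_diff\<close> over an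
  arbitrary real vector space.\<close>

lemma fin_diff_eq_fdiff: "fin_diff h M f = fdiff h M f"
  by (induction M arbitrary: f) auto

lemma fdiff_add: "fdiff h M (\<lambda>x. f x + g x) x = fdiff h M f x + fdiff h M g x"
proof (induction M arbitrary: f g)
  case (Suc M)
  have "(\<lambda>x. f (x + h) + g (x + h) - (f x + g x)) = (\<lambda>x. (f (x + h) - f x) + (g (x + h) - g x))"
    by auto
  then show ?case using Suc by simp
qed simp

lemma fdiff_cmult: "fdiff h M (\<lambda>x. c * f x) x = c * fdiff h M f x"
proof (induction M arbitrary: f)
  case (Suc M)
  show ?case using Suc[of "\<lambda>x. f (x + h) - f x"] by (simp add: right_diff_distrib)
qed simp

lemma fdiff_sum: "fdiff h M (\<lambda>x. \<Sum>i\<in>I. f i x) x = (\<Sum>i\<in>I. fdiff h M (f i) x)"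
proof (induction I rule: infinite_finite_induct)
  case empty
  show ?case using fdiff_cmult[of h M 0 "\<lambda>x. 0" x] by simp
next
  case (infinite A)
  show ?case using fdiff_cmult[of h M 0 "\<lambda>x. 0" x] infinite by simp
qed (simp add: fdiff_add)

lemma fdiff_shift: "fdiff h M (\<lambda>x. f (x + a)) x = fdiff h M f (x + a)"
proof (induction M arbitrary: f)
  case (Suc M)
  have "(\<lambda>x. f (x + h + a) - f (x + a)) = (\<lambda>x. (\<lambda>y. f (y + h) - f y) (x + a))"
    by (auto simp: add_ac)
  then show ?case using Suc[of "\<lambda>y. f (y + h) - f y"] by simp
qed simp

lemma fdiff_Suc: "fdiff h (Suc M) f x = fdiff h M f (x + h) - fdiff h M f x"
proof -
  have "fdiff h M (\<lambda>x. f (x + h) + (-1) * f x) x = fdiff h M f (x + h) + (-1) * fdiff h M f x"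
    by (subst fdiff_add, subst fdiff_cmult, subst fdiff_shift) simp
  then show ?thesis by simp
qed

lemma fdiff_scaleR:
  "c \<noteq> 0 \<Longrightarrow> fdiff h M (\<lambda>x. f (c *\<^sub>R x)) x = fdiff (c *\<^sub>R h) M f (c *\<^sub>R x)"
  by (induction M arbitrary: f) (auto simp add: scaleR_add_right)

text \<open>Restriction to the line through \<open>x\<close> in direction \<open>h\<close> turns a
  step \<open>h\<close> into a step 1 of a function of one real variable, where the mean value
  theorem and a product rule are available.\<close>

lemma fdiff_line:
  "fdiff (1::real) M (\<lambda>t. f (x + t *\<^sub>R h)) t = fdiff h M f (x + t *\<^sub>R h)"
proof (induction M arbitrary: f)
  case (Suc M)
  have "(\<lambda>t. f (x + (t + 1) *\<^sub>R h) - f (x + t *\<^sub>R h))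
    = (\<lambda>t. (\<lambda>y. f (y + h) - f y) (x + t *\<^sub>R h))"
    by (auto simp: scaleR_add_left add.assoc)
  then show ?case using Suc[of "\<lambda>y. f (y + h) - f y"] by simp
qed simp

text \<open>Pascal's rule, applied to the recursion \<open>fdiff_Suc\<close>. In this form a
  difference is a finite linear combination of values, so it commutes with integrals and with
  pointwise limits.\<close>

lemma fdiff_binomial:
  "fdiff h M f x = (\<Sum>j\<le>M. (-1) ^ (M - j) * real (M choose j) * f (x + real j *\<^sub>R h))"
proof (induction M arbitrary: x)
  case (Suc M)
  let ?g = "\<lambda>j. f (x + real j *\<^sub>R h)"
  have shift: "x + h + real j *\<^sub>R h = x + real (Suc j) *\<^sub>R h" for j
    by (simp add: algebra_simps)
  have "fdiff h (Suc M) f x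
      = (\<Sum>j\<le>M. (-1) ^ (M - j) * real (M choose j) * ?g (Suc j))
        - (\<Sum>j\<le>M. (-1) ^ (M - j) * real (M choose j) * ?g j)"
    by (simp only: fdiff_Suc Suc.IH shift)
  moreover have "(\<Sum>j\<le>Suc M. (-1) ^ (Suc M - j) * real (Suc M choose j) * ?g j)
     = (-1) ^ Suc M * ?g 0 + (\<Sum>j\<le>M. (-1) ^ (M - j) * real (Suc M choose Suc j) * ?g (Suc j))"
    by (subst sum.atMost_Suc_shift) simp
  moreover have "(\<Sum>j\<le>M. (-1) ^ (M - j) * real (M choose j) * ?g j)
     = (-1) ^ M * ?g 0 + (\<Sum>j<M. (-1) ^ (M - Suc j) * real (M choose Suc j) * ?g (Suc j))"
    by (cases M) (simp_all add: sum.atMost_Suc_shift lessThan_Suc_atMost del: sum.atMost_Suc)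
  moreover have "(\<Sum>j\<le>M. (-1) ^ (M - j) * real (Suc M choose Suc j) * ?g (Suc j))
     = (\<Sum>j\<le>M. (-1) ^ (M - j) * real (M choose j) * ?g (Suc j))
       - (\<Sum>j<M. (-1) ^ (M - Suc j) * real (M choose Suc j) * ?g (Suc j))"
  proof -
    have "(\<Sum>j\<le>M. (-1) ^ (M - j) * real (M choose Suc j) * ?g (Suc j))
        = (\<Sum>j<M. (-1) ^ (M - j) * real (M choose Suc j) * ?g (Suc j))"
      by (simp add: lessThan_Suc_atMost[symmetric])
    also have "\<dots> = (\<Sum>j<M. - ((-1) ^ (M - Suc j) * real (M choose Suc j) * ?g (Suc j)))"
    proof (rule sum.cong)
      fix j assume "j \<in> {..<M}"
      then have "M - j = Suc (M - Suc j)" by auto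
      then show "(-1) ^ (M - j) * real (M choose Suc j) * ?g (Suc j)
        = - ((-1) ^ (M - Suc j) * real (M choose Suc j) * ?g (Suc j))" by simp
    qed simp
    finally show ?thesis
      by (simp add: sum.distrib algebra_simps sum_negf)
  qed
  ultimately show ?case by simp
qed simp

lemma abs_fdiff_le:
  assumes "\<And>x. \<bar>f x\<bar> \<le> B"
  shows "\<bar>fdiff h M f x\<bar> \<le> 2 ^ M * B"
proof (induction M arbitrary: x)
  case (Suc M)
  show ?case using Suc[of x] Suc[of "x + h"] unfolding fdiff_Suc power_Suc mult.assoc by linarith
qed (simp add: assms)

text \<open>With \<open>S\<close> the translation by \<open>h\<close>, the difference with the
  doubled step is \<open>(S - 1) (S + 1)\<close>. Its \<open>M\<close>-th power is the
  \<open>M\<close>-th difference with step \<open>h\<close> followed by \<open>(S + 1) ^ M\<close>,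
  a sum of \<open>2 ^ M\<close> translations.\<close>

lemma abs_fdiff_step_double:
  assumes "\<And>x. \<bar>fdiff h M f x\<bar> \<le> B"
  shows "\<bar>fdiff (2 *\<^sub>R h) M f x\<bar> \<le> 2 ^ M * B"
  using assms
proof (induction M arbitrary: f x)
  case (Suc M)
  let ?g = "\<lambda>x. f (x + h) - f x"
  have "(\<lambda>x. f (x + 2 *\<^sub>R h) - f x) = (\<lambda>x. ?g (x + h) + ?g x)"
    by (auto simp: scaleR_2 add.assoc)
  then have eq: "fdiff (2 *\<^sub>R h) (Suc M) f x = fdiff (2 *\<^sub>R h) M ?g (x + h) + fdiff (2 *\<^sub>R h) M ?g x"
    using fdiff_add[of "2 *\<^sub>R h" M "\<lambda>x. ?g (x + h)" ?g x] fdiff_shift[of "2 *\<^sub>R h" M ?g h x] by simp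
  have "\<bar>fdiff (2 *\<^sub>R h) M ?g y\<bar> \<le> 2 ^ M * B" for y
    using Suc.IH[of ?g] Suc.prems by simp
  from this[of x] this[of "x + h"] eq show ?case
    unfolding power_Suc mult.assoc by linarith
qed simp

lemma abs_fdiff_step_power2:
  assumes "\<And>x. \<bar>fdiff h M f x\<bar> \<le> B"
  shows "\<bar>fdiff (2 ^ n *\<^sub>R h) M f x\<bar> \<le> 2 ^ (n * M) * B"
proof (induction n arbitrary: x)
  case (Suc n)
  show ?case using abs_fdiff_step_double[OF Suc] by (simp add: power_add mult.assoc)
qed (simp add: assms)

text \<open>The unit increments of a chain of derivatives form again such a chain, so the induction
  hypothesis applies to them and one use of the mean value theorem finishes. An arbitrary chain
  \<open>D\<close> is allowed, instead of iterated \<open>deriv\<close>, because auxiliary functions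
  built from primitives are treated as well.\<close>

lemma fdiff_mean_value:
  assumes "\<And>n x. n < M \<Longrightarrow> (D n has_real_derivative D (Suc n) x) (at x)"
  shows "\<exists>\<xi>. t \<le> \<xi> \<and> \<xi> \<le> t + real M \<and> fdiff 1 M (D 0) t = D M \<xi>"
  using assms
proof (induction M arbitrary: D t)
  case 0
  show ?case by (rule exI[of _ t]) simp
next
  case (Suc M)
  have "((\<lambda>x. D n (x + 1) - D n x) has_real_derivative D (Suc n) (x + 1) - D (Suc n) x) (at x)"
    if "n < M" for n x
    using Suc.prems[of n "x + 1"] Suc.prems[of n x] that
    by (intro DERIV_diff) (auto simp: DERIV_shift)
  from Suc.IH[of "\<lambda>n x. D n (x + 1) - D n x" t, OF this] obtain \<xi> where
    \<xi>: "t \<le> \<xi>" "\<xi> \<le> t + real M" "fdiff 1 (Suc M) (D 0) t = D M (\<xi> + 1) - D M \<xi>" by auto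
  have "\<exists>z. \<xi> < z \<and> z < \<xi> + 1 \<and> D M (\<xi> + 1) - D M \<xi> = (\<xi> + 1 - \<xi>) * D (Suc M) z"
    by (rule MVT2) (use Suc.prems in auto)
  then obtain z where "\<xi> < z" "z < \<xi> + 1" "D M (\<xi> + 1) - D M \<xi> = D (Suc M) z" by auto
  with \<xi> show ?case by (intro exI[of _ z]) auto
qed

text \<open>The bounds are only required at the \<open>k + 1\<close> nodes that enter the \<open>k\<close>-th difference, so that
  local decay of the factors is inherited by the product.\<close>

lemma abs_fdiff_mult_le:
  fixes u v :: "real \<Rightarrow> real"
  assumes "\<And>i n. i + n \<le> k \<Longrightarrow> \<bar>fdiff 1 i u (real n)\<bar> \<le> A * r ^ i"
    and "\<And>i n. i + n \<le> k \<Longrightarrow> \<bar>fdiff 1 i v (real n)\<bar> \<le> B * r ^ i"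
    and "i + n \<le> k"
  shows "\<bar>fdiff 1 i (\<lambda>t. u t * v t) (real n)\<bar> \<le> 2 ^ i * (A * B) * r ^ i"
  using assms
proof (induction i arbitrary: k u v A B n)
  case 0
  have "\<bar>u (real n)\<bar> \<le> A" "\<bar>v (real n)\<bar> \<le> B"
    using 0(1)[of 0 n] 0(2)[of 0 n] 0(3) by auto
  then show ?case by (simp add: abs_mult mult_mono)
next
  case (Suc i)
  then obtain k' where k: "k = Suc k'" by (cases k) auto
  let ?du = "\<lambda>t. u (t + 1) - u t" and ?dv = "\<lambda>t. v (t + 1) - v t" and ?sv = "\<lambda>t. v (t + 1)"
  have du: "\<bar>fdiff 1 j ?du (real m)\<bar> \<le> (A * r) * r ^ j" if "j + m \<le> k'" for j m
    using Suc.prems(1)[of "Suc j" m] that k by (simp add: mult.assoc)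
  have dv: "\<bar>fdiff 1 j ?dv (real m)\<bar> \<le> (B * r) * r ^ j" if "j + m \<le> k'" for j m
    using Suc.prems(2)[of "Suc j" m] that k by (simp add: mult.assoc)
  have sv: "\<bar>fdiff 1 j ?sv (real m)\<bar> \<le> B * r ^ j" if "j + m \<le> k'" for j m
    using Suc.prems(2)[of j "Suc m"] that k fdiff_shift[of 1 j v 1 "real m"]
    by (simp add: add.commute)
  have u: "\<bar>fdiff 1 j u (real m)\<bar> \<le> A * r ^ j" if "j + m \<le> k'" for j m
    using Suc.prems(1)[of j m] that k by simp
  have in': "i + n \<le> k'" using Suc.prems(3) k by simp
  have "(\<lambda>t. u (t + 1) * v (t + 1) - u t * v t) = (\<lambda>t. ?du t * ?sv t + u t * ?dv t)"
    by (auto simp: algebra_simps)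
  then have "fdiff 1 (Suc i) (\<lambda>t. u t * v t) (real n)
     = fdiff 1 i (\<lambda>t. ?du t * ?sv t) (real n) + fdiff 1 i (\<lambda>t. u t * ?dv t) (real n)"
    by (simp only: fdiff.simps fdiff_add)
  moreover have "\<bar>fdiff 1 i (\<lambda>t. ?du t * ?sv t) (real n)\<bar> \<le> 2 ^ i * (A * r * B) * r ^ i"
    by (rule Suc.IH[OF du sv in'])
  moreover have "\<bar>fdiff 1 i (\<lambda>t. u t * ?dv t) (real n)\<bar> \<le> 2 ^ i * (A * (B * r)) * r ^ i"
    by (rule Suc.IH[OF u dv in'])
  ultimately show ?case by (simp add: algebra_simps)
qed

lemma abs_fdiff_prod_le:
  fixes u :: "'i \<Rightarrow> real \<Rightarrow> real"
  assumes "finite S" "r \<ge> 0"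
    and "\<And>s i n. s \<in> S \<Longrightarrow> i + n \<le> k \<Longrightarrow> \<bar>fdiff 1 i (u s) (real n)\<bar> \<le> A s * r ^ i"
    and "i + n \<le> k"
  shows "\<bar>fdiff 1 i (\<lambda>t. \<Prod>s\<in>S. u s t) (real n)\<bar> \<le> 2 ^ (k * card S) * (\<Prod>s\<in>S. A s) * r ^ i"
  using assms
proof (induction S arbitrary: i n rule: finite_induct)
  case empty
  have "fdiff 1 i (\<lambda>t::real. 1) (real n) = (if i = 0 then 1 else 0)"
    by (cases i) (simp, simp, use fdiff_cmult[of 1 "i-1" 0 "\<lambda>x::real. 0" "real n"] in simp)
  then show ?case by (simp add: empty)
next
  case (insert s S)
  have A: "0 \<le> A t" if "t \<in> insert s S" for t
    using order_trans[OF abs_ge_zero insert.prems(2)[OF that, of 0 0]] by simp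
  have "\<bar>fdiff 1 i (\<lambda>t. u s t * (\<Prod>s\<in>S. u s t)) (real n)\<bar>
      \<le> 2 ^ i * (A s * (2 ^ (k * card S) * (\<Prod>s\<in>S. A s))) * r ^ i"
    by (rule abs_fdiff_mult_le[where k = k])
       (use insert in auto)
  \<comment> \<open>The factor \<open>2 ^ i\<close> is weakened to \<open>2 ^ k\<close> so that the
    constant is the same for all orders \<open>i\<close>, as multiplication by the next factor
    requires.\<close>
  also have "\<dots> \<le> 2 ^ k * (A s * (2 ^ (k * card S) * (\<Prod>s\<in>S. A s))) * r ^ i"
    using insert.prems A
    by (intro mult_right_mono power_increasing mult_nonneg_nonneg prod_nonneg) auto
  finally show ?case
    using insert.hyps by (simp add: power_add algebra_simps)
qed

text \<open>With \<open>S\<close> the translation by \<open>h\<close>, the left side is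
  \<open>(S - 1) ^ m ((S + 1) ^ m - 2 ^ m)\<close> applied to \<open>f\<close>, and
  \<open>(S + 1) ^ m - 2 ^ m\<close> is divisible by \<open>S - 1\<close>. One further difference
  splits off, and the coefficients of the quotient sum to at most \<open>m * 2 ^ m\<close>.\<close>

lemma fdiff_double_approx:
  assumes "\<And>x. \<bar>fdiff h (Suc m) f x\<bar> \<le> E"
  shows "\<bar>fdiff (2 *\<^sub>R h) m f x - 2 ^ m * fdiff h m f x\<bar> \<le> real m * 2 ^ m * E"
  using assms
proof (induction m arbitrary: f x)
  case (Suc m)
  let ?g = "\<lambda>x. f (x + h) - f x"
  have "(\<lambda>x. f (x + 2 *\<^sub>R h) - f x) = (\<lambda>x. ?g (x + h) + ?g x)"
    by (auto simp: scaleR_2 add.assoc)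
  then have eq: "fdiff (2 *\<^sub>R h) (Suc m) f x = fdiff (2 *\<^sub>R h) m ?g (x + h) + fdiff (2 *\<^sub>R h) m ?g x"
    using fdiff_add[of "2 *\<^sub>R h" m "\<lambda>x. ?g (x + h)" ?g x] fdiff_shift[of "2 *\<^sub>R h" m ?g h x] by simp
  have E: "\<bar>fdiff h (Suc m) ?g y\<bar> \<le> E" for y using Suc.prems by simp
  have "0 \<le> E" using E[of x] by linarith
  have 1: "\<bar>fdiff (2 *\<^sub>R h) m ?g y - 2 ^ m * fdiff h m ?g y\<bar> \<le> real m * 2 ^ m * E" for y
    using Suc.IH[of ?g, OF E] .
  have "\<bar>fdiff h m ?g (x + h) - fdiff h m ?g x\<bar> \<le> E" using E[of x] by (simp only: fdiff_Suc)
  then have "\<bar>2 ^ m * fdiff h m ?g (x + h) - 2 ^ m * fdiff h m ?g x\<bar> \<le> 2 ^ m * E"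
    by (simp add: abs_mult flip: right_diff_distrib)
  then have "\<bar>fdiff (2 *\<^sub>R h) (Suc m) f x - 2 * (2 ^ m * fdiff h m ?g x)\<bar>
      \<le> 2 * (real m * 2 ^ m * E) + 2 ^ m * E"
    using 1[of x] 1[of "x + h"] unfolding eq by linarith
  also have "\<dots> \<le> real (Suc m) * 2 ^ Suc m * E"
    using \<open>0 \<le> E\<close> by (simp add: algebra_simps)
  finally show ?case by simp
qed simp

text \<open>Marchaud's argument: the difference of order \<open>m\<close> with step \<open>h\<close> is controlled by \<open>2\<^sup>-\<^sup>m\<close> times the
  one with step \<open>2h\<close>, and iterating this yields a geometric series of ratio \<open>2\<^sup>a\<^sup>-\<^sup>m\<close>, which
  converges since \<open>a < 1\<close>.\<close>

lemma fdiff_order_reduce: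
  fixes f :: "'a::real_normed_vector \<Rightarrow> real"
  assumes "\<And>x. \<bar>f x\<bar> \<le> B" "m \<ge> 1" "0 < a" "a < 1"
    and E: "\<And>h x. \<bar>fdiff h (Suc m) f x\<bar> \<le> C * norm h powr a"
  shows "\<exists>C'. \<forall>h x. \<bar>fdiff h m f x\<bar> \<le> C' * norm h powr a"
proof -
  define q where "q = 2 powr a / 2 ^ m"
  have "2 powr a < (2::real) powr 1" using assms by (intro powr_less_mono) auto
  also have "(2::real) powr 1 \<le> 2 ^ m" using assms(2) self_le_power[of "2::real" m] by simp
  finally have q: "0 \<le> q" "q < 1" by (auto simp: q_def)
  \<comment> \<open>The solution of \<open>K * q + real m * C = K\<close>: the left side is the
    effect of one doubling of the step on the constant.\<close>
  define K where "K = real m * C / (1 - q)"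
  have K: "K * q + real m * C = K" using q by (simp add: K_def field_simps)
  have step: "\<bar>fdiff h m f x\<bar> \<le> \<bar>fdiff (2 *\<^sub>R h) m f x\<bar> / 2 ^ m + real m * (C * norm h powr a)" for h x
  proof -
    have "2 ^ m * \<bar>fdiff h m f x\<bar> \<le> \<bar>fdiff (2 *\<^sub>R h) m f x\<bar> + real m * 2 ^ m * (C * norm h powr a)"
      using fdiff_double_approx[OF E, of h x] by (simp add: abs_if split: if_splits)
    then show ?thesis by (simp add: field_simps)
  qed
  \<comment> \<open>Boundedness of \<open>f\<close> enters only through the first summand, which
    disappears as \<open>n\<close> grows.\<close>
  have iter: "\<bar>fdiff h m f x\<bar> \<le> (1 / 2 ^ m) ^ n * (2 ^ m * B) + K * norm h powr a" for n h x
  proof (induction n arbitrary: h)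
    case 0
    have 0: "0 \<le> C * norm h powr a" using E[of h x] by linarith
    then have "0 \<le> real m / (1 - q) * (C * norm h powr a)"
      using q by (intro mult_nonneg_nonneg divide_nonneg_nonneg 0) auto
    then have "0 \<le> K * norm h powr a" by (simp add: K_def)
    then show ?case using abs_fdiff_le[of f B h m x] assms(1) by force
  next
    case (Suc n)
    have "\<bar>fdiff h m f x\<bar> \<le> ((1 / 2 ^ m) ^ n * (2 ^ m * B) + K * norm (2 *\<^sub>R h) powr a) / 2 ^ m
        + real m * (C * norm h powr a)"
      using step[of h x] Suc[of "2 *\<^sub>R h"] by (smt (verit) divide_right_mono zero_le_power)
    also have "\<dots> = (1 / 2 ^ m) ^ Suc n * (2 ^ m * B) + (K * q + real m * C) * norm h powr a"
      by (simp add: q_def powr_mult field_simps)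
    finally show ?case unfolding K .
  qed
  have "\<bar>fdiff h m f x\<bar> \<le> K * norm h powr a" for h x
  proof (rule LIMSEQ_le_const)
    have "(\<lambda>n. (1 / 2 ^ m) ^ n :: real) \<longlonglongrightarrow> 0"
      by (rule LIMSEQ_power_zero) (use assms(2) in auto)
    from tendsto_add[OF tendsto_mult_left_zero[OF this, of "2 ^ m * B"] tendsto_const]
    show "(\<lambda>n. (1 / 2 ^ m) ^ n * (2 ^ m * B) + K * norm h powr a) \<longlonglongrightarrow> K * norm h powr a"
      by (metis add.left_neutral)
  qed (use iter in blast)
  then show ?thesis by blast
qed

lemma fdiff_order_reduce_to_1:
  fixes f :: "'a::real_normed_vector \<Rightarrow> real"
  assumes "\<And>x. \<bar>f x\<bar> \<le> B" "m \<ge> 1" "0 < a" "a < 1"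
    and "\<And>h x. \<bar>fdiff h m f x\<bar> \<le> C * norm h powr a"
  shows "\<exists>C'. \<forall>h x. \<bar>f (x + h) - f x\<bar> \<le> C' * norm h powr a"
  using assms(2,5)
proof (induction m arbitrary: C rule: nat_induct_at_least)
  case base
  then show ?case by auto
next
  case (Suc m)
  then show ?case using fdiff_order_reduce[OF assms(1) Suc(1) assms(3,4) Suc(3)] by blast
qed

section \<open>The modulus of smoothness\<close>

lemma bdd_above_fin_diff:
  fixes f :: "real^'d \<Rightarrow> real"
  assumes "bounded (range f)"
  shows "bdd_above (range (\<lambda>x. \<bar>fin_diff h M f x\<bar>))"
    and "bdd_above ((\<lambda>h. SUP x. \<bar>fin_diff h M f x\<bar>) ` H)"
proof -
  obtain B where B: "\<And>x. \<bar>f x\<bar> \<le> B" using assms by (auto simp: bounded_iff)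
  have le: "\<bar>fin_diff h M f x\<bar> \<le> 2 ^ M * B" for h x
    unfolding fin_diff_eq_fdiff using B by (rule abs_fdiff_le)
  then show "bdd_above (range (\<lambda>x. \<bar>fin_diff h M f x\<bar>))" by (intro bdd_aboveI2)
  show "bdd_above ((\<lambda>h. SUP x. \<bar>fin_diff h M f x\<bar>) ` H)"
    by (intro bdd_aboveI2[where M = "2 ^ M * B"] cSUP_least le) auto
qed

lemma fdiff_le_modulus:
  fixes f :: "real^'d \<Rightarrow> real"
  assumes "bounded (range f)" "norm h \<le> r"
  shows "\<bar>fdiff h M f x\<bar> \<le> modulus M f r"
  unfolding modulus_def
  by (rule cSUP_upper2[where x = h])
     (use assms bdd_above_fin_diff[OF assms(1)] in
       \<open>auto intro!: cSUP_upper2[where x = x] simp: fin_diff_eq_fdiff\<close>)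

lemma modulus_le:
  fixes f :: "real^'d \<Rightarrow> real"
  assumes "r \<ge> 0" "\<And>h x. norm h \<le> r \<Longrightarrow> \<bar>fdiff h M f x\<bar> \<le> B"
  shows "modulus M f r \<le> B"
  unfolding modulus_def
  by (intro cSUP_least) (use assms in \<open>auto simp: fin_diff_eq_fdiff intro!: exI[of _ 0]\<close>)

lemma modulus_mono:
  fixes f :: "real^'d \<Rightarrow> real"
  assumes "bounded (range f)" "0 \<le> r" "r \<le> s"
  shows "modulus M f r \<le> modulus M f s"
  by (rule modulus_le) (use assms in \<open>auto intro!: fdiff_le_modulus\<close>)

lemma modulus_power2:
  fixes f :: "real^'d \<Rightarrow> real"
  assumes "bounded (range f)" "0 \<le> r"
  shows "modulus M f (2 ^ n * r) \<le> 2 ^ (n * M) * modulus M f r"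
proof (rule modulus_le)
  fix h x :: "real^'d"
  assume "norm h \<le> 2 ^ n * r"
  then have "norm ((1 / 2 ^ n) *\<^sub>R h) \<le> r" by (simp add: field_simps)
  from abs_fdiff_step_power2[OF fdiff_le_modulus[OF assms(1) this], of n M x]
  show "\<bar>fdiff h M f x\<bar> \<le> 2 ^ (n * M) * modulus M f r" by simp
qed (use assms in auto)

text \<open>The hypothesis bounds differences of order \<open>nat \<lfloor>a'\<rfloor> + 1\<close>
  at small steps. Boundedness of \<open>f\<close> extends the estimate to all steps, and Marchaud's
  argument lowers the order to 1, for which the exponent must lie below 1.\<close>

lemma uniformly_Hoelderian_imp_Hoelder:
  fixes f :: "real^'d \<Rightarrow> real"
  assumes "uniformly_Hoelderian f"
  obtains a K where "0 < a" "a < 1" "K > 0" "\<And>x h. \<bar>f (x + h) - f x\<bar> \<le> K * norm h powr a"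
proof -
  obtain a' C R where a': "bounded (range f)" "a' > 0" "C > 0" "R > 0"
    and mod: "\<And>r. 0 < r \<Longrightarrow> r \<le> R \<Longrightarrow> modulus (nat \<lfloor>a'\<rfloor> + 1) f r \<le> C * r powr a'"
    using assms unfolding uniformly_Hoelderian_def by blast
  obtain B where B: "\<And>x. \<bar>f x\<bar> \<le> B" using a'(1) by (auto simp: bounded_iff)
  have "0 \<le> B" using B[of 0] by linarith
  define m where "m = nat \<lfloor>a'\<rfloor> + 1"
  \<comment> \<open>Any bound in the open interval from 0 to 1 would do in place of
    \<open>1/2\<close>. Lowering the exponent weakens the estimate, as it is used only for steps of
    norm at most \<open>r0 \<le> 1\<close>.\<close>
  define a where "a = min a' (1/2)"
  define r0 where "r0 = min R 1"
  have r0: "0 < r0" "r0 \<le> R" "r0 \<le> 1" using a' by (auto simp: r0_def)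
  have a: "0 < a" "a < 1" "a \<le> a'" using a' by (auto simp: a_def)
  \<comment> \<open>The first summand serves the steps up to \<open>r0\<close>, the second the
    larger ones, where the trivial bound \<open>2 ^ m * B\<close> is compared with
    \<open>r0 powr a\<close>.\<close>
  define C' where "C' = C + 2 ^ m * B / r0 powr a"
  have C': "C' > 0" unfolding C'_def using a' \<open>0 \<le> B\<close> r0 by (intro add_pos_nonneg) auto
  have "\<bar>fdiff h m f x\<bar> \<le> C' * norm h powr a" for h x
  proof (cases "h = 0")
    case True
    \<comment> \<open>The zero step is separate because the hypothesis only covers positive radii,
      while \<open>0 powr a\<close> is 0.\<close>
    have "fdiff 0 m f x = 0" unfolding m_def using fdiff_cmult[of 0 "nat \<lfloor>a'\<rfloor>" 0 f x] by simp
    then show ?thesis using True by simp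
  next
    case False
    show ?thesis
    proof (cases "norm h \<le> r0")
      case True
      have "\<bar>fdiff h m f x\<bar> \<le> modulus m f (norm h)" by (rule fdiff_le_modulus[OF a'(1)]) simp
      also have "\<dots> \<le> C * norm h powr a'" unfolding m_def using True False r0 by (intro mod) auto
      also have "\<dots> \<le> C' * norm h powr a"
        unfolding C'_def using True r0 a a' \<open>0 \<le> B\<close> by (intro mult_mono powr_mono') auto
      finally show ?thesis .
    next
      case False
      have "\<bar>fdiff h m f x\<bar> \<le> 2 ^ m * B" using abs_fdiff_le[of f B] B by blast
      also have "\<dots> = 2 ^ m * B / r0 powr a * r0 powr a" using r0 by simp
      also have "\<dots> \<le> C' * norm h powr a"
        unfolding C'_def using False r0 a a' \<open>0 \<le> B\<close> by (intro mult_mono powr_mono2) auto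
      finally show ?thesis .
    qed
  qed
  moreover have "m \<ge> 1" by (simp add: m_def)
  ultimately obtain K where K: "\<And>h x. \<bar>f (x + h) - f x\<bar> \<le> K * norm h powr a"
    using fdiff_order_reduce_to_1[of f, OF B _ a(1,2)] by blast
  show ?thesis
  proof (rule that[OF a(1,2), of "\<bar>K\<bar> + 1"])
    show "\<bar>f (x + h) - f x\<bar> \<le> (\<bar>K\<bar> + 1) * norm h powr a" for x h
      by (rule order_trans[OF K mult_right_mono]) auto
  qed simp
qed

section \<open>Integration\<close>

lemma
  fixes f :: "'a::euclidean_space \<Rightarrow> real"
  assumes c: "c \<noteq> 0" and f [measurable]: "f \<in> borel_measurable lebesgue"
  shows borel_measurable_affine: "(\<lambda>x. f (t + c *\<^sub>R x)) \<in> borel_measurable lebesgue"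
    and integrable_affine_iff: "integrable lebesgue (\<lambda>x. f (t + c *\<^sub>R x)) \<longleftrightarrow> integrable lebesgue f"
    and integral_affine: "\<bar>c\<bar> ^ DIM('a) * (\<integral>x. f (t + c *\<^sub>R x) \<partial>lebesgue) = (\<integral>x. f x \<partial>lebesgue)"
proof -
  have T: "(\<lambda>x::'a. t + (\<Sum>j\<in>Basis. (c * (x \<bullet> j)) *\<^sub>R j)) = (\<lambda>x. t + c *\<^sub>R x)"
    by (auto simp: euclidean_representation simp flip: scaleR_scaleR scaleR_sum_right)
  note * = lebesgue_affine_euclidean[of "\<lambda>_. c" t, unfolded T]
  have [measurable]: "(\<lambda>x. t + c *\<^sub>R x) \<in> lebesgue \<rightarrow>\<^sub>M (lebesgue :: 'a measure)"
    using lebesgue_affine_measurable[of "\<lambda>_. c" t] c unfolding T by simp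
  show "(\<lambda>x. f (t + c *\<^sub>R x)) \<in> borel_measurable lebesgue" by measurable
  have eq: "lebesgue = density (distr lebesgue lebesgue (\<lambda>x::'a. t + c *\<^sub>R x)) (\<lambda>_. ennreal (\<bar>c\<bar> ^ DIM('a)))"
    using * c by simp
  show "integrable lebesgue (\<lambda>x. f (t + c *\<^sub>R x)) \<longleftrightarrow> integrable lebesgue f"
    using c by (subst (2) eq) (simp add: integrable_density integrable_distr_eq)
  show "\<bar>c\<bar> ^ DIM('a) * (\<integral>x. f (t + c *\<^sub>R x) \<partial>lebesgue) = (\<integral>x. f x \<partial>lebesgue)"
    using c by (subst (2) eq) (simp add: integral_density integral_distr)
qed

lemmas
  integrable_affine_iff_real = integrable_affine_iff[where 'a = real, simplified] and
  integral_affine_real = integral_affine[where 'a = real, simplified]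

lemma continuous_imp_lebesgue_measurable:
  fixes f :: "'a::euclidean_space \<Rightarrow> real"
  shows "continuous_on UNIV f \<Longrightarrow> f \<in> borel_measurable lebesgue"
  by (intro measurable_completion) (simp add: borel_measurable_continuous_onI)

lemma
  fixes g :: "'d::finite \<Rightarrow> real \<Rightarrow> real"
  assumes g: "\<And>m. g m \<in> borel_measurable borel" "\<And>m. integrable lebesgue (g m)"
  shows integrable_prod_vec: "integrable lebesgue (\<lambda>x::real^'d. \<Prod>m\<in>UNIV. g m (x $ m))"
    and integral_prod_vec: "(\<integral>x. (\<Prod>m\<in>UNIV. g m ((x::real^'d) $ m)) \<partial>lebesgue) = (\<Prod>m\<in>UNIV. \<integral>x. g m x \<partial>lebesgue)"
proof -
  interpret product_sigma_finite "\<lambda>_::real^'d. lborel :: real measure" ..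
  \<comment> \<open>\<open>lborel_eq\<close> presents Lebesgue measure as the image of a product
    measure over \<open>Basis\<close>, so the factors are reindexed from coordinates to basis
    vectors.\<close>
  define h where "h b = g (SOME m. axis m 1 = b)" for b :: "real^'d"
  have h: "h (axis m 1) = g m" for m by (simp add: h_def axis_eq_axis)
  have Basis: "(Basis :: (real^'d) set) = range (\<lambda>m. axis m 1)" by (auto simp: Basis_vec_def)
  have inj: "inj (\<lambda>m::'d. axis m (1::real))" by (auto simp: inj_on_def axis_eq_axis)
  have prod_Basis: "(\<Prod>b\<in>Basis. F b) = (\<Prod>m\<in>UNIV. F (axis m 1))" for F :: "real^'d \<Rightarrow> real"
    unfolding Basis by (subst prod.reindex[OF inj]) simp
  have hb: "h b \<in> borel_measurable borel" for b unfolding h_def by (rule g(1))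
  have gi: "integrable lborel (g m)" for m using g by (simp add: integrable_completion)
  have hi: "integrable lborel (h b)" for b unfolding h_def by (rule gi)
  have eq: "(\<lambda>x::real^'d. \<Prod>m\<in>UNIV. g m (x $ m)) = (\<lambda>x. \<Prod>b\<in>Basis. h b (x \<bullet> b))"
    by (simp add: prod_Basis h inner_axis)
  have meas: "(\<lambda>x::real^'d. \<Prod>b\<in>Basis. h b (x \<bullet> b)) \<in> borel_measurable borel"
    using hb by measurable
  have simp: "(\<Prod>b\<in>Basis. h b ((\<Sum>b\<in>Basis. f b *\<^sub>R b) \<bullet> b)) = (\<Prod>b\<in>Basis. h b (f b))" for f :: "real^'d \<Rightarrow> real"
    by (intro prod.cong) (auto simp: inner_sum_left_Basis)
  show "integrable lebesgue (\<lambda>x::real^'d. \<Prod>m\<in>UNIV. g m (x $ m))"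
    unfolding eq integrable_completion[of _ lborel, simplified, OF meas]
    by (subst lborel_eq, subst integrable_distr_eq)
       (use meas product_integrable_prod[of Basis h] hi in \<open>simp_all add: simp\<close>)
  have "(\<integral>x. (\<Prod>m\<in>UNIV. g m ((x::real^'d) $ m)) \<partial>lebesgue) = (\<Prod>b\<in>Basis. \<integral>x. h b x \<partial>lborel)"
    unfolding eq integral_completion[of _ lborel, simplified, OF meas]
    by (subst lborel_eq, subst integral_distr)
       (use meas product_integral_prod[of Basis h] hi in \<open>simp_all add: simp\<close>)
  also have "\<dots> = (\<Prod>m\<in>UNIV. \<integral>x. g m x \<partial>lebesgue)"
    unfolding prod_Basis h by (simp add: integral_completion g(1))
  finally show "(\<integral>x. (\<Prod>m\<in>UNIV. g m ((x::real^'d) $ m)) \<partial>lebesgue) = (\<Prod>m\<in>UNIV. \<integral>x. g m x \<partial>lebesgue)" .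
qed

section \<open>A summable weight\<close>

text \<open>This weight is integrable, at most 1, and satisfies
  \<open>wt x * wt y \<le> wt (x + y)\<close>. Its powers measure fast decay; in an estimate one
  power can be summed or integrated while the others are moved from one point to another.\<close>

definition wt :: "real \<Rightarrow> real" where
  "wt x = 1 / (1 + \<bar>x\<bar>)\<^sup>2"

lemma wt_pos [simp]: "0 < wt x" and wt_nonneg [simp]: "0 \<le> wt x" and wt_le_1: "wt x \<le> 1"
  by (auto simp: wt_def intro!: divide_pos_pos zero_less_power)

lemma wt_minus [simp]: "wt (- x) = wt x"
  by (simp add: wt_def)

lemma wt_minus_commute: "wt (x - y) = wt (y - x)"
  by (simp add: wt_def abs_minus_commute)

lemma wt_mult_le: "wt x * wt y \<le> wt (x + y)"
proof -
  have "1 + \<bar>x + y\<bar> \<le> (1 + \<bar>x\<bar>) * (1 + \<bar>y\<bar>)"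
    using abs_triangle_ineq[of x y] mult_nonneg_nonneg[OF abs_ge_zero[of x] abs_ge_zero[of y]]
    unfolding distrib_left distrib_right by linarith
  then have "(1 + \<bar>x + y\<bar>)\<^sup>2 \<le> ((1 + \<bar>x\<bar>) * (1 + \<bar>y\<bar>))\<^sup>2" by (intro power_mono) auto
  then show ?thesis unfolding wt_def by (simp add: power_mult_distrib) (auto intro!: divide_left_mono mult_pos_pos zero_less_power)
qed

lemma wt_triangle: "wt (x - y) * wt (y - z) \<le> wt (x - z)"
  using wt_mult_le[of "x - y" "y - z"] by simp

lemma wt_le_shift: "wt x \<le> wt (x + y) * (1 + \<bar>y\<bar>)\<^sup>2"
  using wt_mult_le[of "x + y" "-y"] wt_mult_le[of x y] by (simp add: wt_def field_simps)

lemma continuous_wt [continuous_intros]: "continuous_on S g \<Longrightarrow> continuous_on S (\<lambda>x. wt (g x))"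
  unfolding wt_def by (intro continuous_intros) auto

lemma integrable_wt_0: "integrable lebesgue wt"
proof -
  have [measurable]: "wt \<in> borel_measurable borel"
    by (rule borel_measurable_continuous_onI) (rule continuous_wt, rule continuous_on_id)
  \<comment> \<open>An antiderivative of \<open>wt\<close>, valid also at 0, whose finite limits at
    both ends yield integrability.\<close>
  have "((\<lambda>x. x / (1 + \<bar>x\<bar>)) has_real_derivative wt x) (at x)" for x :: real
  proof (cases x "0::real" rule: linorder_cases)
    case equal
    have "((\<lambda>y::real. 1 / (1 + \<bar>y\<bar>)) \<longlongrightarrow> 1 / (1 + \<bar>0\<bar>)) (at 0)"
      by (intro tendsto_intros) auto
    then have "((\<lambda>y::real. y / (1 + \<bar>y\<bar>) / y) \<longlongrightarrow> 1) (at 0)"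
      using Lim_transform_eventually[of "\<lambda>y::real. 1 / (1 + \<bar>y\<bar>)" 1 "at 0" "\<lambda>y. y / (1 + \<bar>y\<bar>) / y"]
      by (simp add: eventually_at_filter)
    then show ?thesis unfolding equal by (simp add: wt_def has_field_derivative_iff)
  next
    case less
    have "((\<lambda>x. x / (1 - x)) has_real_derivative wt x) (at x)"
      using less by (auto intro!: derivative_eq_intros simp: wt_def power2_eq_square)
    then show ?thesis
      by (rule has_field_derivative_transform_within_open[where S = "{..<0}"]) (use less in auto)
  next
    case greater
    have "((\<lambda>x. x / (1 + x)) has_real_derivative wt x) (at x)"
      using greater by (auto intro!: derivative_eq_intros simp: wt_def power2_eq_square)
    then show ?thesis
      by (rule has_field_derivative_transform_within_open[where S = "{0<..}"]) (use greater in auto)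
  qed
  moreover have "((\<lambda>x::real. x / (1 + \<bar>x\<bar>)) \<longlongrightarrow> 1) at_top" "((\<lambda>x::real. x / (1 + \<bar>x\<bar>)) \<longlongrightarrow> -1) at_bot"
    by real_asymp+
  ultimately have "set_integrable lborel (einterval (-\<infinity>) \<infinity>) wt"
    by (intro interval_integral_FTC_nonneg[where F = "\<lambda>x. x / (1 + \<bar>x\<bar>)" and A = "-1" and B = 1])
       (auto simp: ereal_tendsto_simps continuous_on_eq_continuous_at[symmetric]
          intro!: continuous_on_interior[of UNIV wt] continuous_wt continuous_on_id)
  then show ?thesis by (simp add: set_integrable_def integrable_completion)
qed

lemma integrable_wt: "integrable lebesgue (\<lambda>x. wt (x - a))"
  using integrable_affine_iff_real[of 1 wt "-a"] integrable_wt_0 by (simp add: borel_measurable_integrable)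

definition wt_int :: real where "wt_int = (\<integral>x. wt x \<partial>lebesgue)"

lemma integral_wt: "(\<integral>x. wt (x - a) \<partial>lebesgue) = wt_int"
  using integral_affine_real[of 1 wt "-a"] integrable_wt_0 by (simp add: borel_measurable_integrable wt_int_def)

text \<open>Comparison with the integral: the cells from \<open>k\<close> to \<open>k + 1\<close>
  are disjoint, and within a cell of length 1 the weight changes at most by the factor
  \<open>(1 + 1) ^ 2 = 4\<close>.\<close>

lemma sum_wt_le:
  fixes A :: "int set"
  assumes "finite A"
  shows "(\<Sum>k\<in>A. wt (x - of_int k)) \<le> 4 * wt_int"
proof -
  let ?I = "\<lambda>k y. indicator {real_of_int k..<real_of_int k + 1} y :: real"
  have int: "integrable lebesgue (?I k)" for k by simp
  have "(\<Sum>k\<in>A. wt (x - of_int k)) = (\<Sum>k\<in>A. wt (x - of_int k) * (\<integral>y. ?I k y \<partial>lebesgue))"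
    by simp
  also have "\<dots> = (\<integral>y. (\<Sum>k\<in>A. wt (x - of_int k) * ?I k y) \<partial>lebesgue)"
    by (subst Bochner_Integration.integral_sum) (auto intro!: integrable_mult_right int)
  also have "\<dots> \<le> (\<integral>y. 4 * wt (y - x) \<partial>lebesgue)"
  proof (rule integral_mono)
    fix y
    have le: "wt (x - of_int k) * ?I k y \<le> 4 * wt (y - x)" if "k = \<lfloor>y\<rfloor>" for k
    proof -
      have "wt (x - of_int k) \<le> wt (x - y) * (1 + \<bar>y - of_int k\<bar>)\<^sup>2 "
        using wt_le_shift[of "x - of_int k" "of_int k - y"] by (simp add: abs_minus_commute)
      also have "\<dots> \<le> wt (x - y) * 2\<^sup>2"
        using that by (intro mult_left_mono power_mono) (auto, linarith)
      finally show ?thesis by (auto simp: indicator_def wt_minus_commute)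
    qed
    have "(\<Sum>k\<in>A. wt (x - of_int k) * ?I k y) = (\<Sum>k\<in>A \<inter> {\<lfloor>y\<rfloor>}. wt (x - of_int k) * ?I k y)"
      by (rule sum.mono_neutral_right) (use assms in \<open>auto simp: indicator_def eq_commute[of _ "\<lfloor>y\<rfloor>"] floor_eq_iff\<close>)
    also have "\<dots> \<le> 4 * wt (y - x)"
      using le[OF refl] by (cases "\<lfloor>y\<rfloor> \<in> A") (auto simp: Int_insert_right)
    finally show "(\<Sum>k\<in>A. wt (x - of_int k) * ?I k y) \<le> 4 * wt (y - x)" .
  qed (auto intro!: Bochner_Integration.integrable_sum integrable_mult_right int integrable_wt)
  finally show ?thesis by (simp add: integral_wt)
qed

lemma wt_int_nonneg: "0 \<le> wt_int"
  using sum_wt_le[of "{0}" 0, simplified] wt_nonneg[of 0] by linarith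

definition rapid :: "(real \<Rightarrow> real) \<Rightarrow> bool" where
  "rapid u \<longleftrightarrow> (\<forall>N. \<exists>C. \<forall>x. \<bar>u x\<bar> \<le> C * wt x ^ N)"

lemma rapidD:
  assumes "rapid u" obtains C where "C > 0" "\<And>x. \<bar>u x\<bar> \<le> C * wt x ^ N"
proof -
  obtain C where C: "\<And>x. \<bar>u x\<bar> \<le> C * wt x ^ N" using assms unfolding rapid_def by blast
  show ?thesis
  proof (rule that[of "\<bar>C\<bar> + 1"])
    show "\<bar>u x\<bar> \<le> (\<bar>C\<bar> + 1) * wt x ^ N" for x
      by (rule order_trans[OF C mult_right_mono]) auto
  qed simp
qed

lemma rapid_bounded: assumes "rapid u" obtains C where "C > 0" "\<And>x. \<bar>u x\<bar> \<le> C"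
  using rapidD[OF assms, of 0] by auto

lemma rapidI: "(\<And>N. \<exists>C. \<forall>x. \<bar>u x\<bar> \<le> C * wt x ^ N) \<Longrightarrow> rapid u"
  by (auto simp: rapid_def)

lemma rapid_mult_bounded_wt:
  assumes "rapid u" "\<And>x. \<bar>v x\<bar> * wt x ^ n \<le> B"
  shows "rapid (\<lambda>x. u x * v x)"
proof (rule rapidI)
  fix N
  obtain C where C: "C > 0" "\<And>x. \<bar>u x\<bar> \<le> C * wt x ^ (N + n)" using rapidD[OF assms(1)] by blast
  have "\<bar>u x * v x\<bar> \<le> (C * B) * wt x ^ N" for x
  proof -
    have "\<bar>u x * v x\<bar> \<le> C * wt x ^ (N + n) * \<bar>v x\<bar>"
      unfolding abs_mult using C(2) by (intro mult_right_mono) auto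
    also have "\<dots> = C * wt x ^ N * (\<bar>v x\<bar> * wt x ^ n)" by (simp add: power_add)
    also have "\<dots> \<le> C * wt x ^ N * B" using C assms(2) by (intro mult_left_mono) auto
    finally show ?thesis by (simp add: mult_ac)
  qed
  then show "\<exists>C. \<forall>x. \<bar>u x * v x\<bar> \<le> C * wt x ^ N" by blast
qed

lemma rapid_mult_power: "rapid u \<Longrightarrow> rapid (\<lambda>x. x ^ n * u x)"
proof -
  assume u: "rapid u"
  have "\<bar>x ^ n\<bar> * wt x ^ n \<le> 1" for x :: real
  proof -
    have "\<bar>x\<bar> \<le> (1 + \<bar>x\<bar>)\<^sup>2" by (simp add: power2_sum add_increasing)
    then have "\<bar>x\<bar> * wt x \<le> 1" by (simp add: wt_def divide_le_eq_1_pos)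
    then have "(\<bar>x\<bar> * wt x) ^ n \<le> 1" by (intro power_le_one) auto
    then show ?thesis by (simp add: power_mult_distrib power_abs)
  qed
  from rapid_mult_bounded_wt[OF u this] show ?thesis by (simp add: mult.commute)
qed

lemma rapid_imp_integrable:
  assumes "rapid u" "continuous_on UNIV u"
  shows "integrable lebesgue u"
proof -
  obtain C where C: "C > 0" "\<And>x. \<bar>u x\<bar> \<le> C * wt x ^ 1" using rapidD[OF assms(1)] by blast
  show ?thesis
    by (rule Bochner_Integration.integrable_bound[OF integrable_mult_right[OF integrable_wt_0, of C]])
       (use C assms in \<open>auto intro!: continuous_imp_lebesgue_measurable simp: abs_mult\<close>)
qed

lemma rapid_tendsto_0:
  assumes "rapid u" shows "(u \<longlongrightarrow> 0) at_top" "(u \<longlongrightarrow> 0) at_bot"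
proof -
  obtain C where C: "C > 0" "\<And>x. \<bar>u x\<bar> \<le> C * wt x ^ 1" using rapidD[OF assms(1)] by blast
  have *: "((\<lambda>x. C * wt x) \<longlongrightarrow> 0) at_top" "((\<lambda>x. C * wt x) \<longlongrightarrow> 0) at_bot"
    unfolding wt_def by real_asymp+
  show "(u \<longlongrightarrow> 0) at_top" "(u \<longlongrightarrow> 0) at_bot"
    by (rule Lim_null_comparison[OF _ *(1)], use C in auto)(rule Lim_null_comparison[OF _ *(2)], use C in auto)
qed

section \<open>One-dimensional regularity\<close>

text \<open>For \<open>v = u\<close> this is the tensor product with all factors equal to
  \<open>u\<close>. Partial derivatives in direction \<open>m\<close> change only \<open>v\<close>,
  so the regularity of \<open>u\<close> on the line can be read off from that of the
  product.\<close>

definition ridge :: "(real \<Rightarrow> real) \<Rightarrow> 'd \<Rightarrow> (real \<Rightarrow> real) \<Rightarrow> real^'d \<Rightarrow> real" where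
  "ridge u m v x = v (x $ m) * (\<Prod>i\<in>UNIV - {m}. u (x $ i))"

lemma tensor_eq_ridge:
  fixes i :: "bool^'d"
  shows "tensor \<phi> \<psi> (\<chi> _. b) = ridge (if b then \<psi> else \<phi>) m (if b then \<psi> else \<phi>)"
  unfolding tensor_def ridge_def by (rule ext) (simp add: prod.remove[of UNIV m])

lemma ridge_line: "ridge u m v (x + t *\<^sub>R axis m 1) = v (x $ m + t) * (\<Prod>i\<in>UNIV - {m}. u (x $ i))"
  unfolding ridge_def by (auto intro!: arg_cong2[of _ _ _ _ "(*)"] prod.cong simp: axis_def)

lemma partial_deriv_ridge:
  assumes "\<And>x. v differentiable (at x)"
  shows "partial_deriv m (ridge u m v) = ridge u m (deriv v)"
proof
  fix x
  have "(v has_real_derivative deriv v (x $ m)) (at (x $ m))"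
    using assms DERIV_deriv_iff_real_differentiable by blast
  then have "((\<lambda>t. v (x $ m + t)) has_real_derivative deriv v (x $ m)) (at 0)"
    using DERIV_shift[of v "deriv v (x $ m)" 0 "x $ m"] by (simp add: add.commute)
  then have "((\<lambda>t. ridge u m v (x + t *\<^sub>R axis m 1)) has_real_derivative ridge u m (deriv v) x) (at 0)"
    unfolding ridge_line ridge_def[of u m "deriv v"] by (rule DERIV_cmult_right)
  then show "partial_deriv m (ridge u m v) x = ridge u m (deriv v) x"
    unfolding partial_deriv_def by (rule DERIV_imp_deriv)
qed

text \<open>Freezing the other coordinates at a point where \<open>u\<close> does not vanish leaves
  \<open>v\<close> times a nonzero constant.\<close>

lemma continuous_ridgeD:
  fixes m :: "'d::finite"
  assumes "u a \<noteq> 0" "continuous_on UNIV (ridge u m v)"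
  shows "continuous_on UNIV v"
proof -
  have "continuous_on UNIV (\<lambda>t. (\<chi> i. if i = m then t else a) :: real^'d)"
  proof (rule continuous_on_vec_lambda)
    show "continuous_on UNIV (\<lambda>t. if i = m then t else a)" for i by (cases "i = m") auto
  qed
  with assms(2) have "continuous_on UNIV (\<lambda>t. ridge u m v (\<chi> i. if i = m then t else a))"
    by (rule continuous_on_compose2) auto
  also have "(\<lambda>t. ridge u m v (\<chi> i. if i = m then t else a)) = (\<lambda>t. v t * u a ^ card (UNIV - {m}))"
    by (auto simp: ridge_def)
  finally have "continuous_on UNIV (\<lambda>t. v t * u a ^ card (UNIV - {m}) / u a ^ card (UNIV - {m}))"
    by (intro continuous_on_divide continuous_on_const) (use assms(1) in auto)
  then show ?thesis using assms(1) by simp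
qed

text \<open>Differentiation in direction \<open>m\<close> acts on \<open>v\<close> alone, so the
  induction passes from \<open>v\<close> to \<open>deriv v\<close>. Differentiability of
  \<open>v\<close> is obtained on a line parallel to the axis on which the product of the other
  factors is a nonzero constant.\<close>

lemma C_k_ridge:
  fixes m :: "'d::finite"
  assumes "u a \<noteq> 0" "C_k n (ridge u m v)"
  shows "(\<forall>i\<le>n. continuous_on UNIV ((deriv ^^ i) v)
      \<and> partial_derivs (replicate i m) (ridge u m v) = ridge u m ((deriv ^^ i) v))
    \<and> (\<forall>i<n. \<forall>x. ((deriv ^^ i) v has_real_derivative (deriv ^^ Suc i) v x) (at x))"
  using assms(2)
proof (induction n arbitrary: v)
  case (0 v)
  then show ?case using continuous_ridgeD[of u a m v, OF assms(1)] by simp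
next
  case (Suc n v)
  have cont: "continuous_on UNIV v"
    using continuous_ridgeD[of u a m v, OF assms(1)] Suc.prems by simp
  have diff: "v differentiable (at x)" for x
  proof -
    let ?X = "\<chi> i. if i = m then x else a" and ?c = "u a ^ card (UNIV - {m})"
    have "(\<lambda>t. ridge u m v (?X + t *\<^sub>R axis m 1)) differentiable (at 0)"
      using Suc.prems by auto
    then have "(\<lambda>t. v (x + t) * ?c) differentiable (at 0)" unfolding ridge_line by simp
    then have "(\<lambda>t. v (x + t) * ?c * (1 / ?c)) differentiable (at 0)" by (rule differentiable_mult) simp
    then have "(\<lambda>t. v (x + t)) differentiable (at 0)" using assms(1) by simp
    then obtain D where "((\<lambda>t. v (x + t)) has_real_derivative D) (at 0)"
      by (auto simp: real_differentiable_def)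
    then have "(v has_real_derivative D) (at x)"
      using DERIV_shift[of v D 0 x] by (simp add: add.commute)
    then show ?thesis by (auto simp: real_differentiable_def)
  qed
  have pd: "partial_deriv m (ridge u m v) = ridge u m (deriv v)" by (rule partial_deriv_ridge[OF diff])
  have Ck': "C_k n (ridge u m (deriv v))" using Suc.prems unfolding pd[symmetric] by auto
  have fs: "(deriv ^^ Suc i) w = (deriv ^^ i) (deriv w)" for i w by (simp only: funpow_Suc_right o_apply)
  from Suc.IH[OF Ck'] have IH:
    "\<And>i. i \<le> n \<Longrightarrow> continuous_on UNIV ((deriv ^^ Suc i) v)"
    "\<And>i. i \<le> n \<Longrightarrow> partial_derivs (replicate i m) (ridge u m (deriv v)) = ridge u m ((deriv ^^ Suc i) v)"
    "\<And>i x. i < n \<Longrightarrow> ((deriv ^^ Suc i) v has_real_derivative (deriv ^^ Suc (Suc i)) v x) (at x)"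
    unfolding fs by blast+
  have D0: "(v has_real_derivative deriv v x) (at x)" for x
    using diff DERIV_deriv_iff_real_differentiable by blast
  show ?case
  proof (intro conjI allI impI)
    fix i assume "i \<le> Suc n"
    then show "continuous_on UNIV ((deriv ^^ i) v)" using IH(1)[of "i - 1"] cont by (cases i) auto
    show "partial_derivs (replicate i m) (ridge u m v) = ridge u m ((deriv ^^ i) v)"
      using \<open>i \<le> Suc n\<close> IH(2)[of "i - 1"] by (cases i) (auto simp: pd)
  next
    fix i x assume "i < Suc n"
    then show "((deriv ^^ i) v has_real_derivative (deriv ^^ Suc i) v x) (at x)"
      using IH(3)[of "i - 1" x] D0 by (cases i) auto
  qed
qed

lemma fast_decay_ridge:
  fixes m :: "'d::finite"
  assumes "u a \<noteq> 0" "fast_decay (ridge u m v)"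
  shows "rapid v"
proof (rule rapidI)
  fix N
  obtain C where C: "\<And>x. \<bar>ridge u m v x\<bar> \<le> C / (1 + norm x) ^ (2 * N)"
    using assms(2) unfolding fast_decay_def by blast
  let ?c = "\<bar>u a\<bar> ^ card (UNIV - {m})"
  have c: "?c > 0" using assms(1) by simp
  have "0 \<le> C" using order_trans[OF abs_ge_zero C[of 0]] by simp
  have "\<bar>v t\<bar> \<le> (C / ?c) * wt t ^ N" for t
  proof -
    let ?x = "(\<chi> i. if i = m then t else a) :: real^'d"
    have "\<bar>t\<bar> \<le> norm ?x" using component_le_norm_cart[of ?x m] by simp
    have "\<bar>v t\<bar> * ?c = \<bar>ridge u m v ?x\<bar>" by (simp add: ridge_def abs_mult power_abs)
    also have "\<dots> \<le> C / (1 + norm ?x) ^ (2 * N)" by (rule C)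
    also have "\<dots> \<le> C / (1 + \<bar>t\<bar>) ^ (2 * N)"
      using \<open>0 \<le> C\<close> \<open>\<bar>t\<bar> \<le> norm ?x\<close> by (intro divide_left_mono power_mono) (auto intro!: mult_pos_pos zero_less_power add_pos_nonneg)
    also have "\<dots> = C * wt t ^ N" by (simp add: wt_def power_mult power_divide)
    finally show ?thesis using c by (simp add: field_simps)
  qed
  then show "\<exists>C. \<forall>x. \<bar>v x\<bar> \<le> C * wt x ^ N" by blast
qed

text \<open>\<open>deriv\<close> is total, so the existence of the derivatives is required
  separately. The derivative of order \<open>M\<close> itself only has to be continuous and rapidly
  decaying.\<close>

definition smooth_rapid :: "nat \<Rightarrow> (real \<Rightarrow> real) \<Rightarrow> bool" where
  "smooth_rapid M u \<longleftrightarrow> (\<forall>n\<le>M. rapid ((deriv ^^ n) u) \<and> continuous_on UNIV ((deriv ^^ n) u)) \<and>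
     (\<forall>n<M. \<forall>x. ((deriv ^^ n) u has_real_derivative (deriv ^^ Suc n) u x) (at x))"

lemma smooth_rapidD:
  assumes "smooth_rapid M u"
  shows "n \<le> M \<Longrightarrow> rapid ((deriv ^^ n) u)" "n \<le> M \<Longrightarrow> continuous_on UNIV ((deriv ^^ n) u)"
    "n < M \<Longrightarrow> ((deriv ^^ n) u has_real_derivative (deriv ^^ Suc n) u x) (at x)"
    "rapid u" "continuous_on UNIV u"
proof -
  have "rapid ((deriv ^^ 0) u)" "continuous_on UNIV ((deriv ^^ 0) u)"
    using assms unfolding smooth_rapid_def by blast+
  then show "rapid u" "continuous_on UNIV u" by auto
qed (use assms in \<open>auto simp: smooth_rapid_def\<close>)

text \<open>The index with all entries equal to \<open>b\<close> yields a product of copies of the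
  single function \<open>u\<close> in different variables, and the regularity of this product in one
  direction is that of \<open>u\<close>. The condition \<gamma> > M covers the derivatives up to
  order \<open>M\<close>.\<close>

lemma smooth_rapid_tensor_factor:
  fixes \<phi> \<psi> :: "real \<Rightarrow> real"
  assumes "regular_wavelets TYPE('d::finite) \<gamma> \<phi> \<psi>" "\<gamma> > real M"
    and u: "u = (if b then \<psi> else \<phi>)" "u a \<noteq> 0"
  shows "smooth_rapid M u"
proof -
  define m :: 'd where "m = undefined"
  let ?i = "(\<chi> _. b) :: bool^'d"
  have t: "tensor \<phi> \<psi> ?i = ridge u m u" unfolding u(1) by (rule tensor_eq_ridge)
  define n where "n = nat \<lfloor>\<gamma>\<rfloor>"
  have n: "M \<le> n" using assms(2) unfolding n_def by linarith
  have "C_k n (ridge u m u)"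
    using assms(1) unfolding regular_wavelets_def C_gamma_def n_def t[symmetric] by blast
  note C = C_k_ridge[OF u(2) this]
  have "rapid ((deriv ^^ i) u)" if "i \<le> M" for i
  proof -
    have "fast_decay (partial_derivs (replicate i m) (ridge u m u))"
      using assms(1,2) that unfolding regular_wavelets_def t[symmetric] by auto
    moreover have "partial_derivs (replicate i m) (ridge u m u) = ridge u m ((deriv ^^ i) u)"
      using C that n by auto
    ultimately show ?thesis using fast_decay_ridge[of u a] u(2) by simp
  qed
  then show ?thesis using C n unfolding smooth_rapid_def by auto
qed

section \<open>Orthogonal expansions\<close>

lemma L2_mult_integrable:
  assumes "g \<in> L2" "h \<in> L2"
  shows "integrable lebesgue (\<lambda>x. g x * h x)"
proof (rule Bochner_Integration.integrable_bound)
  show "integrable lebesgue (\<lambda>x. (g x)\<^sup>2 + (h x)\<^sup>2)"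
    using assms by (auto simp: L2_def)
  show "(\<lambda>x. g x * h x) \<in> borel_measurable lebesgue"
    using assms by (auto simp: L2_def)
  have "\<bar>a * b\<bar> \<le> a\<^sup>2 + b\<^sup>2" for a b :: real
    using sum_squares_bound[of "\<bar>a\<bar>" "\<bar>b\<bar>"] abs_ge_zero[of "a * b"] unfolding abs_mult power2_abs by linarith
  then show "AE x in lebesgue. norm (g x * h x) \<le> norm ((g x)\<^sup>2 + (h x)\<^sup>2)"
    by (auto intro!: always_eventually)
qed

lemma L2_add: "g \<in> L2 \<Longrightarrow> h \<in> L2 \<Longrightarrow> (\<lambda>x. g x + h x) \<in> L2"
  using L2_mult_integrable[of g h]
  by (auto simp: L2_def power2_sum intro!: Bochner_Integration.integrable_add integrable_mult_right simp: mult.assoc)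

lemma L2_cmult: "g \<in> L2 \<Longrightarrow> (\<lambda>x. a * g x) \<in> L2"
  by (auto simp: L2_def power_mult_distrib)

lemma L2_diff: "g \<in> L2 \<Longrightarrow> h \<in> L2 \<Longrightarrow> (\<lambda>x. g x - h x) \<in> L2"
  using L2_add[of g "\<lambda>x. - 1 * h x"] L2_cmult[of h "-1"] by simp

lemma L2_zero: "(\<lambda>x. 0) \<in> L2"
  by (simp add: L2_def)

lemma L2_sum: "(\<And>k. k \<in> A \<Longrightarrow> g k \<in> L2) \<Longrightarrow> (\<lambda>x. \<Sum>k\<in>A. g k x) \<in> L2"
  by (induction A rule: infinite_finite_induct) (auto intro: L2_add L2_zero)

lemma l2_inner_commute: "l2_inner g h = l2_inner h g"
  by (simp add: l2_inner_def mult.commute)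

lemma l2_inner_add: "g \<in> L2 \<Longrightarrow> h \<in> L2 \<Longrightarrow> k \<in> L2 \<Longrightarrow>
    l2_inner (\<lambda>x. g x + h x) k = l2_inner g k + l2_inner h k"
  by (simp add: l2_inner_def distrib_right L2_mult_integrable)

lemma l2_inner_diff: "g \<in> L2 \<Longrightarrow> h \<in> L2 \<Longrightarrow> k \<in> L2 \<Longrightarrow>
    l2_inner (\<lambda>x. g x - h x) k = l2_inner g k - l2_inner h k"
  by (simp add: l2_inner_def left_diff_distrib L2_mult_integrable)

lemma l2_inner_cmult: "l2_inner (\<lambda>x. a * g x) k = a * l2_inner g k"
  by (simp add: l2_inner_def mult.assoc)

lemma l2_inner_sum: "(\<And>k. k \<in> A \<Longrightarrow> g k \<in> L2) \<Longrightarrow> h \<in> L2 \<Longrightarrow>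
    l2_inner (\<lambda>x. \<Sum>k\<in>A. g k x) h = (\<Sum>k\<in>A. l2_inner (g k) h)"
proof (induction A rule: infinite_finite_induct)
  case (insert k A)
  then show ?case using l2_inner_add[of "g k" "\<lambda>x. \<Sum>k\<in>A. g k x" h] by (simp add: L2_sum)
qed (simp_all add: l2_inner_def)

lemma l2_norm_sq: "(l2_norm g)\<^sup>2 = l2_inner g g"
  by (simp add: l2_norm_def l2_inner_def)

lemma l2_inner_self_nonneg: "0 \<le> l2_inner g g"
  by (simp add: l2_inner_def)

lemma l2_norm_nonneg [simp]: "0 \<le> l2_norm g"
  by (simp add: l2_norm_def l2_inner_self_nonneg)

lemma l2_norm_less_iff: "e > 0 \<Longrightarrow> l2_norm g < e \<longleftrightarrow> l2_inner g g < e\<^sup>2"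
  by (metis l2_norm_nonneg l2_norm_sq less_le_not_le nless_le power2_less_imp_less power_strict_mono zero_less_numeral)

text \<open>Young's inequality with a free parameter, first pointwise and then integrated; it takes
  the place of the Cauchy-Schwarz inequality.\<close>

lemma l2_inner_abs_le:
  assumes "g \<in> L2" "h \<in> L2" "t > 0"
  shows "2 * \<bar>l2_inner g h\<bar> \<le> t * l2_inner g g + l2_inner h h / t"
proof -
  have "2 * \<bar>a * b\<bar> \<le> t * (a * a) + b * b / t" for a b :: real
  proof -
    have "0 \<le> (t * \<bar>a\<bar> - \<bar>b\<bar>)\<^sup>2 / t" using assms by simp
    also have "\<dots> = t * (a * a) - 2 * \<bar>a * b\<bar> + b * b / t"
      using assms by (simp add: field_simps power2_eq_square abs_mult)
    finally show ?thesis by simp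
  qed
  then have "(\<integral>x. 2 * \<bar>g x * h x\<bar> \<partial>lebesgue) \<le> (\<integral>x. t * (g x * g x) + h x * h x / t \<partial>lebesgue)"
    by (intro integral_mono Bochner_Integration.integrable_add integrable_mult_right integrable_abs
        L2_mult_integrable integrable_divide) (use assms in auto)
  also have "\<dots> = t * l2_inner g g + l2_inner h h / t"
    unfolding l2_inner_def
    by (subst Bochner_Integration.integral_add) (auto intro!: L2_mult_integrable assms)
  finally have "2 * (\<integral>x. \<bar>g x * h x\<bar> \<partial>lebesgue) \<le> t * l2_inner g g + l2_inner h h / t" by simp
  moreover have "\<bar>l2_inner g h\<bar> \<le> (\<integral>x. \<bar>g x * h x\<bar> \<partial>lebesgue)"
    unfolding l2_inner_def using integral_norm_bound[of lebesgue "\<lambda>x. g x * h x"] by simp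
  ultimately show ?thesis by linarith
qed

lemma l2_closure_orthogonal:
  assumes "g \<in> l2_closure S" "S \<subseteq> L2" "h \<in> L2" "\<And>s. s \<in> S \<Longrightarrow> l2_inner s h = 0"
  shows "l2_inner g h = 0"
proof -
  have g: "g \<in> L2" using assms by (simp add: l2_closure_def)
  have "2 * \<bar>l2_inner g h\<bar> \<le> (1 + l2_inner h h) * e" if "e > 0" for e
  proof -
    obtain s where s: "s \<in> S" "l2_norm (\<lambda>x. g x - s x) < e"
      using assms \<open>e > 0\<close> unfolding l2_closure_def by blast
    let ?d = "\<lambda>x. g x - s x"
    have d: "?d \<in> L2" using g s assms(2) by (intro L2_diff) auto
    have "l2_inner ?d h = l2_inner g h" using assms s g by (subst l2_inner_diff) auto
    \<comment> \<open>With the parameter \<open>1/e\<close> both terms on the right become of order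
      \<open>e\<close>.\<close>
    then have "2 * \<bar>l2_inner g h\<bar> \<le> (1/e) * l2_inner ?d ?d + l2_inner h h / (1/e)"
      using l2_inner_abs_le[OF d assms(3), of "1/e"] \<open>e > 0\<close> by simp
    also have "\<dots> \<le> (1/e) * e\<^sup>2 + l2_inner h h / (1/e)"
      using s(2) \<open>e > 0\<close> by (intro add_right_mono mult_left_mono) (auto simp: l2_norm_less_iff)
    also have "\<dots> = (1 + l2_inner h h) * e" using \<open>e > 0\<close> by (simp add: field_simps power2_eq_square)
    finally show ?thesis .
  qed
  note le = this
  have "2 * \<bar>l2_inner g h\<bar> \<le> 0 + e" if "e > 0" for e
  proof -
    have p: "1 + l2_inner h h > 0" using l2_inner_self_nonneg[of h] by linarith
    show ?thesis using le[of "e / (1 + l2_inner h h)"] p that by simp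
  qed
  then have "2 * \<bar>l2_inner g h\<bar> \<le> 0" by (rule field_le_epsilon)
  then show ?thesis by simp
qed

lemma AE_eq_0_imp_eq_0:
  fixes g :: "real \<Rightarrow> real"
  assumes "continuous_on UNIV g" "AE x in lebesgue. g x = 0"
  shows "g x = 0"
proof (rule ccontr)
  assume "g x \<noteq> 0"
  have "open {x. g x \<noteq> 0}"
    using open_Collect_neq[OF assms(1) continuous_on_const, of 0] by simp
  moreover have "{x. g x \<noteq> 0} \<noteq> {}" using \<open>g x \<noteq> 0\<close> by auto
  ultimately have "\<not> negligible {x. g x \<noteq> 0}" by (rule open_not_negligible)
  moreover have "negligible {x. g x \<noteq> 0}"
    using assms(2) \<open>open {x. g x \<noteq> 0}\<close>
    by (simp add: negligible_iff_null_sets AE_iff_null_sets[of "{x. g x \<noteq> 0}" lebesgue])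
  ultimately show False by blast
qed

lemma weight_imp_L2:
  assumes "continuous_on UNIV g" "\<And>y. \<bar>g y\<bar> \<le> C * wt (y - a)"
  shows "g \<in> L2"
proof -
  have "0 \<le> C" using order_trans[OF abs_ge_zero assms(2)[of a]] wt_pos[of 0] by (simp add: zero_le_mult_iff)
  have le: "norm ((g y)\<^sup>2) \<le> norm (C\<^sup>2 * wt (y - a))" for y
  proof -
    have "(g y)\<^sup>2 \<le> (C * wt (y - a))\<^sup>2"
      using assms(2)[of y] by (metis abs_ge_zero power2_abs power_mono)
    also have "\<dots> = C\<^sup>2 * (wt (y - a) * wt (y - a))" by (simp add: power_mult_distrib power2_eq_square)
    also have "\<dots> \<le> C\<^sup>2 * (wt (y - a) * 1)"
      by (intro mult_left_mono) (auto simp: wt_le_1)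
    finally show ?thesis by simp
  qed
  have "integrable lebesgue (\<lambda>y. C\<^sup>2 * wt (y - a))" by (intro integrable_mult_right integrable_wt)
  moreover have "(\<lambda>y. (g y)\<^sup>2) \<in> borel_measurable lebesgue"
    using assms(1) by (intro continuous_imp_lebesgue_measurable continuous_intros)
  ultimately have "integrable lebesgue (\<lambda>y. (g y)\<^sup>2)"
    by (rule Bochner_Integration.integrable_bound) (intro always_eventually allI le)
  then show ?thesis using assms(1) by (simp add: L2_def continuous_imp_lebesgue_measurable)
qed

text \<open>Symmetric intervals exhaust the integers, so an unconditional sum is also the limit of a
  sequence, the form in which dominated convergence applies.\<close>

lemma filterlim_int_intervals:
  "filterlim (\<lambda>N. {- int N..int N}) (finite_subsets_at_top UNIV) sequentially"
  unfolding filterlim_finite_subsets_at_top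
proof safe
  fix X :: "int set" assume "finite X"
  then obtain B where B: "\<And>x. x \<in> X \<Longrightarrow> \<bar>x\<bar> \<le> B"
    using finite_imp_bounded[of "abs ` X"] by (metis Max_ge finite_imageI image_eqI)
  have "\<forall>\<^sub>F N in sequentially. N \<ge> nat B" by (rule eventually_ge_at_top)
  then show "\<forall>\<^sub>F N in sequentially. finite {- int N..int N} \<and> X \<subseteq> {- int N..int N} \<and> {- int N..int N} \<subseteq> UNIV"
    by eventually_elim (use B in \<open>fastforce simp: abs_le_iff\<close>)
qed

lemma has_sum_int_tendsto:
  fixes f :: "int \<Rightarrow> real"
  shows "(f has_sum s) UNIV \<Longrightarrow> (\<lambda>N. \<Sum>k\<in>{- int N..int N}. f k) \<longlonglongrightarrow> s"
  unfolding has_sum_def by (rule filterlim_compose[OF _ filterlim_int_intervals])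

lemma summable_on_int_bounded:
  fixes f :: "int \<Rightarrow> real"
  assumes "\<And>A. finite A \<Longrightarrow> (\<Sum>k\<in>A. \<bar>f k\<bar>) \<le> B"
  shows "f summable_on UNIV"
proof (rule abs_summable_summable, rule nonneg_bdd_above_summable_on)
  show "bdd_above (sum (\<lambda>x. norm (f x)) ` {F. F \<subseteq> UNIV \<and> finite F})"
    using assms by (intro bdd_aboveI2[where M = B]) auto
qed auto

text \<open>Of the two powers of decay of \<open>u\<close>, one combines with the decay of the
  coefficients, by \<open>wt_triangle\<close>, into decay of the sum around \<open>c\<close>; the
  other makes the sum over \<open>k\<close> converge.\<close>

lemma wt_coef_sum_le:
  assumes u: "\<And>x. \<bar>u x\<bar> \<le> C * wt x ^ 2" and a: "\<And>k. k \<in> A \<Longrightarrow> \<bar>a k\<bar> \<le> D * wt (of_int k - c)"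
    and A: "finite A" and D: "D \<ge> 0"
  shows "(\<Sum>k\<in>A. \<bar>a k * u (x - of_int k)\<bar>) \<le> 4 * wt_int * C * D * wt (x - c)"
proof -
  have C: "0 \<le> C" using order_trans[OF abs_ge_zero u[of 0]] by (simp add: zero_le_mult_iff wt_def)
  have "\<bar>a k * u (x - of_int k)\<bar> \<le> (C * D * wt (x - c)) * wt (x - of_int k)" if "k \<in> A" for k
  proof -
    have "\<bar>a k * u (x - of_int k)\<bar> \<le> (D * wt (of_int k - c)) * (C * wt (x - of_int k) ^ 2)"
      unfolding abs_mult using a[OF that] u D by (intro mult_mono) auto
    also have "\<dots> = (C * D) * (wt (x - of_int k) * wt (of_int k - c)) * wt (x - of_int k)"
      by (simp add: power2_eq_square)
    also have "\<dots> \<le> (C * D) * wt (x - c) * wt (x - of_int k)"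
      using C D by (intro mult_right_mono mult_left_mono wt_triangle) auto
    finally show ?thesis .
  qed
  then have "(\<Sum>k\<in>A. \<bar>a k * u (x - of_int k)\<bar>) \<le> (C * D * wt (x - c)) * (\<Sum>k\<in>A. wt (x - of_int k))"
    by (simp add: sum_distrib_left sum_mono)
  also have "\<dots> \<le> (C * D * wt (x - c)) * (4 * wt_int)"
    using C D by (intro mult_left_mono sum_wt_le A) auto
  finally show ?thesis by (simp add: mult_ac)
qed

text \<open>The convergence is locally uniform: on a ball of radius 1 each weight is at most 4 times
  its value at the centre, so the Weierstrass test applies.\<close>

lemma continuous_translate_series:
  fixes u :: "real \<Rightarrow> real"
  assumes u: "\<And>x. \<bar>u x\<bar> \<le> C * wt x" "continuous_on UNIV u" and a: "\<And>k. \<bar>a k\<bar> \<le> D"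
  shows "continuous_on UNIV (\<lambda>x. \<Sum>\<^sub>\<infinity>k. a k * u (x - of_int k))"
proof -
  have C: "0 \<le> C" using order_trans[OF abs_ge_zero u(1)[of 0]] by (simp add: zero_le_mult_iff wt_def)
  have D: "0 \<le> D" using order_trans[OF abs_ge_zero a[of 0]] .
  have "continuous_on (ball x0 1) (\<lambda>x. \<Sum>\<^sub>\<infinity>k. a k * u (x - of_int k))" for x0 :: real
  proof (rule uniform_limit_theorem)
    show "uniform_limit (ball x0 1) (\<lambda>A x. \<Sum>k\<in>A. a k * u (x - of_int k))
       (\<lambda>x. \<Sum>\<^sub>\<infinity>k. a k * u (x - of_int k)) (finite_subsets_at_top UNIV)"
    proof (rule Weierstrass_m_test_general[where M = "\<lambda>k. 4 * D * C * wt (x0 - of_int k)"])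
      fix k :: int and x assume "x \<in> ball x0 1"
      then have 1: "\<bar>x0 - x\<bar> \<le> 1" by (simp add: dist_real_def)
      have "wt (x - of_int k) \<le> wt (x0 - of_int k) * (1 + \<bar>x0 - x\<bar>)\<^sup>2"
        using wt_le_shift[of "x - of_int k" "x0 - x"] by simp
      also have "\<dots> \<le> wt (x0 - of_int k) * 2\<^sup>2"
        using 1 by (intro mult_left_mono power_mono) auto
      finally have "C * wt (x - of_int k) \<le> C * (4 * wt (x0 - of_int k))"
        using C by (intro mult_left_mono) auto
      then have "\<bar>u (x - of_int k)\<bar> \<le> C * (4 * wt (x0 - of_int k))"
        using u(1) order_trans by blast
      then have "\<bar>a k\<bar> * \<bar>u (x - of_int k)\<bar> \<le> D * (C * (4 * wt (x0 - of_int k)))"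
        using a D by (intro mult_mono) auto
      then show "norm (a k * u (x - of_int k)) \<le> 4 * D * C * wt (x0 - of_int k)"
        by (simp add: abs_mult mult_ac)
    next
      have "(\<Sum>k\<in>A. \<bar>4 * D * C * wt (x0 - of_int k)\<bar>) \<le> 4 * D * C * (4 * wt_int)" if "finite A" for A
        using mult_left_mono[OF sum_wt_le[OF that, of x0], of "4 * D * C"] C D
        by (simp add: abs_mult flip: sum_distrib_left)
      then show "(\<lambda>k::int. 4 * D * C * wt (x0 - of_int k)) summable_on UNIV"
        by (rule summable_on_int_bounded)
    qed
    show "\<forall>\<^sub>F A in finite_subsets_at_top UNIV. continuous_on (ball x0 1) (\<lambda>x. \<Sum>k\<in>A. a k * u (x - of_int k))"
      by (intro always_eventually allI continuous_intros continuous_on_compose2[OF u(2)]) auto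
  qed simp
  then have "isCont (\<lambda>x. \<Sum>\<^sub>\<infinity>k. a k * u (x - of_int k)) x0" for x0
    by (rule continuous_on_interior[of "ball x0 1"]) simp
  then show ?thesis by (simp add: continuous_at_imp_continuous_on)
qed

lemma norm_integral_le:
  fixes f :: "'a \<Rightarrow> real"
  assumes "f \<in> borel_measurable M" "integrable M g" "\<And>x. norm (f x) \<le> g x"
  shows "norm (integral\<^sup>L M f) \<le> integral\<^sup>L M g"
proof -
  have "integrable M f"
    by (rule Bochner_Integration.integrable_bound[OF assms(2,1)])
       (use assms(3) order_trans[OF _ abs_ge_self] in auto)
  then have "(\<integral>x. norm (f x) \<partial>M) \<le> integral\<^sup>L M g"
    by (intro integral_mono assms(2,3)) auto
  then show ?thesis using integral_norm_bound[of M f] by linarith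
qed

text \<open>Used twice: for \<phi> with \<open>S = V 0\<close>, and for \<psi> with the orthogonal
  complement of \<open>V 0\<close> in \<open>V 1\<close>.\<close>

locale translates =
  fixes u :: "real \<Rightarrow> real" and S :: "(real \<Rightarrow> real) set"
  assumes cont: "continuous_on UNIV u" and rapid: "rapid u"
    and basis: "orthogonal_basis_of (\<lambda>k::int. \<lambda>x. u (x - of_int k)) S"
begin

abbreviation tr :: "int \<Rightarrow> real \<Rightarrow> real" where
  "tr k \<equiv> \<lambda>x. u (x - of_int k)"

definition nrm :: real where "nrm = l2_inner u u"

lemma tr_L2: "tr k \<in> L2" and tr_orth: "k \<noteq> l \<Longrightarrow> l2_inner (tr k) (tr l) = 0"
  and closure: "l2_closure (lin_span tr) = S"
  using basis unfolding orthogonal_basis_of_def by blast+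

lemma u_L2: "u \<in> L2"
  using tr_L2[of 0] by simp

lemma nrm_pos: "nrm > 0"
proof -
  have "l2_norm (tr 0) \<noteq> 0" using basis unfolding orthogonal_basis_of_def by blast
  then show ?thesis using l2_inner_self_nonneg[of u] by (simp add: nrm_def l2_norm_def)
qed

lemma nonzero: "\<exists>a. u a \<noteq> 0"
  using nrm_pos by (auto simp: nrm_def l2_inner_def intro: ccontr)

lemma tr_inner_self: "l2_inner (tr k) (tr k) = nrm"
proof -
  have "(\<lambda>x. u x * u x) \<in> borel_measurable lebesgue" using u_L2 by (auto simp: L2_def)
  from integral_affine_real[of 1, OF _ this, of "- of_int k"] show ?thesis
    by (simp add: nrm_def l2_inner_def)
qed

lemma tr_inner: "l2_inner (tr k) (tr l) = (if k = l then nrm else 0)"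
  by (simp add: tr_inner_self tr_orth)

lemma lin_span_L2: "lin_span tr \<subseteq> L2"
  unfolding lin_span_def by (auto intro!: L2_sum L2_cmult tr_L2)

lemma S_L2: "S \<subseteq> L2"
  unfolding closure[symmetric] l2_closure_def by blast

lemma lin_span_subset: "lin_span tr \<subseteq> S"
proof
  fix g assume "g \<in> lin_span tr"
  moreover have "l2_norm (\<lambda>x. g x - g x) = 0" by (simp add: l2_norm_def l2_inner_def)
  ultimately show "g \<in> S"
    unfolding closure[symmetric] l2_closure_def using lin_span_L2 by force
qed

lemma sum_in_lin_span: "finite A \<Longrightarrow> (\<lambda>x. \<Sum>k\<in>A. a k * tr k x) \<in> lin_span tr"
  unfolding lin_span_def by blast

lemma tr_in: "tr k \<in> S"
  using lin_span_subset sum_in_lin_span[of "{k}" "\<lambda>_. 1"] by auto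

lemma u_in: "u \<in> S"
  using tr_in[of 0] by simp

lemma l2_inner_diff_comb:
  fixes b :: "int \<Rightarrow> real"
  assumes "g \<in> L2" "finite B"
  defines "p \<equiv> \<lambda>x. \<Sum>k\<in>B. b k * tr k x"
  shows "l2_inner (\<lambda>x. g x - p x) (\<lambda>x. g x - p x)
    = l2_inner g g - 2 * (\<Sum>k\<in>B. b k * l2_inner g (tr k)) + (\<Sum>k\<in>B. (b k)\<^sup>2) * nrm"
proof -
  have p: "p \<in> L2" unfolding p_def by (intro L2_sum L2_cmult tr_L2)
  have gp: "(\<lambda>x. g x - p x) \<in> L2" by (intro L2_diff assms p)
  have ip: "l2_inner p h = (\<Sum>k\<in>B. b k * l2_inner (tr k) h)" if "h \<in> L2" for h
    unfolding p_def by (subst l2_inner_sum) (auto intro!: L2_cmult tr_L2 that simp: l2_inner_cmult)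
  have pk: "l2_inner p (tr k) = b k * nrm" if "k \<in> B" for k
    using that assms(2) by (simp add: ip tr_L2 tr_inner if_distrib cong: if_cong)
  have 1: "l2_inner p (\<lambda>x. g x - p x) = (\<Sum>k\<in>B. b k * (l2_inner g (tr k) - b k * nrm))"
    unfolding ip[OF gp]
    by (intro sum.cong refl) (simp add: l2_inner_commute[of "tr _"] l2_inner_diff assms(1) p tr_L2 pk)
  have 2: "l2_inner g (\<lambda>x. g x - p x) = l2_inner g g - (\<Sum>k\<in>B. b k * l2_inner g (tr k))"
  proof -
    have "l2_inner g (\<lambda>x. g x - p x) = l2_inner (\<lambda>x. g x - p x) g" by (rule l2_inner_commute)
    also have "\<dots> = l2_inner g g - (\<Sum>k\<in>B. b k * l2_inner (tr k) g)"
      by (simp only: l2_inner_diff[OF assms(1) p assms(1)] ip[OF assms(1)])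
    also have "(\<Sum>k\<in>B. b k * l2_inner (tr k) g) = (\<Sum>k\<in>B. b k * l2_inner g (tr k))"
      by (intro sum.cong refl arg_cong2[where f = "(*)"] l2_inner_commute)
    finally show ?thesis .
  qed
  have 3: "(\<Sum>k\<in>B. b k * (l2_inner g (tr k) - b k * nrm)) = (\<Sum>k\<in>B. b k * l2_inner g (tr k)) - (\<Sum>k\<in>B. (b k)\<^sup>2) * nrm"
    by (simp only: right_diff_distrib sum_subtractf sum_distrib_right power2_eq_square mult.assoc)
  show ?thesis
    unfolding l2_inner_diff[OF assms(1) p gp] 1 2
    unfolding 3 by linarith
qed

text \<open>After extending \<open>b\<close> by zero to \<open>B\<close>, the squared distance is a
  constant plus a sum of quadratic polynomials in the single coefficients, each minimal at
  \<open>l2_inner g (tr k) / nrm\<close>.\<close>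

lemma best_approximation:
  fixes b :: "int \<Rightarrow> real"
  assumes "g \<in> L2" "finite B" "A \<subseteq> B"
  defines "s \<equiv> \<lambda>x. \<Sum>k\<in>B. l2_inner g (tr k) / nrm * tr k x" and "p \<equiv> \<lambda>x. \<Sum>k\<in>A. b k * tr k x"
  shows "l2_inner (\<lambda>x. g x - s x) (\<lambda>x. g x - s x) \<le> l2_inner (\<lambda>x. g x - p x) (\<lambda>x. g x - p x)"
proof -
  let ?b = "\<lambda>k. if k \<in> A then b k else 0"
  have p: "p = (\<lambda>x. \<Sum>k\<in>B. ?b k * tr k x)"
    unfolding p_def using assms(2,3) by (auto intro!: sum.mono_neutral_cong_left)
  have le: "- 2 * (l2_inner g (tr k) / nrm * l2_inner g (tr k)) + (l2_inner g (tr k) / nrm)\<^sup>2 * nrm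
    \<le> - 2 * (c * l2_inner g (tr k)) + c\<^sup>2 * nrm" for c k
  proof -
    define w where "w = l2_inner g (tr k) / nrm"
    have w: "l2_inner g (tr k) = w * nrm" using nrm_pos by (simp add: w_def)
    have "0 \<le> nrm * (w - c)\<^sup>2" using nrm_pos by simp
    then show ?thesis unfolding w_def[symmetric] unfolding w by (simp add: power2_eq_square algebra_simps)
  qed
  have "(\<Sum>k\<in>B. - 2 * (l2_inner g (tr k) / nrm * l2_inner g (tr k)) + (l2_inner g (tr k) / nrm)\<^sup>2 * nrm)
    \<le> (\<Sum>k\<in>B. - 2 * (?b k * l2_inner g (tr k)) + (?b k)\<^sup>2 * nrm)"
    by (rule sum_mono[OF le])
  then show ?thesis
    unfolding p s_def l2_inner_diff_comb[OF assms(1,2)]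
    unfolding sum.distrib sum_distrib_left[symmetric] sum_distrib_right[symmetric] by linarith
qed

lemma coef_decay:
  assumes "continuous_on UNIV g" "\<And>y. \<bar>g y\<bar> \<le> C * wt (y - a)"
  obtains D where "D \<ge> 0" "\<And>k. \<bar>l2_inner g (tr k)\<bar> \<le> D * wt (of_int k - a)"
proof -
  obtain B where B: "B > 0" "\<And>x. \<bar>u x\<bar> \<le> B * wt x ^ 2" using rapidD[OF rapid] by blast
  have C: "0 \<le> C" using order_trans[OF abs_ge_zero assms(2)[of a]] by (simp add: zero_le_mult_iff wt_def)
  show ?thesis
  proof (rule that[of "C * B * wt_int"])
    show "0 \<le> C * B * wt_int" using B C wt_int_nonneg by simp
    fix k :: int
    let ?k = "of_int k :: real"
    have le: "norm (g y * tr k y) \<le> C * B * wt (?k - a) * wt (y - ?k)" for y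
    proof -
      have "norm (g y * tr k y) \<le> (C * wt (y - a)) * (B * wt (y - ?k) ^ 2)"
        unfolding real_norm_def abs_mult using assms(2) B C by (intro mult_mono) auto
      also have "\<dots> = (C * B) * (wt (?k - y) * wt (y - a)) * wt (y - ?k)"
        by (simp add: power2_eq_square wt_minus_commute[of ?k y])
      also have "\<dots> \<le> (C * B) * wt (?k - a) * wt (y - ?k)"
        using B C by (intro mult_right_mono mult_left_mono wt_triangle) auto
      finally show ?thesis .
    qed
    have "norm (l2_inner g (tr k)) \<le> (\<integral>y. C * B * wt (?k - a) * wt (y - ?k) \<partial>lebesgue)"
      unfolding l2_inner_def
      using L2_mult_integrable[OF weight_imp_L2[OF assms] tr_L2[of k]] le
      by (intro norm_integral_le integrable_mult_right integrable_wt) auto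
    then show "\<bar>l2_inner g (tr k)\<bar> \<le> C * B * wt_int * wt (?k - a)"
      by (simp add: integral_wt mult_ac)
  qed
qed

lemma
  assumes a: "\<And>k. \<bar>a k\<bar> \<le> D * wt (of_int k - c)" and D: "D \<ge> 0"
  shows series_has_sum: "((\<lambda>k. a k * u (x - of_int k)) has_sum (\<Sum>\<^sub>\<infinity>k. a k * u (x - of_int k))) UNIV"
    and series_continuous: "continuous_on UNIV (\<lambda>x. \<Sum>\<^sub>\<infinity>k. a k * u (x - of_int k))"
    and series_bound: "\<exists>K. \<forall>x. (\<forall>A. finite A \<longrightarrow> \<bar>\<Sum>k\<in>A. a k * u (x - of_int k)\<bar> \<le> K * wt (x - c)) \<and>
        \<bar>\<Sum>\<^sub>\<infinity>k. a k * u (x - of_int k)\<bar> \<le> K * wt (x - c)"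
proof -
  obtain B where B: "B > 0" "\<And>x. \<bar>u x\<bar> \<le> B * wt x ^ 2" using rapidD[OF rapid] by blast
  obtain B1 where B1: "B1 > 0" "\<And>x. \<bar>u x\<bar> \<le> B1 * wt x ^ 1" using rapidD[OF rapid] by blast
  let ?K = "4 * wt_int * B * D"
  have abs: "(\<Sum>k\<in>A. \<bar>a k * u (x - of_int k)\<bar>) \<le> ?K * wt (x - c)" if "finite A" for A x
    using wt_coef_sum_le[of u B A a D c x] B(2) a that D by blast
  show hs: "((\<lambda>k. a k * u (x - of_int k)) has_sum (\<Sum>\<^sub>\<infinity>k. a k * u (x - of_int k))) UNIV" for x
    by (rule has_sum_infsum, rule summable_on_int_bounded[OF abs])
  have "\<bar>a k\<bar> \<le> D" for k
    by (rule order_trans[OF a]) (use D wt_le_1 in \<open>simp add: mult_left_le\<close>)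
  then show "continuous_on UNIV (\<lambda>x. \<Sum>\<^sub>\<infinity>k. a k * u (x - of_int k))"
    using B1 by (intro continuous_translate_series[where C = B1] cont) auto
  have fin: "\<bar>\<Sum>k\<in>A. a k * u (x - of_int k)\<bar> \<le> ?K * wt (x - c)" if "finite A" for A x
    by (rule order_trans[OF sum_abs abs[OF that]])
  moreover have "\<bar>\<Sum>\<^sub>\<infinity>k. a k * u (x - of_int k)\<bar> \<le> ?K * wt (x - c)" for x
    by (rule LIMSEQ_le_const2[OF tendsto_rabs[OF has_sum_int_tendsto[OF hs]]]) (use fin in auto)
  ultimately show "\<exists>K. \<forall>x. (\<forall>A. finite A \<longrightarrow> \<bar>\<Sum>k\<in>A. a k * u (x - of_int k)\<bar> \<le> K * wt (x - c)) \<and>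
        \<bar>\<Sum>\<^sub>\<infinity>k. a k * u (x - of_int k)\<bar> \<le> K * wt (x - c)" by blast
qed

text \<open>Dominated convergence with a weight common to all partial sums. It serves with
  \<open>g\<close> equal to the sum, to place the series in \<open>S\<close>, and with
  \<open>g\<close> in \<open>S\<close>, to identify \<open>g\<close> with its expansion.\<close>

lemma series_L2_tendsto:
  assumes a: "\<And>k. \<bar>a k\<bar> \<le> D * wt (of_int k - c)" and D: "D \<ge> 0"
    and g: "continuous_on UNIV g" "\<And>y. \<bar>g y\<bar> \<le> C * wt (y - c)"
  defines "s \<equiv> \<lambda>N x. \<Sum>k\<in>{- int N..int N}. a k * tr k x" and "t \<equiv> \<lambda>x. \<Sum>\<^sub>\<infinity>k. a k * u (x - of_int k)"
  shows "(\<lambda>N. l2_inner (\<lambda>x. g x - s N x) (\<lambda>x. g x - s N x)) \<longlonglongrightarrow> l2_inner (\<lambda>x. g x - t x) (\<lambda>x. g x - t x)"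
proof -
  obtain K where K: "\<And>x A. finite A \<Longrightarrow> \<bar>\<Sum>k\<in>A. a k * u (x - of_int k)\<bar> \<le> K * wt (x - c)"
    using series_bound[OF a D] by blast
  have t: "continuous_on UNIV t" unfolding t_def by (rule series_continuous[OF a D])
  have s: "continuous_on UNIV (s N)" for N
    unfolding s_def by (intro continuous_intros continuous_on_compose2[OF cont]) auto
  show ?thesis
    unfolding l2_inner_def
  proof (rule integral_dominated_convergence[where w = "\<lambda>x. (C + K)\<^sup>2 * wt (x - c)"])
    show "AE x in lebesgue. (\<lambda>N. (g x - s N x) * (g x - s N x)) \<longlonglongrightarrow> (g x - t x) * (g x - t x)"
      unfolding s_def t_def
      by (intro always_eventually allI tendsto_intros has_sum_int_tendsto series_has_sum[OF a D])
    fix N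
    show "AE x in lebesgue. norm ((g x - s N x) * (g x - s N x)) \<le> (C + K)\<^sup>2 * wt (x - c)"
    proof (intro always_eventually allI)
      fix x
      have "\<bar>g x - s N x\<bar> \<le> (C + K) * wt (x - c)"
        using g(2)[of x] K[of "{- int N..int N}" x] unfolding s_def distrib_right by simp
      then have "\<bar>g x - s N x\<bar>\<^sup>2 \<le> ((C + K) * wt (x - c))\<^sup>2" by (intro power_mono) auto
      also have "\<dots> = (C + K)\<^sup>2 * (wt (x - c) * wt (x - c))" by (simp add: power_mult_distrib power2_eq_square)
      also have "\<dots> \<le> (C + K)\<^sup>2 * (wt (x - c) * 1)" by (intro mult_left_mono) (auto simp: wt_le_1)
      finally show "norm ((g x - s N x) * (g x - s N x)) \<le> (C + K)\<^sup>2 * wt (x - c)"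
        by (simp add: power2_eq_square abs_mult)
    qed
  qed (auto intro!: integrable_mult_right integrable_wt continuous_imp_lebesgue_measurable continuous_intros s t g)
qed

lemma series_in:
  assumes a: "\<And>k. \<bar>a k\<bar> \<le> D * wt (of_int k - c)" and D: "D \<ge> 0"
  shows "(\<lambda>x. \<Sum>\<^sub>\<infinity>k. a k * u (x - of_int k)) \<in> S"
proof -
  let ?t = "\<lambda>x. \<Sum>\<^sub>\<infinity>k. a k * u (x - of_int k)"
  let ?s = "\<lambda>N x. \<Sum>k\<in>{- int N..int N}. a k * tr k x"
  obtain K where K: "\<And>x. \<bar>?t x\<bar> \<le> K * wt (x - c)" using series_bound[OF a D] by blast
  have t: "continuous_on UNIV ?t" by (rule series_continuous[OF a D])
  have "?t \<in> L2" by (rule weight_imp_L2[OF t K])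
  have lim: "(\<lambda>N. l2_inner (\<lambda>x. ?t x - ?s N x) (\<lambda>x. ?t x - ?s N x)) \<longlonglongrightarrow> 0"
    using series_L2_tendsto[OF a D t K] by (simp add: l2_inner_def)
  have "\<exists>h\<in>lin_span tr. l2_norm (\<lambda>x. ?t x - h x) < e" if "e > 0" for e
  proof -
    have "\<forall>\<^sub>F N in sequentially. l2_inner (\<lambda>x. ?t x - ?s N x) (\<lambda>x. ?t x - ?s N x) < e\<^sup>2"
      using order_tendstoD(2)[OF lim, of "e\<^sup>2"] that by simp
    then obtain N where "l2_inner (\<lambda>x. ?t x - ?s N x) (\<lambda>x. ?t x - ?s N x) < e\<^sup>2"
      using eventually_happens'[OF sequentially_bot] by blast
    then show ?thesis
      using that by (intro bexI[of _ "?s N"] sum_in_lin_span) (auto simp: l2_norm_less_iff)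
  qed
  then show ?thesis unfolding closure[symmetric] l2_closure_def using \<open>?t \<in> L2\<close> by blast
qed

text \<open>The partial sums are best approximations, so they converge to \<open>g\<close> in L2,
  and by \<open>series_L2_tendsto\<close> their pointwise limit is at distance zero from
  \<open>g\<close>. Both functions are continuous, hence they agree at every point and not only
  almost everywhere.\<close>

lemma expansion:
  assumes g: "g \<in> S" "continuous_on UNIV g" "\<And>y. \<bar>g y\<bar> \<le> C * wt (y - c)"
  shows "((\<lambda>k. l2_inner g (tr k) / nrm * u (x - of_int k)) has_sum g x) UNIV"
proof -
  obtain D' where D': "D' \<ge> 0" "\<And>k. \<bar>l2_inner g (tr k)\<bar> \<le> D' * wt (of_int k - c)"
    using coef_decay[OF g(2,3)] by blast
  define a where "a k = l2_inner g (tr k) / nrm" for k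
  define D where "D = D' / nrm"
  have D: "D \<ge> 0" "\<And>k. \<bar>a k\<bar> \<le> D * wt (of_int k - c)"
    using D' nrm_pos by (auto simp: D_def a_def divide_right_mono)
  let ?t = "\<lambda>x. \<Sum>\<^sub>\<infinity>k. a k * u (x - of_int k)"
  let ?s = "\<lambda>N x. \<Sum>k\<in>{- int N..int N}. a k * tr k x"
  have t: "continuous_on UNIV ?t" by (rule series_continuous[OF D(2,1)])
  obtain K where K: "\<And>x. \<bar>?t x\<bar> \<le> K * wt (x - c)" using series_bound[OF D(2,1)] by blast
  have gL2: "g \<in> L2" using g(1) S_L2 by blast
  have dL2: "(\<lambda>x. g x - ?t x) \<in> L2" by (intro L2_diff gL2 weight_imp_L2[OF t K])
  have "(\<lambda>N. l2_inner (\<lambda>x. g x - ?s N x) (\<lambda>x. g x - ?s N x)) \<longlonglongrightarrow> 0"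
  proof (rule order_tendstoI)
    fix e :: real assume "0 < e"
    then have "sqrt e > 0" by simp
    moreover have "\<forall>\<epsilon>>0. \<exists>h\<in>lin_span tr. l2_norm (\<lambda>x. g x - h x) < \<epsilon>"
      using g(1) closure unfolding l2_closure_def by blast
    ultimately obtain h where h: "h \<in> lin_span tr" "l2_norm (\<lambda>x. g x - h x) < sqrt e" by blast
    then obtain A b where A: "finite A" "h = (\<lambda>x. \<Sum>k\<in>A. b k * tr k x)" unfolding lin_span_def by blast
    have "\<forall>\<^sub>F N in sequentially. A \<subseteq> {- int N..int N}"
      using filterlim_int_intervals A(1) unfolding filterlim_finite_subsets_at_top
      by (auto elim: eventually_mono)
    then show "\<forall>\<^sub>F N in sequentially. l2_inner (\<lambda>x. g x - ?s N x) (\<lambda>x. g x - ?s N x) < e"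
    proof eventually_elim
      case (elim N)
      have "l2_inner (\<lambda>x. g x - ?s N x) (\<lambda>x. g x - ?s N x) \<le> l2_inner (\<lambda>x. g x - h x) (\<lambda>x. g x - h x)"
        unfolding a_def A(2) by (rule best_approximation[OF gL2 _ elim]) simp
      also have "\<dots> < e" using h(2) \<open>0 < e\<close> by (simp add: l2_norm_less_iff)
      finally show ?case .
    qed
  next
    fix e :: real assume "e < 0"
    then show "\<forall>\<^sub>F N in sequentially. e < l2_inner (\<lambda>x. g x - ?s N x) (\<lambda>x. g x - ?s N x)"
      by (intro always_eventually allI order_less_le_trans[OF _ l2_inner_self_nonneg])
  qed
  with series_L2_tendsto[OF D(2,1) g(2,3)]
  have "l2_inner (\<lambda>x. g x - ?t x) (\<lambda>x. g x - ?t x) = 0" by (rule LIMSEQ_unique)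
  then have "AE x in lebesgue. (g x - ?t x) * (g x - ?t x) = 0"
    unfolding l2_inner_def using L2_mult_integrable[OF dL2 dL2]
    by (subst (asm) integral_nonneg_eq_0_iff_AE) auto
  then have "AE x in lebesgue. g x - ?t x = 0" by simp
  from AE_eq_0_imp_eq_0[OF continuous_on_diff[OF g(2) t] this, of x] have "g x = ?t x" by simp
  then show ?thesis using series_has_sum[OF D(2,1), of x] unfolding a_def by simp
qed

end

section \<open>Reproducing kernels\<close>

context translates
begin

text \<open>The integral kernel of the orthogonal projection onto \<open>S\<close>. The division by
  \<open>nrm\<close> accounts for the free normalization of \<open>u\<close>.\<close>

definition ker :: "real \<Rightarrow> real \<Rightarrow> real" where
  "ker x y = (\<Sum>\<^sub>\<infinity>k. u (x - of_int k) / nrm * u (y - of_int k))"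

text \<open>Three powers of decay are spent: two give \<open>wt (x - y) ^ 2\<close> by
  \<open>wt_triangle\<close>, the third is summed over \<open>k\<close>. The square is kept because
  the estimate of the remainder needs decay to spare; the summand 1 in the constant only makes it
  positive.\<close>

lemma ker_partial_sum_bound:
  "\<exists>K>0. \<forall>x y A. finite A \<longrightarrow> (\<Sum>k\<in>A. \<bar>u (x - of_int k) / nrm * u (y - of_int k)\<bar>) \<le> K * wt (x - y) ^ 2"
proof -
  obtain B where B: "B > 0" "\<And>x. \<bar>u x\<bar> \<le> B * wt x ^ 3" using rapidD[OF rapid] by blast
  have "(\<Sum>k\<in>A. \<bar>u (x - of_int k) / nrm * u (y - of_int k)\<bar>) \<le> (B\<^sup>2 / nrm * (4 * wt_int) + 1) * wt (x - y) ^ 2"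
    if "finite A" for x y and A :: "int set"
  proof -
    have le: "\<bar>u (x - of_int k) / nrm * u (y - of_int k)\<bar> \<le> (B\<^sup>2 / nrm * wt (x - y) ^ 2) * wt (x - of_int k)" for k
    proof -
      have "\<bar>u (x - of_int k) / nrm * u (y - of_int k)\<bar>
          \<le> (B * wt (x - of_int k) ^ 3) / nrm * (B * wt (y - of_int k) ^ 3)"
        unfolding abs_mult abs_divide using B nrm_pos by (intro mult_mono divide_mono) auto
      also have "\<dots> = (B\<^sup>2 / nrm) * (wt (x - of_int k) * wt (of_int k - y)) ^ 2 * (wt (x - of_int k) * wt (y - of_int k))"
        by (simp add: wt_minus_commute[of _ y] power2_eq_square power3_eq_cube)
      also have "\<dots> \<le> (B\<^sup>2 / nrm) * wt (x - y) ^ 2 * (wt (x - of_int k) * 1)"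
        using nrm_pos by (intro mult_mono mult_left_mono power_mono wt_triangle wt_le_1) auto
      finally show ?thesis by simp
    qed
    have "(\<Sum>k\<in>A. \<bar>u (x - of_int k) / nrm * u (y - of_int k)\<bar>)
      \<le> (B\<^sup>2 / nrm * wt (x - y) ^ 2) * (\<Sum>k\<in>A. wt (x - of_int k))"
      unfolding sum_distrib_left by (rule sum_mono[OF le])
    also have "\<dots> \<le> (B\<^sup>2 / nrm * wt (x - y) ^ 2) * (4 * wt_int)"
      using nrm_pos by (intro mult_left_mono sum_wt_le that) auto
    also have "\<dots> \<le> (B\<^sup>2 / nrm * (4 * wt_int) + 1) * wt (x - y) ^ 2"
      unfolding distrib_right by (simp add: mult_ac)
    finally show ?thesis .
  qed
  moreover have "B\<^sup>2 / nrm * (4 * wt_int) + 1 > 0"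
    using nrm_pos wt_int_nonneg by (intro add_nonneg_pos) auto
  ultimately show ?thesis by blast
qed

lemma ker_coef: obtains D where "D \<ge> 0" "\<And>k. \<bar>u (x - of_int k) / nrm\<bar> \<le> D * wt (of_int k - x)"
proof -
  obtain B where B: "B > 0" "\<And>x. \<bar>u x\<bar> \<le> B * wt x ^ 1" using rapidD[OF rapid] by blast
  show ?thesis
    by (rule that[of "B / nrm"])
       (use B nrm_pos in \<open>auto simp: abs_divide wt_minus_commute[of _ x] intro!: divide_right_mono\<close>)
qed

lemma ker_has_sum: "((\<lambda>k. u (x - of_int k) / nrm * u (y - of_int k)) has_sum ker x y) UNIV"
proof -
  obtain D where D: "D \<ge> 0" "\<And>k. \<bar>u (x - of_int k) / nrm\<bar> \<le> D * wt (of_int k - x)"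
    using ker_coef[of x] by blast
  show ?thesis unfolding ker_def by (rule series_has_sum[OF D(2,1)])
qed

lemma ker_tendsto: "(\<lambda>N. \<Sum>k\<in>{- int N..int N}. u (x - of_int k) / nrm * u (y - of_int k)) \<longlonglongrightarrow> ker x y"
  by (rule has_sum_int_tendsto[OF ker_has_sum])

lemma ker_continuous: "continuous_on UNIV (ker x)"
proof -
  obtain D where D: "D \<ge> 0" "\<And>k. \<bar>u (x - of_int k) / nrm\<bar> \<le> D * wt (of_int k - x)"
    using ker_coef[of x] by blast
  show ?thesis unfolding ker_def by (rule series_continuous[OF D(2,1)])
qed

lemma ker_in: "ker x \<in> S"
proof -
  obtain D where D: "D \<ge> 0" "\<And>k. \<bar>u (x - of_int k) / nrm\<bar> \<le> D * wt (of_int k - x)"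
    using ker_coef[of x] by blast
  show ?thesis unfolding ker_def by (rule series_in[OF D(2,1)])
qed

lemma ker_bound:
  obtains K where "K > 0" "\<And>x y. \<bar>ker x y\<bar> \<le> K * wt (x - y) ^ 2"
    "\<And>x y A. finite A \<Longrightarrow> \<bar>\<Sum>k\<in>A. u (x - of_int k) / nrm * u (y - of_int k)\<bar> \<le> K * wt (x - y) ^ 2"
proof -
  obtain K where K: "K > 0"
    "\<And>x y A. finite A \<Longrightarrow> (\<Sum>k\<in>A. \<bar>u (x - of_int k) / nrm * u (y - of_int k)\<bar>) \<le> K * wt (x - y) ^ 2"
    using ker_partial_sum_bound by blast
  have fin: "\<bar>\<Sum>k\<in>A. u (x - of_int k) / nrm * u (y - of_int k)\<bar> \<le> K * wt (x - y) ^ 2" if "finite A" for x y A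
    by (rule order_trans[OF sum_abs K(2)[OF that]])
  have "\<bar>ker x y\<bar> \<le> K * wt (x - y) ^ 2" for x y
    by (rule LIMSEQ_le_const2[OF tendsto_rabs[OF ker_tendsto]]) (use fin in auto)
  with K(1) fin show ?thesis using that by blast
qed

lemma ker_decay: obtains K where "K > 0" "\<And>x y. \<bar>ker x y\<bar> \<le> K * wt (y - x)"
proof -
  obtain K where K: "K > 0" "\<And>x y. \<bar>ker x y\<bar> \<le> K * wt (x - y) ^ 2"
    "\<And>x y A. finite A \<Longrightarrow> \<bar>\<Sum>k\<in>A. u (x - of_int k) / nrm * u (y - of_int k)\<bar> \<le> K * wt (x - y) ^ 2"
    by (rule ker_bound) (rule that; assumption)
  have "\<bar>ker x y\<bar> \<le> K * wt (y - x)" for x y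
  proof -
    have "\<bar>ker x y\<bar> \<le> K * (wt (y - x) * wt (y - x))" using K(2)[of x y] by (simp add: power2_eq_square wt_minus_commute)
    also have "\<dots> \<le> K * (wt (y - x) * 1)" using K(1) by (intro mult_left_mono wt_le_1) auto
    finally show ?thesis by simp
  qed
  with K(1) show ?thesis using that by blast
qed

lemma ker_shift: "ker (x + of_int j) (y + of_int j) = ker x y"
proof -
  have "bij_betw (\<lambda>k. k + j) UNIV (UNIV :: int set)"
    by (rule bij_betw_byWitness[where f' = "\<lambda>k. k - j"]) auto
  from infsum_reindex_bij_betw[OF this, of "\<lambda>k. u (x + of_int j - of_int k) / nrm * u (y + of_int j - of_int k)"]
  show ?thesis by (simp add: ker_def)
qed

text \<open>Integrated against the partial sums of the kernel, \<open>g\<close> yields the partial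
  sums of its own expansion, and both sides converge.\<close>

lemma ker_reproduces:
  assumes g: "g \<in> S" "continuous_on UNIV g" "\<And>y. \<bar>g y\<bar> \<le> C * wt (y - c)"
  shows "(\<integral>y. g y * ker x y \<partial>lebesgue) = g x"
proof -
  obtain K where "K > 0" "\<And>x y. \<bar>ker x y\<bar> \<le> K * wt (x - y) ^ 2"
    "\<And>x y A. finite A \<Longrightarrow> \<bar>\<Sum>k\<in>A. u (x - of_int k) / nrm * u (y - of_int k)\<bar> \<le> K * wt (x - y) ^ 2"
    by (rule ker_bound) (rule that; assumption)
  note K = \<open>K > 0\<close> this(3)
  have gL2: "g \<in> L2" using g(1) S_L2 by blast
  have C: "0 \<le> C" using order_trans[OF abs_ge_zero g(3)[of c]] by (simp add: zero_le_mult_iff wt_def)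
  have "(\<lambda>N. \<integral>y. g y * (\<Sum>k\<in>{- int N..int N}. u (x - of_int k) / nrm * u (y - of_int k)) \<partial>lebesgue)
      \<longlonglongrightarrow> (\<integral>y. g y * ker x y \<partial>lebesgue)"
  proof (rule integral_dominated_convergence[where w = "\<lambda>y. C * K * wt (y - c)"])
    fix N :: nat
    show "AE y in lebesgue. norm (g y * (\<Sum>k\<in>{- int N..int N}. u (x - of_int k) / nrm * u (y - of_int k)))
        \<le> C * K * wt (y - c)"
    proof (intro always_eventually allI)
      fix y
      have "\<bar>\<Sum>k\<in>{- int N..int N}. u (x - of_int k) / nrm * u (y - of_int k)\<bar> \<le> K * wt (x - y) ^ 2"
        by (rule K(2)) simp
      also have "\<dots> \<le> K * 1" using K(1) by (intro mult_left_mono power_le_one) (auto simp: wt_le_1)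
      finally have "norm (g y * (\<Sum>k\<in>{- int N..int N}. u (x - of_int k) / nrm * u (y - of_int k)))
          \<le> (C * wt (y - c)) * K"
        unfolding real_norm_def abs_mult using g(3) C K(1) by (intro mult_mono) auto
      then show "norm (g y * (\<Sum>k\<in>{- int N..int N}. u (x - of_int k) / nrm * u (y - of_int k)))
          \<le> C * K * wt (y - c)" by (simp add: mult_ac)
    qed
    show "(\<lambda>y. g y * (\<Sum>k\<in>{- int N..int N}. u (x - of_int k) / nrm * u (y - of_int k))) \<in> borel_measurable lebesgue"
      by (intro continuous_imp_lebesgue_measurable continuous_intros g continuous_on_compose2[OF cont])
         auto
    show "AE y in lebesgue. (\<lambda>N. g y * (\<Sum>k\<in>{- int N..int N}. u (x - of_int k) / nrm * u (y - of_int k)))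
        \<longlonglongrightarrow> g y * ker x y"
      by (intro always_eventually allI tendsto_mult tendsto_const ker_tendsto)
    show "(\<lambda>y. g y * ker x y) \<in> borel_measurable lebesgue"
      by (intro continuous_imp_lebesgue_measurable continuous_on_mult g ker_continuous)
  qed (intro integrable_mult_right integrable_wt)
  moreover have "(\<integral>y. g y * (\<Sum>k\<in>A. u (x - of_int k) / nrm * u (y - of_int k)) \<partial>lebesgue)
      = (\<Sum>k\<in>A. l2_inner g (tr k) / nrm * u (x - of_int k))" for A
  proof -
    have "(\<integral>y. g y * (\<Sum>k\<in>A. u (x - of_int k) / nrm * u (y - of_int k)) \<partial>lebesgue)
      = (\<integral>y. (\<Sum>k\<in>A. u (x - of_int k) / nrm * (g y * tr k y)) \<partial>lebesgue)"
      by (simp only: sum_distrib_left mult.left_commute[of "g _"])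
    also have "\<dots> = (\<Sum>k\<in>A. u (x - of_int k) / nrm * l2_inner g (tr k))"
      unfolding l2_inner_def
      by (subst Bochner_Integration.integral_sum)
         (intro integrable_mult_right L2_mult_integrable gL2 tr_L2, simp only: integral_mult_right_zero)
    finally show ?thesis by (simp add: mult.commute)
  qed
  moreover note has_sum_int_tendsto[OF expansion[OF g, of x]]
  ultimately show ?thesis by (simp add: LIMSEQ_unique)
qed

end

section \<open>Multiresolution analyses and the kernels of their two spaces\<close>

lemma dyadic_nonzero:
  fixes v :: "real \<Rightarrow> real"
  assumes "continuous_on UNIV v" "v a \<noteq> 0"
  obtains p :: int and n :: nat where "v (of_int p / 2 ^ n) \<noteq> 0"
proof -
  \<comment> \<open>Truncated binary expansions of \<open>a\<close>. Dyadic points are wanted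
    because a large power of 2 turns them into integers, and only integer translations are
    compatible with the spaces.\<close>
  have "(\<lambda>n. of_int \<lfloor>a * 2 ^ n\<rfloor> / 2 ^ n) \<longlonglongrightarrow> a"
  proof (rule LIMSEQ_I)
    fix r :: real assume "r > 0"
    then obtain N where N: "(1/2) ^ N < r" using real_arch_pow_inv[of r "1/2"] by auto
    have "norm (of_int \<lfloor>a * 2 ^ n\<rfloor> / 2 ^ n - a) < r" if "n \<ge> N" for n
    proof -
      have "\<bar>of_int \<lfloor>a * 2 ^ n\<rfloor> - a * 2 ^ n\<bar> \<le> 1" by linarith
      then have "\<bar>(of_int \<lfloor>a * 2 ^ n\<rfloor> - a * 2 ^ n) / 2 ^ n\<bar> \<le> 1 / 2 ^ n"
        by (simp add: abs_divide divide_right_mono)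
      also have "\<dots> = (1/2) ^ n" by (simp add: power_one_over)
      also have "\<dots> \<le> (1/2) ^ N" using that by (intro power_decreasing) auto
      finally show ?thesis using N by (simp add: diff_divide_distrib)
    qed
    then show "\<exists>N. \<forall>n\<ge>N. norm (of_int \<lfloor>a * 2 ^ n\<rfloor> / 2 ^ n - a) < r" by blast
  qed
  moreover have "isCont v a" using assms(1) by (simp add: continuous_on_eq_continuous_at)
  ultimately have "(\<lambda>n. v (of_int \<lfloor>a * 2 ^ n\<rfloor> / 2 ^ n)) \<longlonglongrightarrow> v a"
    by (rule isCont_tendsto_compose[rotated])
  then have "\<forall>\<^sub>F n in sequentially. v (of_int \<lfloor>a * 2 ^ n\<rfloor> / 2 ^ n) \<noteq> 0"
    using assms(2) by (rule tendsto_imp_eventually_ne)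
  then show ?thesis using that eventually_happens'[OF sequentially_bot] by blast
qed

lemma wt_scale: "c \<ge> 1 \<Longrightarrow> wt (y / c) \<le> c\<^sup>2 * wt y"
proof -
  assume c: "c \<ge> 1"
  then have "1 + \<bar>y\<bar> \<le> c * (1 + \<bar>y / c\<bar>)" by (simp add: abs_divide field_simps)
  then have "(1 + \<bar>y\<bar>)\<^sup>2 \<le> (c * (1 + \<bar>y / c\<bar>))\<^sup>2" by (intro power_mono) auto
  then have "(1 + \<bar>y\<bar>)\<^sup>2 \<le> c\<^sup>2 * (1 + \<bar>y / c\<bar>)\<^sup>2" by (simp only: power_mult_distrib)
  moreover have "0 < (1 + \<bar>y\<bar>)\<^sup>2" "0 < (1 + \<bar>y / c\<bar>)\<^sup>2" by (intro zero_less_power add_pos_nonneg; simp)+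
  ultimately show ?thesis unfolding wt_def by (simp only: divide_simps) (simp add: mult.commute)
qed

lemma wt_antimono: "\<bar>x\<bar> \<le> \<bar>y\<bar> \<Longrightarrow> wt y \<le> wt x"
  unfolding wt_def by (intro divide_left_mono power_mono mult_pos_pos zero_less_power) auto

locale mra =
  fixes V :: "int \<Rightarrow> (real \<Rightarrow> real) set" and \<phi> \<psi> :: "real \<Rightarrow> real" and M :: nat
  assumes mra: "multiresolution_analysis V \<phi>"
    and wavelet: "orthogonal_basis_of (\<lambda>k::int. \<lambda>x. \<psi> (x - of_int k)) {g \<in> V 1. \<forall>h\<in>V 0. l2_inner g h = 0}"
    and smooth: "smooth_rapid M \<phi>" "smooth_rapid M \<psi>"

sublocale mra \<subseteq> P: translates \<phi> "V 0"
proof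
  show "continuous_on UNIV \<phi>" "rapid \<phi>" by (rule smooth_rapidD[OF smooth(1)])+
  show "orthogonal_basis_of (\<lambda>k::int. \<lambda>x. \<phi> (x - of_int k)) (V 0)"
    using mra unfolding multiresolution_analysis_def by (elim conjE)
qed

sublocale mra \<subseteq> Q: translates \<psi> "{g \<in> V 1. \<forall>h\<in>V 0. l2_inner g h = 0}"
proof
  show "continuous_on UNIV \<psi>" "rapid \<psi>" by (rule smooth_rapidD[OF smooth(2)])+
qed (rule wavelet)

context mra
begin

lemma V_scale: "g \<in> V j \<longleftrightarrow> (\<lambda>x. g (2 * x)) \<in> V (j + 1)" and V_Suc: "V j \<subseteq> V (j + 1)"
  and V_closed: "closed_subspace_L2 (V j)"
proof -
  have "\<forall>j. closed_subspace_L2 (V j)" "\<forall>j. V j \<subseteq> V (j + 1)" "\<forall>j g. g \<in> V j \<longleftrightarrow> (\<lambda>x. g (2 * x)) \<in> V (j + 1)"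
    using mra unfolding multiresolution_analysis_def by - (elim conjE, assumption)+
  then show "g \<in> V j \<longleftrightarrow> (\<lambda>x. g (2 * x)) \<in> V (j + 1)" "V j \<subseteq> V (j + 1)" "closed_subspace_L2 (V j)"
    by - (elim allE, assumption)+
qed

lemma V_add: "g \<in> V j \<Longrightarrow> h \<in> V j \<Longrightarrow> (\<lambda>x. g x + h x) \<in> V j"
  using V_closed[of j] unfolding closed_subspace_L2_def by (elim conjE) (drule bspec, assumption)+

lemma V_cmult: "g \<in> V j \<Longrightarrow> (\<lambda>x. a * g x) \<in> V j"
  using V_closed[of j] unfolding closed_subspace_L2_def by auto

lemma V1_half: "g \<in> V 1 \<Longrightarrow> (\<lambda>x. g (x / 2)) \<in> V 0"
  using V_scale[of "\<lambda>x. g (x / 2)" 0] by simp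

text \<open>One stretching by the factor 2 maps \<open>V 0\<close> into \<open>V (-1)\<close>, which
  is contained in \<open>V 0\<close>.\<close>

lemma V0_dilate: "g \<in> V 0 \<Longrightarrow> (\<lambda>x. g (x / 2 ^ j)) \<in> V 0"
proof (induction j)
  case (Suc j)
  then have "(\<lambda>x. g (x / 2 ^ j)) \<in> V 0" by simp
  then have "(\<lambda>x. g (x / 2 / 2 ^ j)) \<in> V (-1)" using V_scale[of "\<lambda>x. g (x / 2 / 2 ^ j)" "-1"] by simp
  then show ?case using V_Suc[of "-1"] by (auto simp: field_simps)
qed simp

lemma \<psi>_translate_V1: "(\<lambda>x. \<psi> (x - of_int k)) \<in> V 1"
  and \<psi>_translate_orth: "h \<in> V 0 \<Longrightarrow> l2_inner (\<lambda>x. \<psi> (x - of_int k)) h = 0"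
  using Q.tr_in[of k] by auto

text \<open>The kernel reproduces \<open>\<phi>(2\<^sup>-\<^sup>j y)\<close>. Around \<open>2\<^sup>j a\<close>, where \<open>a\<close> is dyadic with \<open>\<phi>(a) \<noteq> 0\<close> and the kernel
  is invariant under the translation by \<open>2\<^sup>j a\<close>, this function tends to the constant \<open>\<phi>(a)\<close>.\<close>

lemma ker_integral: "(\<integral>y. P.ker x y \<partial>lebesgue) = 1"
proof -
  obtain a0 where "\<phi> a0 \<noteq> 0" using P.nonzero by blast
  then obtain p n where pn: "\<phi> (of_int p / 2 ^ n) \<noteq> 0" using dyadic_nonzero[OF P.cont] by blast
  define a where "a = of_int p / (2::real) ^ n"
  obtain K where K: "K > 0" "\<And>x y. \<bar>P.ker x y\<bar> \<le> K * wt (y - x)" by (rule P.ker_decay) (rule that; assumption)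
  obtain B where B: "B > 0" "\<And>x. \<bar>\<phi> x\<bar> \<le> B * wt x ^ 1" using rapidD[OF P.rapid] by blast
  have B1: "\<bar>\<phi> x\<bar> \<le> B" for x
    using order_trans[OF B(2)[of x], of B] wt_le_1[of x] B(1) by (simp add: mult_left_le)
  have meas: "(\<lambda>y. \<phi> (y / 2 ^ j + a) * P.ker x y) \<in> borel_measurable lebesgue" for j
    by (intro continuous_imp_lebesgue_measurable continuous_intros continuous_on_compose2[OF P.cont]
        P.ker_continuous) auto
  have rep: "(\<integral>y. \<phi> (y / 2 ^ j + a) * P.ker x y \<partial>lebesgue) = \<phi> (x / 2 ^ j + a)" if "j \<ge> n" for j
  proof -
    define q where "q = p * 2 ^ (j - n)"
    have q: "of_int q / 2 ^ j = a"
    proof -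
      have "(2::real) ^ j = 2 ^ (j - n) * 2 ^ n" using that by (simp flip: power_add)
      then show ?thesis by (simp add: q_def a_def)
    qed
    \<comment> \<open>The constant grows with \<open>j\<close>, which is harmless: the bound only
      justifies the reproduction for each fixed \<open>j\<close>, whereas the passage to the limit
      uses the uniform bound \<open>B\<close>.\<close>
    have dec: "\<bar>\<phi> (y / 2 ^ j)\<bar> \<le> (B * (2 ^ j)\<^sup>2) * wt (y - 0)" for y
    proof -
      have "\<bar>\<phi> (y / 2 ^ j)\<bar> \<le> B * wt (y / 2 ^ j)" using B(2)[of "y / 2 ^ j"] by simp
      also have "\<dots> \<le> B * ((2 ^ j)\<^sup>2 * wt y)" using B(1) by (intro mult_left_mono wt_scale) auto
      finally show ?thesis by simp
    qed
    have "(\<integral>y. \<phi> (y / 2 ^ j) * P.ker (x + of_int q) y \<partial>lebesgue) = \<phi> ((x + of_int q) / 2 ^ j)"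
      by (rule P.ker_reproduces[OF V0_dilate[OF P.u_in] _ dec])
         (auto intro!: continuous_on_compose2[OF P.cont] continuous_intros)
    also have "(\<integral>y. \<phi> (y / 2 ^ j) * P.ker (x + of_int q) y \<partial>lebesgue)
       = (\<integral>y. \<phi> ((of_int q + 1 * y) / 2 ^ j) * P.ker (x + of_int q) (of_int q + 1 * y) \<partial>lebesgue)"
      by (subst integral_affine_real[of 1 _ "of_int q", symmetric])
         (auto intro!: continuous_imp_lebesgue_measurable continuous_intros continuous_on_compose2[OF P.cont]
            P.ker_continuous)
    also have "\<dots> = (\<integral>y. \<phi> (y / 2 ^ j + a) * P.ker x y \<partial>lebesgue)"
      using P.ker_shift[of x q] by (simp add: add_divide_distrib q add.commute)
    finally show ?thesis by (simp add: add_divide_distrib q)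
  qed
  have lim0: "(\<lambda>j. y / 2 ^ j + a) \<longlonglongrightarrow> a" for y :: real
  proof -
    have "(\<lambda>j. y * (1/2) ^ j + a) \<longlonglongrightarrow> y * 0 + a"
      by (intro tendsto_intros LIMSEQ_power_zero) auto
    then show ?thesis by (simp add: power_one_over)
  qed
  have lim1: "(\<lambda>j. \<phi> (y / 2 ^ j + a)) \<longlonglongrightarrow> \<phi> a" for y
    by (rule isCont_tendsto_compose[OF _ lim0]) (use P.cont in \<open>simp add: continuous_on_eq_continuous_at\<close>)
  have "(\<lambda>j. \<integral>y. \<phi> (y / 2 ^ j + a) * P.ker x y \<partial>lebesgue) \<longlonglongrightarrow> (\<integral>y. \<phi> a * P.ker x y \<partial>lebesgue)"
  proof (rule integral_dominated_convergence[where w = "\<lambda>y. B * (K * wt (y - x))"])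
    show "AE y in lebesgue. (\<lambda>j. \<phi> (y / 2 ^ j + a) * P.ker x y) \<longlonglongrightarrow> \<phi> a * P.ker x y"
      by (intro always_eventually allI tendsto_mult lim1 tendsto_const)
    show "AE y in lebesgue. norm (\<phi> (y / 2 ^ j + a) * P.ker x y) \<le> B * (K * wt (y - x))" for j
      unfolding real_norm_def abs_mult using B(1) B1 K by (intro always_eventually allI mult_mono) auto
  qed (auto intro!: meas integrable_mult_right integrable_wt borel_measurable_times
      continuous_imp_lebesgue_measurable[OF P.ker_continuous])
  moreover have "(\<lambda>j. \<integral>y. \<phi> (y / 2 ^ j + a) * P.ker x y \<partial>lebesgue) \<longlonglongrightarrow> \<phi> a"
    by (rule Lim_transform_eventually[OF lim1])
       (use rep in \<open>auto simp: eventually_sequentially intro!: exI[of _ n]\<close>)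
  ultimately have "(\<integral>y. \<phi> a * P.ker x y \<partial>lebesgue) = \<phi> a" by (rule LIMSEQ_unique)
  then show ?thesis using pn by (simp add: a_def)
qed

text \<open>The left side, as a function of \<open>y\<close>, is the reproducing kernel of
  \<open>V 1\<close> at \<open>x\<close>. Subtracting the kernel of \<open>V 0\<close> leaves an
  element of \<open>V 1\<close> orthogonal to \<open>V 0\<close>, whose inner products with the
  translates of \<psi> are the values \<open>\<psi> (x - of_int k)\<close>. Its expansion is
  therefore the series that defines \<open>Q.ker\<close>.\<close>

lemma ker_two_scale: "2 * P.ker (2 * x) (2 * y) = P.ker x y + Q.ker x y"
proof -
  define g where "g z = 2 * P.ker (2 * x) (2 * z)" for z
  obtain K where K: "K > 0" "\<And>x y. \<bar>P.ker x y\<bar> \<le> K * wt (y - x)" by (rule P.ker_decay) (rule that; assumption)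
  have gV: "g \<in> V 1"
    unfolding g_def using V_cmult[of "P.ker (2 * x)" 0 2] P.ker_in[of "2 * x"]
      V_scale[of "\<lambda>z. 2 * P.ker (2 * x) z" 0] by simp
  have gc: "continuous_on UNIV g"
    unfolding g_def by (intro continuous_intros continuous_on_compose2[OF P.ker_continuous]) auto
  have gd: "\<bar>g z\<bar> \<le> 2 * K * wt (z - x)" for z
  proof -
    have "\<bar>g z\<bar> \<le> 2 * (K * wt (2 * z - 2 * x))" using K(2)[of "2 * x" "2 * z"] by (simp add: g_def abs_mult)
    also have "\<dots> \<le> 2 * (K * wt (z - x))" using K(1) by (intro mult_left_mono wt_antimono) auto
    finally show ?thesis by simp
  qed
  \<comment> \<open>Reproduction in \<open>V 1\<close> is reproduction in \<open>V 0\<close> for the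
    stretched function, followed by the substitution of \<open>2 * y\<close> for
    \<open>y\<close>.\<close>
  have g_inner: "l2_inner g h = h x"
    if h: "h \<in> V 1" "continuous_on UNIV h" "\<And>y. \<bar>h y\<bar> \<le> C * wt (y - c)" for h C c
  proof -
    have "0 \<le> C" using order_trans[OF abs_ge_zero h(3)[of c]] by (simp add: zero_le_mult_iff wt_def)
    have hc: "continuous_on UNIV (\<lambda>y. h (y / 2))" by (rule continuous_on_compose2[OF h(2)]) (auto intro!: continuous_intros)
    have "\<bar>h (y / 2)\<bar> \<le> (C * 2\<^sup>2) * wt (y - 2 * c)" for y
    proof -
      have "\<bar>h (y / 2)\<bar> \<le> C * wt ((y - 2 * c) / 2)" using h(3)[of "y / 2"] by (simp add: diff_divide_distrib)
      also have "\<dots> \<le> C * (2\<^sup>2 * wt (y - 2 * c))" using \<open>0 \<le> C\<close> by (intro mult_left_mono wt_scale) auto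
      finally show ?thesis by simp
    qed
    from P.ker_reproduces[OF V1_half[OF h(1)] hc this, of "2 * x"]
    have "h x = (\<integral>y. h (y / 2) * P.ker (2 * x) y \<partial>lebesgue)" by simp
    also have "\<dots> = 2 * (\<integral>y. h ((0 + 2 * y) / 2) * P.ker (2 * x) (0 + 2 * y) \<partial>lebesgue)"
      by (subst integral_affine_real[of 2 _ 0, symmetric])
         (auto intro!: continuous_imp_lebesgue_measurable continuous_intros hc P.ker_continuous)
    also have "\<dots> = l2_inner g h"
    proof -
      have "l2_inner g h = (\<integral>y. 2 * (h y * P.ker (2 * x) (2 * y)) \<partial>lebesgue)"
        by (simp add: l2_inner_def g_def mult_ac)
      also have "\<dots> = 2 * (\<integral>y. h y * P.ker (2 * x) (2 * y) \<partial>lebesgue)"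
        by (rule integral_mult_right_zero)
      finally show ?thesis by simp
    qed
    finally show ?thesis by simp
  qed
  have trd: "\<exists>C. \<forall>y. \<bar>v (y - c)\<bar> \<le> C * wt (y - c)" if "rapid v" for v and c :: real
    using that unfolding rapid_def by (metis power_one_right)
  have Pc: "continuous_on UNIV (\<lambda>x. \<phi> (x - of_int k))" and Qc: "continuous_on UNIV (\<lambda>x. \<psi> (x - of_int k))" for k :: int
    by (auto intro!: continuous_on_compose2[OF P.cont] continuous_on_compose2[OF Q.cont] continuous_intros)
  have kerL2: "P.ker x \<in> L2" using P.ker_in P.S_L2 by blast
  have gL2: "g \<in> L2" by (rule weight_imp_L2[OF gc gd])
  let ?r = "\<lambda>z. g z - P.ker x z"
  have rL2: "?r \<in> L2" by (intro L2_diff gL2 kerL2)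
  have rP: "l2_inner ?r (P.tr k) = 0" for k
  proof -
    obtain C where C: "\<And>y. \<bar>\<phi> (y - of_int k)\<bar> \<le> C * wt (y - of_int k)" using trd[OF P.rapid] by blast
    have "P.tr k \<in> V 1" using P.tr_in V_Suc[of 0] by auto
    then have "l2_inner g (P.tr k) = P.tr k x" by (rule g_inner[OF _ Pc C])
    moreover have "l2_inner (P.ker x) (P.tr k) = P.tr k x"
      using P.ker_reproduces[OF P.tr_in Pc C, of x] by (simp add: l2_inner_def mult.commute)
    ultimately show ?thesis by (simp add: l2_inner_diff gL2 kerL2 P.tr_L2)
  qed
  have "l2_inner h ?r = 0" if "h \<in> V 0" for h
  proof (rule l2_closure_orthogonal[OF _ P.lin_span_L2 rL2])
    show "h \<in> l2_closure (lin_span P.tr)" using that P.closure by simp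
    fix s assume "s \<in> lin_span P.tr"
    then obtain A b where "s = (\<lambda>x. \<Sum>k\<in>A. b k * P.tr k x)" unfolding lin_span_def by blast
    then have "l2_inner s ?r = (\<Sum>k\<in>A. b k * l2_inner (P.tr k) ?r)"
      by (simp add: l2_inner_sum L2_cmult P.tr_L2 rL2 l2_inner_cmult)
    also have "\<dots> = 0" using rP by (simp add: l2_inner_commute[of "P.tr _"])
    finally show "l2_inner s ?r = 0" .
  qed
  moreover have "?r \<in> V 1"
    using V_add[OF gV V_cmult[of "P.ker x" 1 "-1"]] P.ker_in V_Suc[of 0] by auto
  ultimately have rW: "?r \<in> {g \<in> V 1. \<forall>h\<in>V 0. l2_inner g h = 0}" by (simp add: l2_inner_commute)
  have rc: "continuous_on UNIV ?r" by (intro continuous_intros gc P.ker_continuous)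
  have rd: "\<bar>?r z\<bar> \<le> (3 * K) * wt (z - x)" for z
    using gd[of z] K(2)[of x z] by simp
  have "l2_inner ?r (Q.tr k) = \<psi> (x - of_int k)" for k
  proof -
    obtain C where C: "\<And>y. \<bar>\<psi> (y - of_int k)\<bar> \<le> C * wt (y - of_int k)" using trd[OF Q.rapid] by blast
    have "l2_inner g (Q.tr k) = Q.tr k x" by (rule g_inner[OF \<psi>_translate_V1 Qc C])
    moreover have "l2_inner (P.ker x) (Q.tr k) = 0"
      using \<psi>_translate_orth[OF P.ker_in] by (simp add: l2_inner_commute)
    ultimately show ?thesis by (simp add: l2_inner_diff gL2 kerL2 Q.tr_L2)
  qed
  with Q.expansion[OF rW rc rd, of y] have "((\<lambda>k. \<psi> (x - of_int k) / Q.nrm * \<psi> (y - of_int k)) has_sum ?r y) UNIV"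
    by simp
  with Q.ker_has_sum[of x y] have "?r y = Q.ker x y" by (rule has_sum_unique[rotated])
  then show ?thesis by (simp add: g_def)
qed

end

section \<open>Vanishing moments and iterated primitives\<close>

lemma isCont_UNIV: "continuous_on UNIV f \<Longrightarrow> isCont f x"
  by (simp add: continuous_on_eq_continuous_at)

text \<open>If the derivative of order \<open>Suc l\<close> vanishes, then the one of order
  \<open>l\<close> is constant, and it decays, so it vanishes too.\<close>

lemma smooth_rapid_eq_0:
  assumes "smooth_rapid M u" "l \<le> M" "\<And>x. (deriv ^^ l) u x = 0"
  shows "u x = 0"
  using assms(2,3)
proof (induction l arbitrary: x)
  case (Suc l)
  let ?v = "(deriv ^^ l) u"
  have D: "(?v has_real_derivative 0) (at x)" for x
    using smooth_rapidD(3)[OF assms(1), of l x] Suc.prems by simp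
  have "rapid ?v" using smooth_rapidD(1)[OF assms(1)] Suc.prems(1) by simp
  have "?v x = 0" for x
  proof -
    have "?v = (\<lambda>_. ?v x)" using DERIV_isconst_all[of ?v] D by auto
    moreover have "(?v \<longlongrightarrow> 0) at_top" by (rule rapid_tendsto_0(1)[OF \<open>rapid ?v\<close>])
    ultimately have "((\<lambda>_. ?v x) \<longlongrightarrow> 0) (at_top :: real filter)" by metis
    then show ?thesis by (simp add: tendsto_const_iff)
  qed
  then show ?case using Suc.IH Suc.prems(1) by simp
qed simp

context mra
begin

text \<open>Stretching \<psi> by 2 moves it from \<open>V 1\<close> into \<open>V 0\<close>, and
  further stretching keeps it there, while the translates of \<psi> are orthogonal to
  \<open>V 0\<close>. The translation is then shifted to the stretched factor, where it becomes
  dyadic.\<close>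

lemma \<psi>_orth_dilate:
  assumes "j \<ge> 1"
  shows "(\<integral>y. \<psi> (y / 2 ^ j + of_int k / 2 ^ j) * \<psi> y \<partial>lebesgue) = 0"
proof -
  obtain i where j: "j = Suc i" using assms by (cases j) auto
  have "(\<lambda>x. \<psi> (x / 2)) \<in> V 0" using V1_half[OF \<psi>_translate_V1[of 0]] by simp
  from V0_dilate[OF this, of i] have "(\<lambda>x. \<psi> (x / 2 ^ j)) \<in> V 0" by (simp add: j field_simps)
  from \<psi>_translate_orth[OF this, of k]
  have "0 = (\<integral>y. \<psi> (y - of_int k) * \<psi> (y / 2 ^ j) \<partial>lebesgue)"
    by (simp add: l2_inner_def)
  also have "\<dots> = (\<integral>y. \<psi> (of_int k + 1 * y - of_int k) * \<psi> ((of_int k + 1 * y) / 2 ^ j) \<partial>lebesgue)"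
    by (subst integral_affine_real[of 1 _ "of_int k", symmetric])
       (auto intro!: continuous_imp_lebesgue_measurable continuous_intros continuous_on_compose2[OF Q.cont])
  finally show ?thesis by (simp add: add_divide_distrib add.commute mult.commute)
qed

text \<open>The remainder is uniform in \<open>a\<close> and \<open>s\<close> because the derivative
  of order \<open>l + 1 \<le> M\<close> decays rapidly and is therefore bounded.\<close>

lemma taylor_\<psi>:
  assumes "l < M"
  obtains B where "B \<ge> 0"
    "\<And>a s. \<bar>\<psi> (a + s) - (\<Sum>m\<le>l. (deriv ^^ m) \<psi> a / fact m * s ^ m)\<bar> \<le> B * \<bar>s\<bar> ^ Suc l"
proof -
  have "rapid ((deriv ^^ Suc l) \<psi>)" by (rule smooth_rapidD(1)[OF smooth(2)]) (use assms in simp)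
  then obtain B where B: "B > 0" "\<And>x. \<bar>(deriv ^^ Suc l) \<psi> x\<bar> \<le> B" using rapid_bounded by blast
  show ?thesis
  proof (rule that[of B])
    fix a s
    have "\<exists>t. \<bar>t\<bar> \<le> \<bar>s\<bar> \<and> \<psi> (a + s) = (\<Sum>m<Suc l. (\<lambda>m x. (deriv ^^ m) \<psi> (a + x)) m 0 / fact m * s ^ m)
        + (\<lambda>m x. (deriv ^^ m) \<psi> (a + x)) (Suc l) t / fact (Suc l) * s ^ Suc l"
    proof (rule Maclaurin_bi_le)
      show "(\<lambda>x. (deriv ^^ 0) \<psi> (a + x)) = (\<lambda>s. \<psi> (a + s))" by simp
      show "\<forall>m t. m < Suc l \<and> \<bar>t\<bar> \<le> \<bar>s\<bar> \<longrightarrow>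
        ((\<lambda>x. (deriv ^^ m) \<psi> (a + x)) has_real_derivative (deriv ^^ Suc m) \<psi> (a + t)) (at t)"
      proof (intro allI impI)
        fix m t assume "m < Suc l \<and> \<bar>t\<bar> \<le> \<bar>s\<bar>"
        then have "((deriv ^^ m) \<psi> has_real_derivative (deriv ^^ Suc m) \<psi> (t + a)) (at (t + a))"
          by (intro smooth_rapidD(3)[OF smooth(2)]) (use assms in simp)
        then show "((\<lambda>x. (deriv ^^ m) \<psi> (a + x)) has_real_derivative (deriv ^^ Suc m) \<psi> (a + t)) (at t)"
          by (simp only: DERIV_shift add.commute[of a])
      qed
    qed
    then obtain t where "\<psi> (a + s) = (\<Sum>m<Suc l. (deriv ^^ m) \<psi> a / fact m * s ^ m)
        + (deriv ^^ Suc l) \<psi> (a + t) / fact (Suc l) * s ^ Suc l" by auto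
    then have "\<bar>\<psi> (a + s) - (\<Sum>m\<le>l. (deriv ^^ m) \<psi> a / fact m * s ^ m)\<bar>
        = \<bar>(deriv ^^ Suc l) \<psi> (a + t)\<bar> / fact (Suc l) * \<bar>s\<bar> ^ Suc l"
      by (simp add: lessThan_Suc_atMost abs_mult power_abs del: funpow.simps fact_Suc power_Suc)
    also have "\<dots> \<le> B / 1 * \<bar>s\<bar> ^ Suc l"
      using B by (intro mult_right_mono frac_le fact_ge_1) auto
    finally show "\<bar>\<psi> (a + s) - (\<Sum>m\<le>l. (deriv ^^ m) \<psi> a / fact m * s ^ m)\<bar> \<le> B * \<bar>s\<bar> ^ Suc l" by simp
  qed (use B in simp)
qed

text \<open>The wavelet is orthogonal to its dilates \<open>\<psi>(2\<^sup>-\<^sup>j y + a)\<close>, \<open>a\<close> dyadic. In the Taylor expansion at \<open>a\<close> the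
  first moment that does not vanish would dominate as \<open>j\<close> grows, so its coefficient is zero at all
  dyadic points; but no derivative of \<open>\<psi>\<close> vanishes identically.\<close>

lemma moments:
  "l < M \<Longrightarrow> (\<integral>y. y ^ l * \<psi> y \<partial>lebesgue) = 0"
proof (induction l rule: less_induct)
  case (less l)
  define mm where "mm l = (\<integral>y. y ^ l * \<psi> y \<partial>lebesgue)" for l
  have int: "integrable lebesgue (\<lambda>y. y ^ l * \<psi> y)" for l
    by (rule rapid_imp_integrable[OF rapid_mult_power[OF Q.rapid]]) (intro continuous_intros Q.cont)
  have int_abs: "integrable lebesgue (\<lambda>y. \<bar>y\<bar> ^ Suc l * \<bar>\<psi> y\<bar>)"
    using integrable_abs[OF int[of "Suc l"]] by (simp add: abs_mult power_abs)
  obtain B where B: "B \<ge> 0"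
    "\<And>a s. \<bar>\<psi> (a + s) - (\<Sum>m\<le>l. (deriv ^^ m) \<psi> a / fact m * s ^ m)\<bar> \<le> B * \<bar>s\<bar> ^ Suc l"
    by (rule taylor_\<psi>[OF less.prems]) (rule that; assumption)
  define J where "J = (\<integral>y. \<bar>y\<bar> ^ Suc l * \<bar>\<psi> y\<bar> \<partial>lebesgue)"
  have dyadic: "(deriv ^^ l) \<psi> (of_int p / 2 ^ n) * mm l = 0" for p n
  proof -
    define a :: real where "a = of_int p / 2 ^ n"
    define D where "D = (deriv ^^ l) \<psi> a / fact l * mm l"
    \<comment> \<open>The Taylor polynomial contributes \<open>D / 2 ^ (j * l)\<close>, the lower
      moments being zero by induction. The remainder is of the order of
      \<open>1 / 2 ^ (j * Suc l)\<close>, and the two cancel by orthogonality; multiplying by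
      \<open>2 ^ (j * l)\<close> leaves one factor \<open>(1/2) ^ j\<close>.\<close>
    have le: "\<bar>D\<bar> \<le> B * J * (1/2) ^ j" if "j \<ge> Suc n" for j
    proof -
      define q where "q = p * 2 ^ (j - n)"
      have q: "of_int q / 2 ^ j = a"
      proof -
        have "(2::real) ^ j = 2 ^ (j - n) * 2 ^ n" using that by (simp flip: power_add)
        then show ?thesis by (simp add: q_def a_def)
      qed
      let ?T = "\<lambda>y. \<Sum>m\<le>l. (deriv ^^ m) \<psi> a / fact m * (y / 2 ^ j) ^ m"
      have 0: "(\<integral>y. \<psi> (a + y / 2 ^ j) * \<psi> y \<partial>lebesgue) = 0"
        using \<psi>_orth_dilate[of j q] that by (simp add: q add.commute)
      have eqT: "(\<lambda>y. ?T y * \<psi> y) = (\<lambda>y. \<Sum>m\<le>l. ((deriv ^^ m) \<psi> a / fact m / 2 ^ (j * m)) * (y ^ m * \<psi> y))"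
        unfolding sum_distrib_right by (intro ext sum.cong refl) (simp add: power_divide power_mult)
      have intT: "integrable lebesgue (\<lambda>y. ?T y * \<psi> y)"
        unfolding eqT by (intro Bochner_Integration.integrable_sum integrable_mult_right int)
      have "(\<integral>y. ?T y * \<psi> y \<partial>lebesgue) = (\<Sum>m\<le>l. ((deriv ^^ m) \<psi> a / fact m / 2 ^ (j * m)) * mm m)"
        unfolding eqT mm_def
        by (subst Bochner_Integration.integral_sum) (intro integrable_mult_right int, simp only: integral_mult_right_zero)
      also have "\<dots> = (\<Sum>m\<in>{l}. ((deriv ^^ m) \<psi> a / fact m / 2 ^ (j * m)) * mm m)"
        by (rule sum.mono_neutral_right) (use less in \<open>auto simp: mm_def\<close>)
      also have "\<dots> = D / 2 ^ (j * l)" by (simp add: D_def)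
      finally have T: "(\<integral>y. ?T y * \<psi> y \<partial>lebesgue) = D / 2 ^ (j * l)" .
      have int1: "integrable lebesgue (\<lambda>y. \<psi> (a + y / 2 ^ j) * \<psi> y)"
      proof -
        obtain B' where B': "B' > 0" "\<And>x. \<bar>\<psi> x\<bar> \<le> B'" using rapid_bounded[OF Q.rapid] by blast
        have "integrable lebesgue (\<lambda>y. B' * \<psi> y)" using int[of 0] by simp
        then show ?thesis
          by (rule Bochner_Integration.integrable_bound)
             (use B' in \<open>auto simp: abs_mult intro!: mult_right_mono continuous_imp_lebesgue_measurable
               continuous_intros continuous_on_compose2[OF Q.cont]\<close>)
      qed
      have "D / 2 ^ (j * l) = - (\<integral>y. \<psi> (a + y / 2 ^ j) * \<psi> y - ?T y * \<psi> y \<partial>lebesgue)"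
        using Bochner_Integration.integral_diff[OF int1 intT] 0 T by linarith
      then have "\<bar>D / 2 ^ (j * l)\<bar> = norm (\<integral>y. \<psi> (a + y / 2 ^ j) * \<psi> y - ?T y * \<psi> y \<partial>lebesgue)"
        by simp
      also have "\<dots> \<le> (\<integral>y. (B / 2 ^ (j * Suc l)) * (\<bar>y\<bar> ^ Suc l * \<bar>\<psi> y\<bar>) \<partial>lebesgue)"
      proof (rule norm_integral_le)
        show "(\<lambda>y. \<psi> (a + y / 2 ^ j) * \<psi> y - ?T y * \<psi> y) \<in> borel_measurable lebesgue"
          by (rule borel_measurable_integrable[OF Bochner_Integration.integrable_diff[OF int1 intT]])
        show "integrable lebesgue (\<lambda>y. (B / 2 ^ (j * Suc l)) * (\<bar>y\<bar> ^ Suc l * \<bar>\<psi> y\<bar>))"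
          by (intro integrable_mult_right int_abs)
        fix y
        have "norm (\<psi> (a + y / 2 ^ j) * \<psi> y - ?T y * \<psi> y) = \<bar>\<psi> (a + y / 2 ^ j) - ?T y\<bar> * \<bar>\<psi> y\<bar>"
          by (simp add: left_diff_distrib[symmetric] abs_mult)
        also have "\<dots> \<le> B * \<bar>y / 2 ^ j\<bar> ^ Suc l * \<bar>\<psi> y\<bar>"
          by (intro mult_right_mono B(2)) auto
        also have "\<dots> = (B / 2 ^ (j * Suc l)) * (\<bar>y\<bar> ^ Suc l * \<bar>\<psi> y\<bar>)"
          by (simp only: abs_divide power_divide power_mult abs_power2 abs_numeral power_abs mult.assoc) simp
        finally show "norm (\<psi> (a + y / 2 ^ j) * \<psi> y - ?T y * \<psi> y) \<le> (B / 2 ^ (j * Suc l)) * (\<bar>y\<bar> ^ Suc l * \<bar>\<psi> y\<bar>)" .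
      qed
      also have "\<dots> = (B / 2 ^ (j * Suc l)) * J" unfolding J_def by (rule integral_mult_right_zero)
      finally have "\<bar>D\<bar> / 2 ^ (j * l) \<le> B * J / 2 ^ (j * Suc l)" by (simp add: abs_divide)
      then have "\<bar>D\<bar> / 2 ^ (j * l) * 2 ^ (j * l) \<le> B * J / 2 ^ (j * Suc l) * 2 ^ (j * l)"
        by (rule mult_right_mono) simp
      then show ?thesis by (simp add: power_add power_one_over)
    qed
    have "(\<lambda>j. B * J * (1/2) ^ j) \<longlonglongrightarrow> B * J * 0"
      by (intro tendsto_intros LIMSEQ_power_zero) auto
    then have "\<bar>D\<bar> \<le> B * J * 0"
      by (rule LIMSEQ_le_const) (use le in blast)
    then have "D = 0" by simp
    then show ?thesis by (simp add: D_def a_def)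
  qed
  have "mm l = 0"
  proof (rule ccontr)
    assume "mm l \<noteq> 0"
    have c: "continuous_on UNIV ((deriv ^^ l) \<psi>)" using smooth_rapidD(2)[OF smooth(2)] less.prems by simp
    have "(deriv ^^ l) \<psi> x = 0" for x
    proof (rule ccontr)
      assume "(deriv ^^ l) \<psi> x \<noteq> 0"
      then obtain p n where "(deriv ^^ l) \<psi> (of_int p / 2 ^ n) \<noteq> 0" using dyadic_nonzero[OF c] by blast
      then show False using dyadic[of p n] \<open>mm l \<noteq> 0\<close> by simp
    qed
    then have "\<psi> x = 0" for x using smooth_rapid_eq_0[OF smooth(2), of l] less.prems by simp
    then show False using Q.nonzero by blast
  qed
  then show ?case by (simp add: mm_def)
qed

end

section \<open>Rapidly decaying primitives\<close>

lemma integral_deriv_rapid: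
  assumes G: "rapid G" "\<And>x. (G has_real_derivative g x) (at x)" and g: "rapid g" "continuous_on UNIV g"
  shows "(\<integral>x. g x \<partial>lebesgue) = 0"
proof -
  have [measurable]: "g \<in> borel_measurable borel" using g(2) by (rule borel_measurable_continuous_onI)
  have gi: "integrable lborel g" using rapid_imp_integrable[OF g] by (simp add: integrable_completion)
  have "(\<lambda>n. \<integral>x. g x * indicator {- real n..real n} x \<partial>lborel) \<longlonglongrightarrow> (\<integral>x. g x \<partial>lborel)"
  proof (rule integral_dominated_convergence[where w = "\<lambda>x. \<bar>g x\<bar>"])
    show "AE x in lborel. (\<lambda>n. g x * indicator {- real n..real n} x) \<longlonglongrightarrow> g x"
    proof (intro always_eventually allI)
      fix x
      obtain N where N: "\<bar>x\<bar> \<le> real N" using real_arch_simple by blast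
      show "(\<lambda>n. g x * indicator {- real n..real n} x) \<longlonglongrightarrow> g x"
        by (rule tendsto_eventually)
           (use N in \<open>auto simp: eventually_sequentially indicator_def intro!: exI[of _ N]\<close>)
    qed
    show "AE x in lborel. norm (g x * indicator {- real n..real n} x) \<le> \<bar>g x\<bar>" for n
      by (intro always_eventually allI) (simp add: indicator_def)
  qed (use gi in auto)
  moreover have "(\<integral>x. g x * indicator {- real n..real n} x \<partial>lborel) = G (real n) - G (- real n)" for n
    by (rule integral_FTC_Icc_real) (use G(2) g(2) isCont_UNIV in auto)
  moreover have "(\<lambda>n. G (real n) - G (- real n)) \<longlonglongrightarrow> 0 - 0"
    by (intro tendsto_diff filterlim_compose[OF rapid_tendsto_0(1)[OF G(1)]]
        filterlim_compose[OF rapid_tendsto_0(2)[OF G(1)]] filterlim_real_sequentially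
        filterlim_compose[OF filterlim_uminus_at_bot_at_top filterlim_real_sequentially])
  ultimately have "(\<integral>x. g x \<partial>lborel) = 0" by (simp add: LIMSEQ_unique)
  then show ?thesis by (simp add: integral_completion)
qed

text \<open>The primitive is the integral over the left half-line. As the total integral is zero, it
  is also minus the integral over the right half-line, and thus decays at both ends. Integrating the
  derivative of \<open>x ^ Suc l * U x\<close> expresses the \<open>l\<close>-th moment of
  \<open>U\<close> by the moment of \<open>u\<close> of order \<open>l + 1\<close>, so each
  primitive uses up one vanishing moment.\<close>

lemma rapid_primitive:
  assumes u: "rapid u" "continuous_on UNIV u" and m: "\<And>l. l < Suc m \<Longrightarrow> (\<integral>x. x ^ l * u x \<partial>lebesgue) = 0"
  obtains U where "rapid U" "continuous_on UNIV U" "\<And>x. (U has_real_derivative u x) (at x)"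
    "\<And>l. l < m \<Longrightarrow> (\<integral>x. x ^ l * U x \<partial>lebesgue) = 0"
proof -
  obtain F where "\<forall>x::real. -\<infinity> < ereal x \<longrightarrow> ereal x < \<infinity> \<longrightarrow> (F has_vector_derivative u x) (at x)"
    using einterval_antiderivative[of "-\<infinity>" "\<infinity>" u] isCont_UNIV[OF u(2)] by auto
  then have F: "(F has_real_derivative u x) (at x)" for x
    by (simp add: has_real_derivative_iff_has_vector_derivative)
  have ui: "integrable lebesgue u" by (rule rapid_imp_integrable[OF u])
  have ub: "u \<in> borel_measurable borel" using u(2) by (rule borel_measurable_continuous_onI)
  define U where "U x = (\<integral>t. u t * indicator {..x} t \<partial>lebesgue)" for x
  have ind: "integrable lebesgue (\<lambda>t. u t * indicator A t)" if "A \<in> sets borel" for A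
    using integrable_mult_indicator[OF _ ui, of A] that by (simp add: mult.commute)
  have diff: "U y - U x = F y - F x" if "x \<le> y" for x y
  proof -
    have "U y - U x = (\<integral>t. u t * indicator {..y} t - u t * indicator {..x} t \<partial>lebesgue)"
      unfolding U_def by (subst Bochner_Integration.integral_diff) (auto intro!: ind)
    also have "\<dots> = (\<integral>t. u t * indicator {x..y} t \<partial>lebesgue)"
    proof (rule integral_cong_AE)
      have "AE t in lebesgue. t \<noteq> x"
        by (rule AE_completion) (rule AE_lborel_singleton)
      then show "AE t in lebesgue. u t * indicator {..y} t - u t * indicator {..x} t = u t * indicator {x..y} t"
        by eventually_elim (use that in \<open>auto simp: indicator_def\<close>)
    qed (auto intro!: borel_measurable_diff borel_measurable_integrable[OF ind])
    also have "\<dots> = (\<integral>t. u t * indicator {x..y} t \<partial>lborel)"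
      by (rule integral_completion) (use ub in measurable)
    also have "\<dots> = F y - F x"
      by (rule integral_FTC_Icc_real[OF that]) (use F isCont_UNIV[OF u(2)] in auto)
    finally show ?thesis .
  qed
  define c where "c = U 0 - F 0"
  have UF: "U x = F x + c" for x
    using diff[of 0 x] diff[of x 0] unfolding c_def by linarith
  have D: "(U has_real_derivative u x) (at x)" for x
  proof -
    have "U = (\<lambda>x. F x + c)" using UF by blast
    then show ?thesis using DERIV_add[OF F[of x] DERIV_const[of c]] by simp
  qed
  have total: "(\<integral>t. u t \<partial>lebesgue) = 0" using m[of 0] by simp
  have alt: "U x = - (\<integral>t. u t * indicator {x<..} t \<partial>lebesgue)" for x
  proof -
    have "U x + (\<integral>t. u t * indicator {x<..} t \<partial>lebesgue) = (\<integral>t. u t * indicator {..x} t + u t * indicator {x<..} t \<partial>lebesgue)"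
      unfolding U_def by (subst Bochner_Integration.integral_add) (auto intro!: ind)
    also have "\<dots> = (\<integral>t. u t \<partial>lebesgue)"
      by (rule Bochner_Integration.integral_cong) (auto simp: indicator_def)
    finally show ?thesis using total by simp
  qed
  have rU: "rapid U"
  proof (rule rapidI)
    fix N
    obtain C where C: "C > 0" "\<And>x. \<bar>u x\<bar> \<le> C * wt x ^ Suc N" by (rule rapidD[OF u(1)]) (rule that; assumption)
    \<comment> \<open>On the half-line that points away from the origin all points are at least as
      far out as \<open>x\<close>. Of the \<open>N + 1\<close> powers of the weight,
      \<open>N\<close> are bounded by their value at \<open>x\<close> and the last one is
      integrated.\<close>
    have tail: "norm (\<integral>t. u t * indicator A t \<partial>lebesgue) \<le> (C * wt_int) * wt x ^ N"
      if A: "A \<in> sets borel" and "\<And>t. t \<in> A \<Longrightarrow> \<bar>x\<bar> \<le> \<bar>t\<bar>" for A x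
    proof -
      have "norm (\<integral>t. u t * indicator A t \<partial>lebesgue) \<le> (\<integral>t. C * wt x ^ N * wt t \<partial>lebesgue)"
      proof (rule norm_integral_le)
        fix t
        show "norm (u t * indicator A t) \<le> C * wt x ^ N * wt t"
        proof (cases "t \<in> A")
          case True
          have "\<bar>u t\<bar> \<le> C * (wt t ^ N * wt t)" using C(2)[of t] by (simp add: mult.commute)
          also have "\<dots> \<le> C * (wt x ^ N * wt t)"
            using C(1) that(2)[OF True] by (intro mult_left_mono mult_right_mono power_mono wt_antimono) auto
          finally show ?thesis using True by simp
        qed (use C(1) in simp)
      qed (intro borel_measurable_integrable[OF ind] A integrable_mult_right integrable_wt_0)+
      then show ?thesis by (simp add: wt_int_def mult_ac)
    qed
    have "\<bar>U x\<bar> \<le> (C * wt_int) * wt x ^ N" for x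
    proof (cases "x \<le> 0")
      case True
      then show ?thesis using tail[of "{..x}" x] by (simp add: U_def)
    next
      case False
      then show ?thesis using tail[of "{x<..}" x] by (simp add: alt)
    qed
    then show "\<exists>C. \<forall>x. \<bar>U x\<bar> \<le> C * wt x ^ N" by blast
  qed
  have cU: "continuous_on UNIV U"
    using D by (meson DERIV_isCont continuous_at_imp_continuous_on)
  have mU: "(\<integral>x. x ^ l * U x \<partial>lebesgue) = 0" if "l < m" for l
  proof -
    define g where "g x = real (Suc l) * (x ^ l * U x) + x ^ Suc l * u x" for x
    have i1: "integrable lebesgue (\<lambda>x. x ^ l * U x)" and i2: "integrable lebesgue (\<lambda>x. x ^ Suc l * u x)"
      by (intro rapid_imp_integrable rapid_mult_power rU u continuous_intros cU)+
    have rg: "rapid g"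
    proof (rule rapidI)
      fix N
      obtain C1 C2 where C: "\<And>x. \<bar>x ^ l * U x\<bar> \<le> C1 * wt x ^ N" "\<And>x. \<bar>x ^ Suc l * u x\<bar> \<le> C2 * wt x ^ N"
        using rapid_mult_power[OF rU, of l] rapid_mult_power[OF u(1), of "Suc l"] unfolding rapid_def by meson
      have "\<bar>g x\<bar> \<le> (real (Suc l) * C1 + C2) * wt x ^ N" for x
      proof -
        have "\<bar>g x\<bar> \<le> real (Suc l) * \<bar>x ^ l * U x\<bar> + \<bar>x ^ Suc l * u x\<bar>"
          unfolding g_def by (rule order_trans[OF abs_triangle_ineq]) (simp add: abs_mult)
        also have "\<dots> \<le> real (Suc l) * (C1 * wt x ^ N) + C2 * wt x ^ N"
          by (intro add_mono mult_left_mono C) auto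
        finally show ?thesis by (simp add: algebra_simps)
      qed
      then show "\<exists>C. \<forall>x. \<bar>g x\<bar> \<le> C * wt x ^ N" by blast
    qed
    have "(\<integral>x. g x \<partial>lebesgue) = 0"
    proof (rule integral_deriv_rapid[OF rapid_mult_power[OF rU, of "Suc l"] _ rg])
      show "((\<lambda>x. x ^ Suc l * U x) has_real_derivative g x) (at x)" for x
        unfolding g_def
        by (rule DERIV_cong[OF DERIV_mult[OF DERIV_pow D]]) (simp add: mult_ac)
      show "continuous_on UNIV g" unfolding g_def by (intro continuous_intros cU u)
    qed
    moreover have "(\<integral>x. g x \<partial>lebesgue) = real (Suc l) * (\<integral>x. x ^ l * U x \<partial>lebesgue) + (\<integral>x. x ^ Suc l * u x \<partial>lebesgue)"
      unfolding g_def
      by (subst Bochner_Integration.integral_add) (intro integrable_mult_right i1 i2 | simp only: integral_mult_right_zero)+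
    moreover have "(\<integral>x. x ^ Suc l * u x \<partial>lebesgue) = 0" using m[of "Suc l"] that by simp
    ultimately show ?thesis by simp
  qed
  show ?thesis by (rule that[OF rU cU D mU])
qed

lemma rapid_iterated_primitives:
  assumes "rapid u" "continuous_on UNIV u" "\<And>l. l < m \<Longrightarrow> (\<integral>x. x ^ l * u x \<partial>lebesgue) = 0"
  shows "\<exists>\<theta>. \<theta> 0 = u \<and> (\<forall>n\<le>m. rapid (\<theta> n) \<and> continuous_on UNIV (\<theta> n)) \<and>
    (\<forall>n<m. \<forall>x. (\<theta> (Suc n) has_real_derivative \<theta> n x) (at x))"
  using assms
proof (induction m arbitrary: u)
  case 0
  then show ?case by (intro exI[of _ "\<lambda>_. u"]) auto
next
  case (Suc m)
  obtain U where U: "rapid U" "continuous_on UNIV U" "\<And>x. (U has_real_derivative u x) (at x)"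
    "\<And>l. l < m \<Longrightarrow> (\<integral>x. x ^ l * U x \<partial>lebesgue) = 0"
    using rapid_primitive[of u m, OF Suc.prems] by blast
  obtain \<theta> where \<theta>: "\<theta> 0 = U" "\<And>n. n \<le> m \<Longrightarrow> rapid (\<theta> n)" "\<And>n. n \<le> m \<Longrightarrow> continuous_on UNIV (\<theta> n)"
    "\<And>n x. n < m \<Longrightarrow> (\<theta> (Suc n) has_real_derivative \<theta> n x) (at x)"
    using Suc.IH[OF U(1,2,4)] by auto
  let ?\<theta> = "\<lambda>n. case n of 0 \<Rightarrow> u | Suc n \<Rightarrow> \<theta> n"
  have "rapid (?\<theta> n) \<and> continuous_on UNIV (?\<theta> n)" if "n \<le> Suc m" for n
    using that \<theta>(2,3) Suc.prems(1,2) by (cases n) auto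
  moreover have "(?\<theta> (Suc n) has_real_derivative ?\<theta> n x) (at x)" if "n < Suc m" for n x
    using that \<theta>(4) U(3) \<theta>(1) by (cases n) auto
  ultimately show ?case by (intro exI[of _ ?\<theta>]) auto
qed

section \<open>Coefficients are bounded by the modulus of smoothness\<close>

lemma tail_prod_split:
  fixes x :: "real^'d"
  shows "(\<Prod>i\<in>UNIV. (if i = m then w else v i) (x $ i)) = w (x $ m) * (\<Prod>i\<in>UNIV - {m}. v i (x $ i))"
  by (simp add: prod.remove[of UNIV m])

lemma integrable_ridge:
  fixes m :: "'d::finite"
  assumes "continuous_on UNIV w" "integrable lebesgue w" "\<And>i. continuous_on UNIV (v i)" "\<And>i. rapid (v i)"
  shows "integrable lebesgue (\<lambda>x::real^'d. w (x $ m) * (\<Prod>i\<in>UNIV - {m}. v i (x $ i)))"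
  using integrable_prod_vec[of "\<lambda>i. if i = m then w else v i"] assms
  by (simp add: tail_prod_split borel_measurable_continuous_onI rapid_imp_integrable if_distrib[of "integrable lebesgue"]
      if_distrib[of "\<lambda>g. g \<in> borel_measurable borel"])

lemma continuous_ridge:
  fixes m :: "'d::finite" and w :: "real \<Rightarrow> real" and v :: "'d \<Rightarrow> real \<Rightarrow> real"
  assumes "continuous_on UNIV w" "\<And>i. continuous_on UNIV (v i)"
  shows "continuous_on UNIV (\<lambda>x::real^'d. w (x $ m) * (\<Prod>i\<in>UNIV - {m}. v i (x $ i)))"
proof (intro continuous_on_mult continuous_on_prod)
  show "continuous_on UNIV (\<lambda>x::real^'d. w (x $ m))"
    by (rule continuous_on_compose2[OF assms(1)]) (auto intro!: continuous_intros)
  show "continuous_on UNIV (\<lambda>x::real^'d. v i (x $ i))" for i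
    by (rule continuous_on_compose2[OF assms(2)]) (auto intro!: continuous_intros)
qed

lemma integrable_bounded_mult:
  fixes f g :: "'a \<Rightarrow> real"
  assumes "f \<in> borel_measurable M" "\<And>x. \<bar>f x\<bar> \<le> B" "integrable M g"
  shows "integrable M (\<lambda>x. f x * g x)"
proof (rule Bochner_Integration.integrable_bound)
  show "integrable M (\<lambda>x. B * \<bar>g x\<bar>)" by (intro integrable_mult_right integrable_abs assms)
  show "(\<lambda>x. f x * g x) \<in> borel_measurable M" using assms(1,3) by measurable
  have "0 \<le> B" using order_trans[OF abs_ge_zero assms(2)] .
  then show "AE x in M. norm (f x * g x) \<le> norm (B * \<bar>g x\<bar>)"
    using assms(2) by (intro always_eventually allI) (auto simp: abs_mult intro!: mult_right_mono)
qed

text \<open>Derivatives are shifted in one direction \<open>m\<close> only, later chosen as one in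
  which the wavelet has the factor \<psi>; \<open>\<theta> n\<close> will be its \<open>n\<close>-th
  primitive. The other factors \<open>v\<close> need no moments and stay unchanged.\<close>

locale ridge_chain =
  fixes m :: "'d::finite" and M :: nat and \<theta> :: "nat \<Rightarrow> real \<Rightarrow> real" and v :: "'d \<Rightarrow> real \<Rightarrow> real"
  assumes \<theta>: "\<And>n. n \<le> M \<Longrightarrow> rapid (\<theta> n)" "\<And>n. n \<le> M \<Longrightarrow> continuous_on UNIV (\<theta> n)"
      "\<And>n x. n < M \<Longrightarrow> (\<theta> (Suc n) has_real_derivative \<theta> n x) (at x)"
    and v: "\<And>i. continuous_on UNIV (v i)" "\<And>i. rapid (v i)"
    and M: "M \<ge> 1"
begin

definition R :: "real^'d \<Rightarrow> real" where "R x = (\<Prod>i\<in>UNIV - {m}. v i (x $ i))"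

abbreviation e :: "real^'d" where "e \<equiv> axis m 1"

lemma R_shift: "R (x + t *\<^sub>R e) = R x"
  unfolding R_def by (intro prod.cong) (auto simp: axis_def)

lemma integrable_\<theta>R: "n \<le> M \<Longrightarrow> integrable lebesgue (\<lambda>x. \<theta> n (x $ m) * R x)"
  unfolding R_def by (intro integrable_ridge v \<theta> rapid_imp_integrable)

lemma wtR: "integrable lebesgue (\<lambda>x. wt (x $ m - t) * R x)"
proof -
  have "continuous_on UNIV (\<lambda>s. wt (s - t))" by (intro continuous_intros)
  from integrable_ridge[OF this integrable_wt v] show ?thesis unfolding R_def .
qed

context
  fixes f :: "real^'d \<Rightarrow> real" and B :: real
  assumes f: "f \<in> borel_measurable lebesgue" and B: "\<And>x. \<bar>f x\<bar> \<le> B"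
begin

text \<open>The correlation of \<open>f\<close> with the \<open>n\<close>-th function of the chain,
  translated by \<open>t\<close> in direction \<open>m\<close>. The value \<open>J 0 0\<close>
  becomes a wavelet coefficient, and derivatives in \<open>t\<close> fall on the chain, never on
  \<open>f\<close>.\<close>

definition J :: "nat \<Rightarrow> real \<Rightarrow> real" where
  "J n t = (\<integral>x. f x * (\<theta> n (x $ m - t) * R x) \<partial>lebesgue)"

lemma meas_\<theta>: "n \<le> M \<Longrightarrow> (\<lambda>x. f x * (\<theta> n (x $ m - t) * R x)) \<in> borel_measurable lebesgue"
proof (rule borel_measurable_times[OF f])
  assume "n \<le> M"
  then have "continuous_on UNIV (\<lambda>s. \<theta> n (s - t))"
    by (intro continuous_on_compose2[OF \<theta>(2)]) (auto intro!: continuous_intros)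
  from continuous_ridge[OF this v(1)] show "(\<lambda>x. \<theta> n (x $ m - t) * R x) \<in> borel_measurable lebesgue"
    unfolding R_def by (rule continuous_imp_lebesgue_measurable)
qed

text \<open>The translation moves to \<open>f\<close> because \<open>R\<close> does not depend on
  the coordinate \<open>m\<close>. Differences of \<open>J n\<close> in \<open>t\<close> thereby
  become differences of \<open>f\<close> in direction \<open>m\<close>.\<close>

lemma J_shift:
  assumes "n \<le> M"
  shows "J n t = (\<integral>x. f (x + t *\<^sub>R e) * (\<theta> n (x $ m) * R x) \<partial>lebesgue)"
  using integral_affine[of 1 _ "t *\<^sub>R e", OF _ meas_\<theta>[OF assms, of t]]
  unfolding J_def by (simp add: R_shift add.commute[of "t *\<^sub>R e"])

lemma integrable_J_shift:
  assumes "n \<le> M"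
  shows "integrable lebesgue (\<lambda>x. f (x + t *\<^sub>R e) * (\<theta> n (x $ m) * R x))"
  using borel_measurable_affine[of 1 f "t *\<^sub>R e"] f B
  by (intro integrable_bounded_mult[where B = B] integrable_\<theta>R assms) (simp_all add: add.commute)

lemma J_fdiff:
  assumes "n \<le> M"
  shows "fdiff h k (J n) 0 = (\<integral>x. fdiff (h *\<^sub>R e) k f x * (\<theta> n (x $ m) * R x) \<partial>lebesgue)"
proof -
  have "(\<integral>x. fdiff (h *\<^sub>R e) k f x * (\<theta> n (x $ m) * R x) \<partial>lebesgue)
     = (\<integral>x. (\<Sum>j\<le>k. ((-1) ^ (k - j) * real (k choose j)) * (f (x + (real j * h) *\<^sub>R e) * (\<theta> n (x $ m) * R x))) \<partial>lebesgue)"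
    unfolding fdiff_binomial sum_distrib_right by (simp add: mult.assoc)
  also have "\<dots> = (\<Sum>j\<le>k. ((-1) ^ (k - j) * real (k choose j)) * J n (real j * h))"
    by (subst Bochner_Integration.integral_sum)
       (intro integrable_mult_right integrable_J_shift assms, simp only: integral_mult_right_zero J_shift[OF assms])
  finally show ?thesis unfolding fdiff_binomial by simp
qed

lemma J_fdiff_bound:
  assumes "n \<le> M" "\<And>x. \<bar>fdiff (h *\<^sub>R e) k f x\<bar> \<le> W"
  shows "\<bar>fdiff h k (J n) 0\<bar> \<le> W * (\<integral>x. \<bar>\<theta> n (x $ m) * R x\<bar> \<partial>lebesgue)"
proof -
  have meas: "(\<lambda>x. fdiff (h *\<^sub>R e) k f x) \<in> borel_measurable lebesgue"
    unfolding fdiff_binomial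
    by (intro borel_measurable_sum borel_measurable_times borel_measurable_const)
       (use borel_measurable_affine[of 1 f "real _ *\<^sub>R h *\<^sub>R e"] f in \<open>simp add: add.commute\<close>)
  have "norm (\<integral>x. fdiff (h *\<^sub>R e) k f x * (\<theta> n (x $ m) * R x) \<partial>lebesgue)
     \<le> (\<integral>x. W * \<bar>\<theta> n (x $ m) * R x\<bar> \<partial>lebesgue)"
  proof (rule norm_integral_le)
    show "norm (fdiff (h *\<^sub>R e) k f x * (\<theta> n (x $ m) * R x)) \<le> W * \<bar>\<theta> n (x $ m) * R x\<bar>" for x
      unfolding real_norm_def abs_mult[of "fdiff _ _ _ _"] by (intro mult_right_mono assms) auto
  qed (intro borel_measurable_times meas borel_measurable_integrable[OF integrable_\<theta>R] assms
      integrable_mult_right integrable_abs integrable_\<theta>R)+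
  then show ?thesis unfolding J_fdiff[OF assms(1)] by simp
qed

text \<open>Differentiation under the integral. For increments of modulus below 1 the difference
  quotient is, up to sign, a value of \<open>\<theta> n\<close> at distance at most 1, hence at most
  a constant times 4 times the weight; this is the dominating function. The minus sign comes from
  the argument \<open>x $ m - t\<close>.\<close>

lemma J_deriv:
  assumes "n < M"
  shows "(J (Suc n) has_real_derivative - J n t) (at t)"
proof -
  have n: "n \<le> M" "Suc n \<le> M" using assms by auto
  obtain C where C: "C > 0" "\<And>x. \<bar>\<theta> n x\<bar> \<le> C * wt x ^ 1" by (rule rapidD[OF \<theta>(1)[OF n(1)]]) (rule that; assumption)
  have "0 \<le> B" using order_trans[OF abs_ge_zero B] .
  have int: "integrable lebesgue (\<lambda>x. f x * (\<theta> k (x $ m - s) * R x))" if "k \<le> M" for k s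
  proof -
    have "continuous_on UNIV (\<lambda>r. \<theta> k (r - s))"
      by (intro continuous_on_compose2[OF \<theta>(2)[OF that]]) (auto intro!: continuous_intros)
    moreover have "integrable lebesgue (\<lambda>r. \<theta> k (r - s))"
      using integrable_affine_iff_real[of 1 "\<theta> k" "-s"] rapid_imp_integrable[OF \<theta>(1)[OF that] \<theta>(2)[OF that]] by simp
    ultimately have "integrable lebesgue (\<lambda>x. \<theta> k (x $ m - s) * R x)"
      unfolding R_def by (intro integrable_ridge v)
    then show ?thesis by (rule integrable_bounded_mult[OF f B])
  qed
  have "((\<lambda>h. (J (Suc n) (t + h) - J (Suc n) t) / h) \<longlongrightarrow> - J n t) (at 0)"
    unfolding tendsto_at_iff_sequentially comp_def
  proof (intro allI impI)
    fix X :: "nat \<Rightarrow> real"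
    assume X: "\<forall>i. X i \<in> UNIV - {0}" "X \<longlonglongrightarrow> 0"
    have "\<forall>\<^sub>F i in sequentially. \<bar>X i\<bar> < 1"
      using order_tendstoD(2)[OF tendsto_rabs[OF X(2)], of 1] by simp
    then obtain N where N: "\<And>i. i \<ge> N \<Longrightarrow> \<bar>X i\<bar> < 1" unfolding eventually_sequentially by blast
    let ?q = "\<lambda>i x. f x * ((\<theta> (Suc n) (x $ m - (t + X i)) - \<theta> (Suc n) (x $ m - t)) / X i * R x)"
    have eq: "(J (Suc n) (t + X i) - J (Suc n) t) / X i = (\<integral>x. ?q i x \<partial>lebesgue)" for i
    proof -
      have "J (Suc n) (t + X i) - J (Suc n) t
        = (\<integral>x. f x * (\<theta> (Suc n) (x $ m - (t + X i)) * R x) - f x * (\<theta> (Suc n) (x $ m - t) * R x) \<partial>lebesgue)"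
        unfolding J_def by (rule Bochner_Integration.integral_diff[symmetric]) (intro int n)+
      then have "(J (Suc n) (t + X i) - J (Suc n) t) / X i
        = (\<integral>x. (f x * (\<theta> (Suc n) (x $ m - (t + X i)) * R x) - f x * (\<theta> (Suc n) (x $ m - t) * R x)) / X i \<partial>lebesgue)"
        by simp
      then show ?thesis by (simp add: algebra_simps diff_divide_distrib)
    qed
    have "(\<lambda>i. \<integral>x. ?q (i + N) x \<partial>lebesgue) \<longlonglongrightarrow> (\<integral>x. f x * (- \<theta> n (x $ m - t) * R x) \<partial>lebesgue)"
    proof (rule integral_dominated_convergence[where w = "\<lambda>x. B * (C * 4) * \<bar>wt (x $ m - t) * R x\<bar>"])
      show "AE x in lebesgue. (\<lambda>i. ?q (i + N) x) \<longlonglongrightarrow> f x * (- \<theta> n (x $ m - t) * R x)"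
      proof (intro always_eventually allI tendsto_mult tendsto_const)
        fix x :: "real^'d"
        have "((\<lambda>s. \<theta> (Suc n) (x $ m - s)) has_real_derivative \<theta> n (x $ m - t) * (0 - 1)) (at t)"
          by (rule DERIV_chain2[OF \<theta>(3)[OF assms]]) (intro derivative_intros)
        then have "(\<lambda>h. (\<theta> (Suc n) (x $ m - (t + h)) - \<theta> (Suc n) (x $ m - t)) / h) \<midarrow>0\<rightarrow> - \<theta> n (x $ m - t)"
          by (simp add: DERIV_def)
        then have "(\<lambda>i. (\<theta> (Suc n) (x $ m - (t + X i)) - \<theta> (Suc n) (x $ m - t)) / X i) \<longlonglongrightarrow> - \<theta> n (x $ m - t)"
          unfolding tendsto_at_iff_sequentially comp_def using X by blast
        then show "(\<lambda>i. (\<theta> (Suc n) (x $ m - (t + X (i + N))) - \<theta> (Suc n) (x $ m - t)) / X (i + N)) \<longlonglongrightarrow> - \<theta> n (x $ m - t)"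
          by (rule LIMSEQ_ignore_initial_segment)
      qed
      fix i
      show "AE x in lebesgue. norm (?q (i + N) x) \<le> B * (C * 4) * \<bar>wt (x $ m - t) * R x\<bar>"
      proof (intro always_eventually allI)
        fix x :: "real^'d"
        define h where "h = X (i + N)"
        define a where "a = x $ m - t"
        have h: "h \<noteq> 0" "\<bar>h\<bar> < 1" using X(1) N by (auto simp: h_def)
        have "\<exists>\<xi>. \<bar>\<xi> - a\<bar> \<le> \<bar>h\<bar> \<and> \<theta> (Suc n) (a - h) - \<theta> (Suc n) a = - h * \<theta> n \<xi>"
        proof (cases "h > 0")
          case True
          then obtain z where "a - h < z" "z < a" "\<theta> (Suc n) a - \<theta> (Suc n) (a - h) = (a - (a - h)) * \<theta> n z"
            using MVT2[of "a - h" a "\<theta> (Suc n)" "\<theta> n"] \<theta>(3)[OF assms] by auto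
          then show ?thesis by (intro exI[of _ z]) auto
        next
          case False
          then have "a < a - h" using h by simp
          then obtain z where "a < z" "z < a - h" "\<theta> (Suc n) (a - h) - \<theta> (Suc n) a = (a - h - a) * \<theta> n z"
            using MVT2[of a "a - h" "\<theta> (Suc n)" "\<theta> n"] \<theta>(3)[OF assms] by auto
          then show ?thesis using False by (intro exI[of _ z]) auto
        qed
        then obtain \<xi> where \<xi>: "\<bar>\<xi> - a\<bar> \<le> \<bar>h\<bar>" "\<theta> (Suc n) (a - h) - \<theta> (Suc n) a = - h * \<theta> n \<xi>" by blast
        have "(\<theta> (Suc n) (a - h) - \<theta> (Suc n) a) / h = - \<theta> n \<xi>" using \<xi>(2) h by simp
        then have "\<bar>(\<theta> (Suc n) (a - h) - \<theta> (Suc n) a) / h\<bar> = \<bar>\<theta> n \<xi>\<bar>" by simp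
        also have "\<dots> \<le> C * wt \<xi>" using C(2)[of \<xi>] by simp
        also have "\<dots> \<le> C * (wt a * (1 + \<bar>a - \<xi>\<bar>)\<^sup>2)"
          using wt_le_shift[of \<xi> "a - \<xi>"] C(1) by (intro mult_left_mono) auto
        also have "\<dots> \<le> C * (wt a * 2\<^sup>2)"
          using C(1) \<xi>(1) h by (intro mult_left_mono power_mono) auto
        finally have q: "\<bar>(\<theta> (Suc n) (a - h) - \<theta> (Suc n) a) / h\<bar> \<le> C * 4 * wt a" by simp
        have "norm (?q (i + N) x) = \<bar>f x\<bar> * (\<bar>(\<theta> (Suc n) (a - h) - \<theta> (Suc n) a) / h\<bar> * \<bar>R x\<bar>)"
          by (simp add: a_def h_def abs_mult abs_divide diff_diff_eq)
        also have "\<dots> \<le> B * ((C * 4 * wt a) * \<bar>R x\<bar>)"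
          by (intro mult_mono B mult_right_mono q \<open>0 \<le> B\<close>) auto
        finally show "norm (?q (i + N) x) \<le> B * (C * 4) * \<bar>wt (x $ m - t) * R x\<bar>"
          by (simp add: a_def abs_mult mult_ac)
      qed
    next
      have "?q (i + N) \<in> borel_measurable lebesgue" for i
      proof -
        have "?q (i + N) = (\<lambda>x. (f x * (\<theta> (Suc n) (x $ m - (t + X (i + N))) * R x)
            - f x * (\<theta> (Suc n) (x $ m - t) * R x)) / X (i + N))"
          by (simp add: fun_eq_iff algebra_simps diff_divide_distrib)
        then show ?thesis using meas_\<theta>[OF n(2)] by simp
      qed
      then show "\<And>i. ?q (i + N) \<in> borel_measurable lebesgue" .
      have "(\<lambda>x. - (f x * (\<theta> n (x $ m - t) * R x))) \<in> borel_measurable lebesgue"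
        using meas_\<theta>[OF n(1), of t] by simp
      then show "(\<lambda>x. f x * (- \<theta> n (x $ m - t) * R x)) \<in> borel_measurable lebesgue" by simp
    qed (intro integrable_mult_right integrable_abs wtR)
    then have "(\<lambda>i. (J (Suc n) (t + X (i + N)) - J (Suc n) t) / X (i + N)) \<longlonglongrightarrow> - J n t"
      unfolding eq by (simp only: J_def mult_minus_left mult_minus_right integral_minus)
    then show "(\<lambda>i. (J (Suc n) (t + X i) - J (Suc n) t) / X i) \<longlonglongrightarrow> - J n t"
      by (rule LIMSEQ_offset)
  qed
  then show ?thesis by (simp add: DERIV_def)
qed

text \<open>The \<open>M\<close>-th derivative of the auxiliary function \<open>G 0\<close> is a finite difference of \<open>J 0\<close> at the
  origin with variable step, while its own finite differences are those of \<open>J M\<close> plus the constant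
  \<open>J 0 0\<close>; the mean value theorem then isolates \<open>J 0 0\<close>.\<close>

lemma abs_J_le:
  assumes W: "\<And>\<tau> x. 0 \<le> \<tau> \<Longrightarrow> \<tau> \<le> 1 \<Longrightarrow> \<bar>fdiff (\<tau> *\<^sub>R e) M f x\<bar> \<le> W"
  shows "\<bar>J 0 0\<bar> \<le> ((\<integral>x. \<bar>\<theta> 0 (x $ m) * R x\<bar> \<partial>lebesgue)
     + (\<Sum>j=1..M. real (M choose j) * (real M / real j) ^ M) * (\<integral>x. \<bar>\<theta> M (x $ m) * R x\<bar> \<partial>lebesgue)) * W"
proof -
  \<comment> \<open>In the \<open>M\<close>-th derivative of \<open>G 0\<close> the chain rule
    produces powers of \<open>- (j / M)\<close>; the factors \<open>(M / j) ^ M * (-1) ^ M\<close>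
    undo them, so that binomial coefficients remain.\<close>
  define b where "b j = (-1) ^ (M - j) * real (M choose j) * (real M / real j) ^ M * (-1) ^ M" for j
  \<comment> \<open>A monomial of degree \<open>M\<close> whose \<open>M\<close>-th derivative is
    \<open>(-1) ^ M * J 0 0\<close>, the missing term \<open>j = 0\<close> of the binomial sum. Its
    \<open>M\<close>-th difference with step 1 is the same constant.\<close>
  define P where "P n s = (-1) ^ M * J 0 0 * (s ^ (M - n) / fact (M - n))" for n and s :: real
  define G where "G n s = P n s + (\<Sum>j=1..M. b j * ((- (real j / real M)) ^ n * J (M - n) (s * (real j / real M))))" for n s
  have dP: "(P n has_real_derivative P (Suc n) s) (at s)" if "n < M" for n s
  proof -
    define k where "k = M - Suc n"
    have k: "M - n = Suc k" "M - Suc n = k" using that by (auto simp: k_def)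
    have "((\<lambda>s. s ^ Suc k / fact (Suc k)) has_real_derivative s ^ k / fact k) (at s)"
      by (rule DERIV_cong[OF DERIV_cdivide[OF DERIV_pow]]) (simp del: of_nat_Suc)
    then show ?thesis unfolding P_def k by (rule DERIV_cmult)
  qed
  have dG: "(G n has_real_derivative G (Suc n) s) (at s)" if "n < M" for n s
  proof -
    define k where "k = M - Suc n"
    have k: "M - n = Suc k" "M - Suc n = k" "k < M" using that by (auto simp: k_def)
    have "((\<lambda>s. J (Suc k) (s * c)) has_real_derivative - J k (s * c) * c) (at s)" for c
    proof (rule DERIV_chain2[OF J_deriv[OF k(3)]])
      show "((\<lambda>s. s * c) has_real_derivative c) (at s)" by (auto intro!: derivative_eq_intros)
    qed
    then have "((\<lambda>s. b j * ((- c) ^ n * J (Suc k) (s * c))) has_real_derivative b j * ((- c) ^ Suc n * J k (s * c))) (at s)" for j c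
    proof (intro DERIV_cmult)
      fix c assume "\<And>c. ((\<lambda>s. J (Suc k) (s * c)) has_real_derivative - J k (s * c) * c) (at s)"
      from DERIV_cmult[OF this[of c], of "(- c) ^ n"]
      show "((\<lambda>s. (- c) ^ n * J (Suc k) (s * c)) has_real_derivative (- c) ^ Suc n * J k (s * c)) (at s)"
        by (simp add: mult_ac)
    qed
    then show ?thesis
      unfolding G_def[abs_def] k(1,2) by (intro DERIV_add dP that DERIV_sum)
  qed
  obtain \<xi> where \<xi>: "0 \<le> \<xi>" "\<xi> \<le> real M" "fdiff 1 M (G 0) 0 = G M \<xi>"
    using fdiff_mean_value[of M G 0, OF dG] by auto
  have GM: "G M \<xi> = fdiff (\<xi> / real M) M (J 0) 0"
  proof -
    have "b j * ((- (real j / real M)) ^ M * J 0 (\<xi> * (real j / real M)))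
        = (-1) ^ (M - j) * real (M choose j) * J 0 (real j * (\<xi> / real M))" if "j \<in> {1..M}" for j
    proof -
      have "(real M / real j) ^ M * ((-1) ^ M * (- (real j / real M)) ^ M) = (real M / real j * ((-1) * (- (real j / real M)))) ^ M"
        by (simp only: power_mult_distrib)
      also have "\<dots> = 1" using that M by simp
      finally have "(real M / real j) ^ M * ((-1) ^ M * (- (real j / real M)) ^ M) = 1" .
      then have "b j * (- (real j / real M)) ^ M = (-1) ^ (M - j) * real (M choose j)"
        unfolding b_def by (simp only: mult.assoc mult_1_right)
      then show ?thesis by (simp add: mult.assoc[symmetric] mult.commute)
    qed
    then have "G M \<xi> = (-1) ^ M * J 0 0 + (\<Sum>j=1..M. (-1) ^ (M - j) * real (M choose j) * J 0 (real j * (\<xi> / real M)))"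
      unfolding G_def P_def by simp
    also have "\<dots> = (\<Sum>j\<le>M. (-1) ^ (M - j) * real (M choose j) * J 0 (real j * (\<xi> / real M)))"
    proof -
      have "{..M} = insert 0 {1..M}" by auto
      then show ?thesis by simp
    qed
    finally show ?thesis by (simp add: fdiff_binomial)
  qed
  have fP: "fdiff 1 M (P 0) 0 = (-1) ^ M * J 0 0"
    using fdiff_mean_value[of M P 0, OF dP] by (auto simp: P_def)
  have "fdiff 1 M (G 0) 0 = fdiff 1 M (P 0) 0 + (\<Sum>j=1..M. b j * fdiff (real j / real M) M (J M) 0)"
  proof -
    have "fdiff 1 M (\<lambda>s. J M (s * c)) 0 = fdiff c M (J M) 0" for c
      by (simp add: fdiff_binomial)
    then show ?thesis unfolding G_def[abs_def] fdiff_add fdiff_sum fdiff_cmult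
      by (simp del: times_divide_eq_right)
  qed
  \<comment> \<open>All steps that remain, \<open>\<xi> / M\<close> and \<open>j / M\<close>, lie
    between 0 and 1, where \<open>W\<close> is a bound. This is the reason for scaling the arguments
    in \<open>G\<close> by \<open>j / M\<close>.\<close>
  then have main: "(-1) ^ M * J 0 0 = fdiff (\<xi> / real M) M (J 0) 0 - (\<Sum>j=1..M. b j * fdiff (real j / real M) M (J M) 0)"
    using \<xi>(3) GM fP by simp
  let ?I0 = "\<integral>x. \<bar>\<theta> 0 (x $ m) * R x\<bar> \<partial>lebesgue" and ?IM = "\<integral>x. \<bar>\<theta> M (x $ m) * R x\<bar> \<partial>lebesgue"
  have b: "\<bar>b j\<bar> = real (M choose j) * (real M / real j) ^ M" for j
    unfolding b_def by (simp add: abs_mult power_abs abs_divide)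
  have "\<bar>J 0 0\<bar> = \<bar>(-1) ^ M * J 0 0\<bar>" by (simp add: abs_mult power_abs)
  also have "\<dots> \<le> \<bar>fdiff (\<xi> / real M) M (J 0) 0\<bar> + (\<Sum>j=1..M. \<bar>b j * fdiff (real j / real M) M (J M) 0\<bar>)"
    unfolding main by (rule order_trans[OF abs_triangle_ineq4 add_left_mono[OF sum_abs]])
  also have "\<dots> \<le> W * ?I0 + (\<Sum>j=1..M. \<bar>b j\<bar> * (W * ?IM))"
  proof (intro add_mono sum_mono)
    show "\<bar>fdiff (\<xi> / real M) M (J 0) 0\<bar> \<le> W * ?I0"
      by (rule J_fdiff_bound) (use \<xi> M in \<open>auto intro!: W\<close>)
    show "\<bar>b j * fdiff (real j / real M) M (J M) 0\<bar> \<le> \<bar>b j\<bar> * (W * ?IM)" if "j \<in> {1..M}" for j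
      unfolding abs_mult[of "b j"] by (intro mult_left_mono J_fdiff_bound W) (use that M in auto)
  qed
  also have "\<dots> = (?I0 + (\<Sum>j=1..M. \<bar>b j\<bar>) * ?IM) * W"
    by (simp only: distrib_right sum_distrib_right mult.assoc mult.commute[of W])
  finally show ?thesis unfolding b .
qed

end

text \<open>The order of quantifiers matters: \<open>C\<close> is chosen before \<open>f\<close>, so
  one constant serves all rescaled and translated copies of a function, that is, the coefficients at
  all levels and positions.\<close>

lemma ridge_integral_le:
  "\<exists>C>0. \<forall>f W. f \<in> borel_measurable lebesgue \<and> bounded (range f) \<and>
      (\<forall>\<tau> x. 0 \<le> \<tau> \<longrightarrow> \<tau> \<le> 1 \<longrightarrow> \<bar>fdiff (\<tau> *\<^sub>R e) M f x\<bar> \<le> W) \<longrightarrow>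
      \<bar>\<integral>x. f x * (\<theta> 0 (x $ m) * R x) \<partial>lebesgue\<bar> \<le> C * W"
proof -
  let ?C = "(\<integral>x. \<bar>\<theta> 0 (x $ m) * R x\<bar> \<partial>lebesgue)
     + (\<Sum>j=1..M. real (M choose j) * (real M / real j) ^ M) * (\<integral>x. \<bar>\<theta> M (x $ m) * R x\<bar> \<partial>lebesgue)"
  have C: "0 \<le> ?C" by (intro add_nonneg_nonneg mult_nonneg_nonneg sum_nonneg integral_nonneg_AE) auto
  show ?thesis
  proof (intro exI[of _ "?C + 1"] conjI allI impI)
    fix f :: "real^'d \<Rightarrow> real" and W
    assume f: "f \<in> borel_measurable lebesgue \<and> bounded (range f) \<and>
      (\<forall>\<tau> x. 0 \<le> \<tau> \<longrightarrow> \<tau> \<le> 1 \<longrightarrow> \<bar>fdiff (\<tau> *\<^sub>R e) M f x\<bar> \<le> W)"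
    then obtain B where B: "\<And>x. \<bar>f x\<bar> \<le> B" by (auto simp: bounded_iff)
    have "\<bar>J f 0 0\<bar> \<le> ?C * W" by (rule abs_J_le[where B = B]) (use f B in auto)
    moreover have "0 \<le> W" using f order_trans[OF abs_ge_zero, of "fdiff (0 *\<^sub>R e) M f 0" W] by auto
    moreover have "J f 0 0 = (\<integral>x. f x * (\<theta> 0 (x $ m) * R x) \<partial>lebesgue)"
      using J_def[of f B 0 0] f B by simp
    ultimately show "\<bar>\<integral>x. f x * (\<theta> 0 (x $ m) * R x) \<partial>lebesgue\<bar> \<le> (?C + 1) * W"
      by (simp add: distrib_right)
  qed (use C in linarith)
qed

end

section \<open>The wavelet decomposition\<close>

lemma integrable_wt_prod: "integrable lebesgue (\<lambda>Y::real^'d. \<Prod>m\<in>UNIV. C * wt (Y $ m - X $ m))"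
  and integral_wt_prod: "(\<integral>Y. (\<Prod>m\<in>UNIV. C * wt ((Y::real^'d) $ m - X $ m)) \<partial>lebesgue) = (C * wt_int) ^ CARD('d)"
proof -
  have "continuous_on UNIV (\<lambda>y. C * wt (y - a))" for a by (intro continuous_intros)
  note g = borel_measurable_continuous_onI[OF this]
  show "integrable lebesgue (\<lambda>Y::real^'d. \<Prod>m\<in>UNIV. C * wt (Y $ m - X $ m))"
    by (intro integrable_prod_vec[of "\<lambda>m y. C * wt (y - X $ m)"] integrable_mult_right integrable_wt g)
  show "(\<integral>Y. (\<Prod>m\<in>UNIV. C * wt ((Y::real^'d) $ m - X $ m)) \<partial>lebesgue) = (C * wt_int) ^ CARD('d)"
    by (subst integral_prod_vec[of "\<lambda>m y. C * wt (y - X $ m)"])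
       (auto intro!: integrable_mult_right integrable_wt g simp: integral_wt)
qed

text \<open>Lattice points, like the indices of the wavelets below, are functions on the coordinates
  rather than vectors, so that a product of sums expands by \<open>prod_sum_PiE\<close>.\<close>

definition ibox :: "nat \<Rightarrow> ('d::finite \<Rightarrow> int) set" where
  "ibox N = PiE UNIV (\<lambda>_. {- int N..int N})"

lemma sum_ibox_prod:
  fixes F :: "'d::finite \<Rightarrow> int \<Rightarrow> real"
  shows "(\<Prod>m\<in>UNIV. \<Sum>k\<in>{- int N..int N}. F m k) = (\<Sum>k\<in>ibox N. \<Prod>m\<in>UNIV. F m (k m))"
  unfolding ibox_def by (rule prod_sum_PiE) auto

definition kv :: "('d \<Rightarrow> int) \<Rightarrow> real^'d" where
  "kv k = (\<chi> m. of_int (k m))"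

lemma kv_nth [simp]: "kv k $ m = of_int (k m)"
  by (simp add: kv_def)

lemma sum_ibox_wt_le:
  "(\<Sum>k\<in>ibox N. \<Prod>m\<in>UNIV. wt ((X - kv k) $ m)) \<le> (4 * wt_int) ^ CARD('d)" for X :: "real^'d"
proof -
  have "(\<Sum>k\<in>ibox N. \<Prod>m\<in>UNIV. wt ((X - kv k) $ m)) = (\<Prod>m\<in>UNIV. \<Sum>k\<in>{- int N..int N}. wt (X $ m - of_int k))"
    by (subst sum_ibox_prod) simp
  also have "\<dots> \<le> (\<Prod>m\<in>(UNIV :: 'd set). 4 * wt_int)"
    by (intro prod_mono conjI sum_nonneg sum_wt_le) auto
  finally show ?thesis by simp
qed

text \<open>Rescaling turns level \<open>l\<close> into unit scale; all kernels and projections are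
  then needed at one scale only.\<close>

definition dil :: "nat \<Rightarrow> (real^'d \<Rightarrow> real) \<Rightarrow> real^'d \<Rightarrow> real" where
  "dil l f Y = f ((1 / 2 ^ l) *\<^sub>R Y)"

lemma dil_measurable:
  fixes f :: "real^'d \<Rightarrow> real"
  shows "f \<in> borel_measurable lebesgue \<Longrightarrow> dil l f \<in> borel_measurable lebesgue"
  using borel_measurable_affine[of "1 / 2 ^ l" f 0] by (simp add: dil_def[abs_def])

lemma dil_Suc: "dil (Suc l) f (2 *\<^sub>R Y) = dil l f Y"
  by (simp add: dil_def)

lemma dil_scale: "dil l f (2 ^ l *\<^sub>R x) = f x"
  by (simp add: dil_def)

context mra
begin

definition fac :: "bool \<Rightarrow> real \<Rightarrow> real" where "fac b = (if b then \<psi> else \<phi>)"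
definition nr :: "bool \<Rightarrow> real" where "nr b = (if b then Q.nrm else P.nrm)"
definition kern :: "bool \<Rightarrow> real \<Rightarrow> real \<Rightarrow> real" where "kern b = (if b then Q.ker else P.ker)"

lemma fac_smooth: "smooth_rapid M (fac b)" and fac_cont: "continuous_on UNIV (fac b)" and fac_rapid: "rapid (fac b)"
  using smooth P.cont Q.cont P.rapid Q.rapid by (auto simp: fac_def)

lemma nr_pos: "nr b > 0"
  using P.nrm_pos Q.nrm_pos by (simp add: nr_def)

definition kern_sum :: "nat \<Rightarrow> bool \<Rightarrow> real \<Rightarrow> real \<Rightarrow> real" where
  "kern_sum N b x y = (\<Sum>k\<in>{- int N..int N}. fac b (x - of_int k) / nr b * fac b (y - of_int k))"

lemma kern_tendsto: "(\<lambda>N. kern_sum N b x y) \<longlonglongrightarrow> kern b x y"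
  using P.ker_tendsto Q.ker_tendsto by (simp add: kern_sum_def fac_def nr_def kern_def)

lemma kern_continuous: "continuous_on UNIV (kern b x)"
  using P.ker_continuous Q.ker_continuous by (simp add: kern_def)

lemma kern_sum_continuous: "continuous_on UNIV (kern_sum N b x)"
  unfolding kern_sum_def[abs_def]
  by (intro continuous_on_sum continuous_on_mult continuous_on_const continuous_on_compose2[OF fac_cont])
     (auto intro!: continuous_intros)

lemma kern_bound:
  obtains C where "C > 0" "\<And>b x y. \<bar>kern b x y\<bar> \<le> C * wt (x - y) ^ 2"
    "\<And>N b x y. \<bar>kern_sum N b x y\<bar> \<le> C * wt (x - y) ^ 2"
proof -
  obtain C1 where C1: "C1 > 0" "\<And>x y. \<bar>P.ker x y\<bar> \<le> C1 * wt (x - y) ^ 2"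
    "\<And>x y A. finite A \<Longrightarrow> \<bar>\<Sum>k\<in>A. \<phi> (x - of_int k) / P.nrm * \<phi> (y - of_int k)\<bar> \<le> C1 * wt (x - y) ^ 2"
    by (rule P.ker_bound) (rule that; assumption)
  obtain C2 where C2: "C2 > 0" "\<And>x y. \<bar>Q.ker x y\<bar> \<le> C2 * wt (x - y) ^ 2"
    "\<And>x y A. finite A \<Longrightarrow> \<bar>\<Sum>k\<in>A. \<psi> (x - of_int k) / Q.nrm * \<psi> (y - of_int k)\<bar> \<le> C2 * wt (x - y) ^ 2"
    by (rule Q.ker_bound) (rule that; assumption)
  define C where "C = max C1 C2"
  have le: "C1 * wt z ^ 2 \<le> C * wt z ^ 2" "C2 * wt z ^ 2 \<le> C * wt z ^ 2" for z
    by (auto simp: C_def intro!: mult_right_mono)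
  show ?thesis
  proof (rule that[of C])
    show "C > 0" using C1(1) by (simp add: C_def)
    show "\<bar>kern b x y\<bar> \<le> C * wt (x - y) ^ 2" for b x y
      using order_trans[OF C1(2) le(1)] order_trans[OF C2(2) le(2)] by (simp add: kern_def)
    show "\<bar>kern_sum N b x y\<bar> \<le> C * wt (x - y) ^ 2" for N b x y
      unfolding kern_sum_def fac_def nr_def
      using order_trans[OF C1(3) le(1), of "{- int N..int N}"] order_trans[OF C2(3) le(2), of "{- int N..int N}"]
      by (cases b) auto
  qed
qed

definition psi :: "('d::finite \<Rightarrow> bool) \<Rightarrow> real^'d \<Rightarrow> real" where
  "psi i X = (\<Prod>m\<in>UNIV. fac (i m) (X $ m))"

lemma tensor_eq_psi: "tensor \<phi> \<psi> (\<chi> m. i m) = psi i"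
  by (rule ext) (simp add: tensor_def psi_def fac_def)

lemma psi_continuous: "continuous_on UNIV (\<lambda>X. psi i (X - a))"
  unfolding psi_def
  by (intro continuous_on_prod continuous_on_compose2[OF fac_cont]) (auto intro!: continuous_intros)

definition ipr :: "('d::finite \<Rightarrow> bool) \<Rightarrow> (real^'d \<Rightarrow> real) \<Rightarrow> ('d \<Rightarrow> int) \<Rightarrow> real" where
  "ipr i g k = (\<integral>Y. g Y * psi i (Y - kv k) \<partial>lebesgue)"

lemma psi_bound:
  obtains C where "C > 0" "\<And>i (X::real^'d::finite). \<bar>psi i X\<bar> \<le> (\<Prod>m\<in>UNIV. C * wt (X $ m))"
proof -
  obtain C1 C2 where C: "C1 > 0" "\<And>x. \<bar>\<phi> x\<bar> \<le> C1 * wt x" "C2 > 0" "\<And>x. \<bar>\<psi> x\<bar> \<le> C2 * wt x"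
    using rapidD[OF P.rapid, of 1] rapidD[OF Q.rapid, of 1] by (metis power_one_right)
  have le: "\<bar>fac b x\<bar> \<le> max C1 C2 * wt x" for b x
    using order_trans[OF C(2)[of x], of "max C1 C2 * wt x"] order_trans[OF C(4)[of x], of "max C1 C2 * wt x"]
    by (auto simp: fac_def intro!: mult_right_mono)
  show ?thesis
  proof (rule that[of "max C1 C2"])
    show "\<bar>psi i X\<bar> \<le> (\<Prod>m\<in>UNIV. max C1 C2 * wt (X $ m))" for i and X :: "real^'d"
      unfolding psi_def abs_prod by (intro prod_mono conjI le) auto
  qed (use C in simp)
qed

lemma psi_integrable: "integrable lebesgue (\<lambda>Y::real^'d. psi i (Y - a))"
proof -
  obtain C where C: "C > 0" "\<And>i (X::real^'d). \<bar>psi i X\<bar> \<le> (\<Prod>m\<in>UNIV. C * wt (X $ m))"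
    by (rule psi_bound[where 'd = 'd]) (rule that; assumption)
  show ?thesis
  proof (rule Bochner_Integration.integrable_bound[OF integrable_wt_prod[of C a]])
    show "AE Y in lebesgue. norm (psi i (Y - a)) \<le> norm (\<Prod>m\<in>UNIV. C * wt (Y $ m - a $ m))"
    proof (intro always_eventually allI)
      fix Y :: "real^'d"
      have "norm (psi i (Y - a)) \<le> (\<Prod>m\<in>UNIV. C * wt (Y $ m - a $ m))"
        using C(2)[of i "Y - a"] by simp
      then show "norm (psi i (Y - a)) \<le> norm (\<Prod>m\<in>UNIV. C * wt (Y $ m - a $ m))"
        unfolding real_norm_def by (rule order_trans[OF _ abs_ge_self])
    qed
  qed (rule continuous_imp_lebesgue_measurable[OF psi_continuous])
qed

lemma wavelet_coeff_eq:
  fixes f :: "real^'d \<Rightarrow> real"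
  assumes "f \<in> borel_measurable lebesgue"
  shows "wavelet_coeff \<phi> \<psi> f (\<chi> m. i m) l (\<chi> m. k m) = ipr i (dil l f) k"
proof -
  have "(\<lambda>Y. dil l f Y * psi i (Y - kv k)) \<in> borel_measurable lebesgue"
    by (intro borel_measurable_times dil_measurable assms continuous_imp_lebesgue_measurable psi_continuous)
  from integral_affine[OF _ this, of "2 ^ l" 0]
  show ?thesis
    by (simp add: wavelet_coeff_def tensor_eq_psi ipr_def dil_scale kv_def power_mult mult.commute)
qed

text \<open>The projection onto the closed span of the integer translates of \<open>psi i\<close>,
  extended to bounded functions by means of its kernel. The constant index \<open>False\<close>
  gives the coarse projection.\<close>

definition T :: "('d::finite \<Rightarrow> bool) \<Rightarrow> (real^'d \<Rightarrow> real) \<Rightarrow> real^'d \<Rightarrow> real" where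
  "T i g X = (\<integral>Y. g Y * (\<Prod>m\<in>UNIV. kern (i m) (X $ m) (Y $ m)) \<partial>lebesgue)"

lemma prod_kern_measurable:
  "(\<lambda>Y::real^'d. \<Prod>m\<in>UNIV. kern (i m) (X $ m) (Y $ m)) \<in> borel_measurable lebesgue"
  "(\<lambda>Y::real^'d. \<Prod>m\<in>UNIV. kern_sum N (i m) (X $ m) (Y $ m)) \<in> borel_measurable lebesgue"
  by (intro continuous_imp_lebesgue_measurable continuous_on_prod
      continuous_on_compose2[OF kern_continuous] continuous_on_compose2[OF kern_sum_continuous];
      auto intro!: continuous_intros)+

lemma prod_kern_bound:
  obtains C where "C > 0"
    "\<And>i (X::real^'d::finite) Y. \<bar>\<Prod>m\<in>UNIV. kern (i m) (X $ m) (Y $ m)\<bar> \<le> (\<Prod>m\<in>UNIV. C * wt (Y $ m - X $ m) ^ 2)"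
    "\<And>N i (X::real^'d) Y. \<bar>\<Prod>m\<in>UNIV. kern_sum N (i m) (X $ m) (Y $ m)\<bar> \<le> (\<Prod>m\<in>UNIV. C * wt (Y $ m - X $ m) ^ 2)"
proof -
  obtain C where C: "C > 0" "\<And>b x y. \<bar>kern b x y\<bar> \<le> C * wt (x - y) ^ 2"
    "\<And>N b x y. \<bar>kern_sum N b x y\<bar> \<le> C * wt (x - y) ^ 2"
    by (rule kern_bound) (rule that; assumption)
  show ?thesis
  proof (rule that[OF C(1)])
    show "\<bar>\<Prod>m\<in>UNIV. kern (i m) (X $ m) (Y $ m)\<bar> \<le> (\<Prod>m\<in>UNIV. C * wt (Y $ m - X $ m) ^ 2)"
      for i and X Y :: "real^'d"
      unfolding abs_prod using C(2) by (intro prod_mono conjI) (auto simp: wt_minus_commute[of "Y $ _"])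
    show "\<bar>\<Prod>m\<in>UNIV. kern_sum N (i m) (X $ m) (Y $ m)\<bar> \<le> (\<Prod>m\<in>UNIV. C * wt (Y $ m - X $ m) ^ 2)"
      for N i and X Y :: "real^'d"
      unfolding abs_prod using C(3) by (intro prod_mono conjI) (auto simp: wt_minus_commute[of "Y $ _"])
  qed
qed

lemma wt_prod_sq_le: "C > 0 \<Longrightarrow> (\<Prod>m\<in>UNIV. C * wt (z m) ^ 2) \<le> (\<Prod>m\<in>(UNIV::'d::finite set). C * wt (z m))"
  by (intro prod_mono conjI mult_left_mono) (auto simp: power2_eq_square wt_le_1 mult_left_le)

lemma T_integrable:
  fixes g :: "real^'d \<Rightarrow> real"
  assumes g: "g \<in> borel_measurable lebesgue" "\<And>x. \<bar>g x\<bar> \<le> B"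
  shows "integrable lebesgue (\<lambda>Y. g Y * (\<Prod>m\<in>UNIV. kern (i m) (X $ m) (Y $ m)))"
proof -
  obtain C where C: "C > 0"
    "\<And>i (X::real^'d) Y. \<bar>\<Prod>m\<in>UNIV. kern (i m) (X $ m) (Y $ m)\<bar> \<le> (\<Prod>m\<in>UNIV. C * wt (Y $ m - X $ m) ^ 2)"
    "\<And>N i (X::real^'d) Y. \<bar>\<Prod>m\<in>UNIV. kern_sum N (i m) (X $ m) (Y $ m)\<bar> \<le> (\<Prod>m\<in>UNIV. C * wt (Y $ m - X $ m) ^ 2)"
    by (rule prod_kern_bound[where 'd = 'd]) (rule that; assumption)
  have "integrable lebesgue (\<lambda>Y. \<Prod>m\<in>UNIV. kern (i m) (X $ m) (Y $ m))"
  proof (rule Bochner_Integration.integrable_bound[OF integrable_wt_prod[of C X] prod_kern_measurable(1)])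
    show "AE Y in lebesgue. norm (\<Prod>m\<in>UNIV. kern (i m) (X $ m) (Y $ m)) \<le> norm (\<Prod>m\<in>UNIV. C * wt (Y $ m - X $ m))"
      unfolding real_norm_def
      by (intro always_eventually allI order_trans[OF order_trans[OF C(2) wt_prod_sq_le[OF C(1)]] abs_ge_self])
  qed
  then show ?thesis by (rule integrable_bounded_mult[OF g])
qed

text \<open>Convergence along boxes suffices, because the later estimates hold for the sum over
  every box with the same constant.\<close>

lemma T_tendsto:
  fixes g :: "real^'d \<Rightarrow> real"
  assumes g: "g \<in> borel_measurable lebesgue" "\<And>x. \<bar>g x\<bar> \<le> B"
  shows "(\<lambda>N. \<Sum>k\<in>ibox N. ipr i g k / (\<Prod>m\<in>UNIV. nr (i m)) * psi i (X - kv k)) \<longlonglongrightarrow> T i g X"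
proof -
  obtain C where C: "C > 0"
    "\<And>i (X::real^'d) Y. \<bar>\<Prod>m\<in>UNIV. kern (i m) (X $ m) (Y $ m)\<bar> \<le> (\<Prod>m\<in>UNIV. C * wt (Y $ m - X $ m) ^ 2)"
    "\<And>N i (X::real^'d) Y. \<bar>\<Prod>m\<in>UNIV. kern_sum N (i m) (X $ m) (Y $ m)\<bar> \<le> (\<Prod>m\<in>UNIV. C * wt (Y $ m - X $ m) ^ 2)"
    by (rule prod_kern_bound[where 'd = 'd]) (rule that; assumption)
  have B: "0 \<le> B" using order_trans[OF abs_ge_zero g(2)] .
  let ?n = "\<Prod>m\<in>UNIV. nr (i m)"
  have "(\<lambda>N. \<integral>Y. g Y * (\<Prod>m\<in>UNIV. kern_sum N (i m) (X $ m) (Y $ m)) \<partial>lebesgue) \<longlonglongrightarrow> T i g X"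
    unfolding T_def
  proof (rule integral_dominated_convergence[where w = "\<lambda>Y. B * (\<Prod>m\<in>UNIV. C * wt (Y $ m - X $ m))"])
    show "AE Y in lebesgue. norm (g Y * (\<Prod>m\<in>UNIV. kern_sum N (i m) (X $ m) (Y $ m)))
        \<le> B * (\<Prod>m\<in>UNIV. C * wt (Y $ m - X $ m))" for N
      unfolding real_norm_def abs_mult
      by (intro always_eventually allI mult_mono g(2) B order_trans[OF C(3) wt_prod_sq_le[OF C(1)]]) auto
    show "AE Y in lebesgue. (\<lambda>N. g Y * (\<Prod>m\<in>UNIV. kern_sum N (i m) (X $ m) (Y $ m)))
        \<longlonglongrightarrow> g Y * (\<Prod>m\<in>UNIV. kern (i m) (X $ m) (Y $ m))"
      by (intro always_eventually allI tendsto_mult tendsto_const tendsto_prod kern_tendsto)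
  qed (intro borel_measurable_times g prod_kern_measurable integrable_mult_right integrable_wt_prod)+
  moreover have "(\<integral>Y. g Y * (\<Prod>m\<in>UNIV. kern_sum N (i m) (X $ m) (Y $ m)) \<partial>lebesgue)
      = (\<Sum>k\<in>ibox N. ipr i g k / ?n * psi i (X - kv k))" for N
  proof -
    have "(\<Prod>m\<in>UNIV. kern_sum N (i m) (X $ m) (Y $ m)) = (\<Sum>k\<in>ibox N. psi i (X - kv k) / ?n * psi i (Y - kv k))"
      for Y :: "real^'d"
      unfolding kern_sum_def sum_ibox_prod psi_def by (simp add: prod.distrib prod_dividef)
    then have "(\<integral>Y. g Y * (\<Prod>m\<in>UNIV. kern_sum N (i m) (X $ m) (Y $ m)) \<partial>lebesgue)
      = (\<integral>Y. (\<Sum>k\<in>ibox N. psi i (X - kv k) / ?n * (g Y * psi i (Y - kv k))) \<partial>lebesgue)"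
      by (simp only: sum_distrib_left mult.left_commute[of "g _"])
    also have "\<dots> = (\<Sum>k\<in>ibox N. psi i (X - kv k) / ?n * ipr i g k)"
      unfolding ipr_def
      by (subst Bochner_Integration.integral_sum)
         (intro integrable_mult_right integrable_bounded_mult[OF g] psi_integrable, simp only: integral_mult_right_zero)
    finally show ?thesis by (simp add: mult.commute)
  qed
  ultimately show ?thesis by simp
qed

text \<open>Along the line in direction \<open>H\<close> every factor is a function of one variable
  whose \<open>j\<close>-th difference is at most a constant times \<open>norm H ^ j\<close> by the
  mean value theorem; \<open>abs_fdiff_prod_le\<close> combines the factors. For
  \<open>norm H \<le> 1\<close> all points involved stay within distance \<open>M\<close> of
  \<open>X\<close> in each coordinate, so the decay at \<open>X\<close> survives.\<close>

lemma fdiff_psi_small: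
  obtains C where "C > 0" "\<And>i H (X::real^'d::finite). norm H \<le> 1 \<Longrightarrow>
    \<bar>fdiff H M (psi i) X\<bar> \<le> C * norm H ^ M * (\<Prod>m\<in>UNIV. wt (X $ m))"
proof -
  have "\<exists>C. \<forall>n\<le>M. \<forall>b x. \<bar>(deriv ^^ n) (fac b) x\<bar> \<le> C * wt x"
  proof -
    have "\<exists>C. \<forall>x. \<bar>(deriv ^^ n) (fac b) x\<bar> \<le> C * wt x" if "n \<le> M" for n b
      using smooth_rapidD(1)[OF fac_smooth that] unfolding rapid_def by (metis power_one_right)
    then obtain c where c: "\<And>n b x. n \<le> M \<Longrightarrow> \<bar>(deriv ^^ n) (fac b) x\<bar> \<le> c n b * wt x" by metis
    have "\<bar>(deriv ^^ n) (fac b) x\<bar> \<le> (\<Sum>n\<le>M. \<Sum>b\<in>UNIV. \<bar>c n b\<bar>) * wt x" if "n \<le> M" for n b x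
    proof -
      have "c n b \<le> (\<Sum>b\<in>UNIV. \<bar>c n b\<bar>)"
        by (rule order_trans[OF abs_ge_self]) (rule member_le_sum, auto)
      also have "\<dots> \<le> (\<Sum>n\<le>M. \<Sum>b\<in>UNIV. \<bar>c n b\<bar>)"
        using that by (intro member_le_sum[of n "{..M}" "\<lambda>n. \<Sum>b\<in>UNIV. \<bar>c n b\<bar>"]) (auto intro!: sum_nonneg)
      finally show ?thesis using c[OF that, of b x] by (meson mult_right_mono order_trans wt_nonneg)
    qed
    then show ?thesis by blast
  qed
  then obtain C0 where C0: "\<And>n b x. n \<le> M \<Longrightarrow> \<bar>(deriv ^^ n) (fac b) x\<bar> \<le> C0 * wt x" by blast
  \<comment> \<open>The factor \<open>(1 + M) ^ 2\<close> is the price for moving the weight back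
    from an intermediate point at distance at most \<open>M\<close>.\<close>
  define C where "C = \<bar>C0\<bar> * (1 + real M)\<^sup>2"
  have C: "0 \<le> C" by (simp add: C_def)
  define C' where "C' = 2 ^ (M * CARD('d)) * C ^ CARD('d) + 1"
  show ?thesis
  proof (rule that[of C'])
    show "C' > 0" using C by (simp add: C'_def add_nonneg_pos)
    fix i and H X :: "real^'d"
    assume H: "norm H \<le> 1"
    define u where "u m t = fac (i m) (X $ m + t * H $ m)" for m and t :: real
    have Hm: "\<bar>H $ m\<bar> \<le> norm H" for m by (rule component_le_norm_cart)
    have ub: "\<bar>fdiff 1 j (u m) (real n)\<bar> \<le> (C * wt (X $ m)) * norm H ^ j" if jn: "j + n \<le> M" for m j n
    proof -
      define D where "D p t = (H $ m) ^ p * (deriv ^^ p) (fac (i m)) (X $ m + t * H $ m)" for p and t :: real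
      have dD: "(D p has_real_derivative D (Suc p) t) (at t)" if "p < j" for p t
      proof -
        have "p < M" using that jn by simp
        have "((\<lambda>t. (deriv ^^ p) (fac (i m)) (X $ m + t * H $ m)) has_real_derivative
            (deriv ^^ Suc p) (fac (i m)) (X $ m + t * H $ m) * H $ m) (at t)"
        proof (rule DERIV_chain2[OF smooth_rapidD(3)[OF fac_smooth \<open>p < M\<close>]])
          show "((\<lambda>t. X $ m + t * H $ m) has_real_derivative H $ m) (at t)" by (auto intro!: derivative_eq_intros)
        qed
        from DERIV_cmult[OF this, of "(H $ m) ^ p"] show ?thesis
          unfolding D_def by (simp add: mult_ac del: funpow.simps)
      qed
      have "D 0 = u m" by (simp add: D_def u_def fun_eq_iff)
      then obtain \<xi> where \<xi>: "real n \<le> \<xi>" "\<xi> \<le> real n + real j" "fdiff 1 j (u m) (real n) = D j \<xi>"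
        using fdiff_mean_value[of j D "real n", OF dD] by auto
      have "j \<le> M" using jn by simp
      have \<xi>M: "\<bar>\<xi> * H $ m\<bar> \<le> real M"
      proof -
        have "\<bar>\<xi> * H $ m\<bar> \<le> real M * 1"
          unfolding abs_mult using \<xi>(1,2) jn Hm[of m] H by (intro mult_mono) auto
        then show ?thesis by simp
      qed
      have "\<bar>(deriv ^^ j) (fac (i m)) (X $ m + \<xi> * H $ m)\<bar> \<le> \<bar>C0\<bar> * wt (X $ m + \<xi> * H $ m)"
        by (rule order_trans[OF C0[OF \<open>j \<le> M\<close>]]) (simp add: mult_right_mono)
      also have "\<dots> \<le> \<bar>C0\<bar> * (wt (X $ m) * (1 + \<bar>\<xi> * H $ m\<bar>)\<^sup>2)"
        using wt_le_shift[of "X $ m + \<xi> * H $ m" "- (\<xi> * H $ m)"] by (intro mult_left_mono) auto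
      also have "\<dots> \<le> \<bar>C0\<bar> * (wt (X $ m) * (1 + real M)\<^sup>2)"
        using \<xi>M by (intro mult_left_mono power_mono add_left_mono) auto
      also have "\<dots> = C * wt (X $ m)" by (simp add: C_def)
      finally have d: "\<bar>(deriv ^^ j) (fac (i m)) (X $ m + \<xi> * H $ m)\<bar> \<le> C * wt (X $ m)" .
      have "\<bar>fdiff 1 j (u m) (real n)\<bar> = \<bar>H $ m\<bar> ^ j * \<bar>(deriv ^^ j) (fac (i m)) (X $ m + \<xi> * H $ m)\<bar>"
        by (simp add: \<xi>(3) D_def abs_mult power_abs)
      also have "\<dots> \<le> norm H ^ j * (C * wt (X $ m))"
        by (intro mult_mono power_mono Hm d) auto
      finally show ?thesis by (simp add: mult.commute)
    qed
    have "fdiff H M (psi i) X = fdiff 1 M (\<lambda>t. psi i (X + t *\<^sub>R H)) 0"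
      by (subst fdiff_line) simp
    also have "(\<lambda>t. psi i (X + t *\<^sub>R H)) = (\<lambda>t. \<Prod>m\<in>UNIV. u m t)"
      by (simp add: psi_def u_def)
    finally have "\<bar>fdiff H M (psi i) X\<bar> \<le> 2 ^ (M * card (UNIV :: 'd set)) * (\<Prod>m\<in>UNIV. C * wt (X $ m)) * norm H ^ M"
      using abs_fdiff_prod_le[of "UNIV :: 'd set" "norm H" M u "\<lambda>m. C * wt (X $ m)" M 0] ub by simp
    also have "\<dots> = (2 ^ (M * CARD('d)) * C ^ CARD('d)) * (norm H ^ M * (\<Prod>m\<in>UNIV. wt (X $ m)))"
      by (simp add: prod.distrib)
    also have "\<dots> \<le> C' * (norm H ^ M * (\<Prod>m\<in>UNIV. wt (X $ m)))"
      unfolding C'_def by (intro mult_right_mono mult_nonneg_nonneg prod_nonneg) auto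
    finally show "\<bar>fdiff H M (psi i) X\<bar> \<le> C' * norm H ^ M * (\<Prod>m\<in>UNIV. wt (X $ m))" by simp
  qed
qed

text \<open>For \<open>norm H > 1\<close> the points of the difference lie far apart and decay
  around \<open>X\<close> is lost. The difference is then expanded into its values, and the sum over
  the box is taken for each of them separately.\<close>

lemma sum_ibox_fdiff_psi:
  obtains C where "C > 0" "\<And>N i H (X::real^'d::finite).
    (\<Sum>k\<in>ibox N. \<bar>fdiff H M (psi i) (X - kv k)\<bar>) \<le> C * min 1 (norm H ^ M)"
proof -
  obtain C1 where C1: "C1 > 0" "\<And>i H (X::real^'d). norm H \<le> 1 \<Longrightarrow>
    \<bar>fdiff H M (psi i) X\<bar> \<le> C1 * norm H ^ M * (\<Prod>m\<in>UNIV. wt (X $ m))"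
    by (rule fdiff_psi_small[where 'd = 'd]) (rule that; assumption)
  obtain C2 where C2: "C2 > 0" "\<And>i (X::real^'d). \<bar>psi i X\<bar> \<le> (\<Prod>m\<in>UNIV. C2 * wt (X $ m))"
    by (rule psi_bound[where 'd = 'd]) (rule that; assumption)
  define W where "W = (4 * wt_int) ^ CARD('d)"
  have W: "0 \<le> W" unfolding W_def using wt_int_nonneg by simp
  define C where "C = C1 * W + 2 ^ M * (C2 ^ CARD('d) * W) + 1"
  have p: "0 \<le> C1 * W" "0 \<le> 2 ^ M * (C2 ^ CARD('d) * W)"
    using C1(1) C2(1) W by auto
  show ?thesis
  proof (rule that[of C])
    show "C > 0" using p by (simp add: C_def)
    fix N i H and X :: "real^'d"
    show "(\<Sum>k\<in>ibox N. \<bar>fdiff H M (psi i) (X - kv k)\<bar>) \<le> C * min 1 (norm H ^ M)"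
    proof (cases "norm H \<le> 1")
      case True
      have "(\<Sum>k\<in>ibox N. \<bar>fdiff H M (psi i) (X - kv k)\<bar>)
          \<le> C1 * norm H ^ M * (\<Sum>k\<in>ibox N. \<Prod>m\<in>UNIV. wt ((X - kv k) $ m))"
        unfolding sum_distrib_left by (intro sum_mono C1(2) True)
      also have "\<dots> \<le> C1 * norm H ^ M * W"
        unfolding W_def using C1(1) by (intro mult_left_mono sum_ibox_wt_le) auto
      also have "\<dots> = (C1 * W) * norm H ^ M" by simp
      also have "\<dots> \<le> C * norm H ^ M" using p by (intro mult_right_mono) (auto simp: C_def)
      also have "norm H ^ M = min 1 (norm H ^ M)" using True by (simp add: power_le_one min_absorb2)
      finally show ?thesis .
    next
      case False
      have sum_psi: "(\<Sum>k\<in>ibox N. \<bar>psi i (Z - kv k)\<bar>) \<le> C2 ^ CARD('d) * W" for Z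
      proof -
        have "(\<Sum>k\<in>ibox N. \<bar>psi i (Z - kv k)\<bar>) \<le> (\<Sum>k\<in>ibox N. C2 ^ CARD('d) * (\<Prod>m\<in>UNIV. wt ((Z - kv k) $ m)))"
          using C2(2)[of i "Z - kv _"] by (intro sum_mono) (simp add: prod.distrib)
        also have "\<dots> \<le> C2 ^ CARD('d) * W"
          unfolding sum_distrib_left[symmetric] W_def using C2(1) by (intro mult_left_mono sum_ibox_wt_le) auto
        finally show ?thesis .
      qed
      have "(\<Sum>k\<in>ibox N. \<bar>fdiff H M (psi i) (X - kv k)\<bar>)
          \<le> (\<Sum>k\<in>ibox N. \<Sum>j\<le>M. real (M choose j) * \<bar>psi i (X + real j *\<^sub>R H - kv k)\<bar>)"
        unfolding fdiff_binomial
        by (intro sum_mono order_trans[OF sum_abs]) (auto simp: abs_mult power_abs algebra_simps)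
      also have "\<dots> = (\<Sum>j\<le>M. real (M choose j) * (\<Sum>k\<in>ibox N. \<bar>psi i (X + real j *\<^sub>R H - kv k)\<bar>))"
        unfolding sum_distrib_left by (rule sum.swap)
      also have "\<dots> \<le> (\<Sum>j\<le>M. real (M choose j) * (C2 ^ CARD('d) * W))"
        by (intro sum_mono mult_left_mono sum_psi) auto
      also have "\<dots> = 2 ^ M * (C2 ^ CARD('d) * W)"
        using choose_row_sum[of M] by (simp flip: sum_distrib_right of_nat_sum)
      also have "\<dots> \<le> C * 1" using p by (simp add: C_def)
      also have "1 = min 1 (norm H ^ M)" using False by (simp add: min_absorb1)
      finally show ?thesis .
    qed
  qed
qed

text \<open>The estimate holds for each box sum by \<open>sum_ibox_fdiff_psi\<close> and passes to
  the limit, a difference being a finite combination of values.\<close>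

lemma fdiff_T_le:
  obtains C where "C > 0" "\<And>i (g :: real^'d::finite \<Rightarrow> real) B c H X.
    g \<in> borel_measurable lebesgue \<Longrightarrow> (\<And>x. \<bar>g x\<bar> \<le> B) \<Longrightarrow> (\<And>k. \<bar>ipr i g k\<bar> \<le> c) \<Longrightarrow>
    \<bar>fdiff H M (T i g) X\<bar> \<le> C * c * min 1 (norm H ^ M)"
proof -
  obtain C1 where C1: "C1 > 0" "\<And>N i H (X::real^'d).
    (\<Sum>k\<in>ibox N. \<bar>fdiff H M (psi i) (X - kv k)\<bar>) \<le> C1 * min 1 (norm H ^ M)"
    by (rule sum_ibox_fdiff_psi[where 'd = 'd]) (rule that; assumption)
  \<comment> \<open>A common lower bound for the normalizations makes the constant independent of
    the index \<open>i\<close>.\<close>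
  define n0 where "n0 = min (nr True) (nr False)"
  have n0: "n0 > 0" "n0 \<le> nr b" for b using nr_pos by (cases b; simp add: n0_def)+
  show ?thesis
  proof (rule that[of "C1 / n0 ^ CARD('d)"])
    show "C1 / n0 ^ CARD('d) > 0" using C1 n0 by simp
    fix i :: "'d \<Rightarrow> bool" and g :: "real^'d \<Rightarrow> real" and B c H X
    assume g: "g \<in> borel_measurable lebesgue" "\<And>x. \<bar>g x\<bar> \<le> B" and c: "\<And>k. \<bar>ipr i g k\<bar> \<le> c"
    let ?n = "\<Prod>m\<in>UNIV. nr (i m)"
    have n: "n0 ^ CARD('d) \<le> ?n"
      using prod_mono[of UNIV "\<lambda>_::'d. n0" "\<lambda>m. nr (i m)"] n0 by (simp add: less_imp_le)
    have n0d: "0 < n0 ^ CARD('d)" using n0 by simp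
    have "0 \<le> c" using order_trans[OF abs_ge_zero c] .
    have "(\<lambda>N. fdiff H M (\<lambda>X. \<Sum>k\<in>ibox N. ipr i g k / ?n * psi i (X - kv k)) X) \<longlonglongrightarrow> fdiff H M (T i g) X"
      unfolding fdiff_binomial by (intro tendsto_sum tendsto_mult tendsto_const T_tendsto[OF g])
    moreover have "\<bar>fdiff H M (\<lambda>X. \<Sum>k\<in>ibox N. ipr i g k / ?n * psi i (X - kv k)) X\<bar>
        \<le> C1 / n0 ^ CARD('d) * c * min 1 (norm H ^ M)" for N
    proof -
      have "fdiff H M (\<lambda>X. psi i (X - kv k)) X = fdiff H M (psi i) (X - kv k)" for k
        using fdiff_shift[of H M "psi i" "- kv k" X] by simp
      then have "\<bar>fdiff H M (\<lambda>X. \<Sum>k\<in>ibox N. ipr i g k / ?n * psi i (X - kv k)) X\<bar>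
         = \<bar>\<Sum>k\<in>ibox N. ipr i g k / ?n * fdiff H M (psi i) (X - kv k)\<bar>"
        by (simp only: fdiff_sum fdiff_cmult)
      also have "\<dots> \<le> (\<Sum>k\<in>ibox N. c / n0 ^ CARD('d) * \<bar>fdiff H M (psi i) (X - kv k)\<bar>)"
      proof (intro order_trans[OF sum_abs] sum_mono)
        fix k
        have "\<bar>ipr i g k / ?n\<bar> \<le> c / n0 ^ CARD('d)"
          unfolding abs_divide using n n0d \<open>0 \<le> c\<close> by (intro frac_le c) auto
        then show "\<bar>ipr i g k / ?n * fdiff H M (psi i) (X - kv k)\<bar> \<le> c / n0 ^ CARD('d) * \<bar>fdiff H M (psi i) (X - kv k)\<bar>"
          unfolding abs_mult by (rule mult_right_mono) simp
      qed
      also have "\<dots> \<le> c / n0 ^ CARD('d) * (C1 * min 1 (norm H ^ M))"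
        unfolding sum_distrib_left[symmetric] using \<open>0 \<le> c\<close> n0d by (intro mult_left_mono C1(2)) auto
      finally show ?thesis by (simp add: mult_ac)
    qed
    ultimately show "\<bar>fdiff H M (T i g) X\<bar> \<le> C1 / n0 ^ CARD('d) * c * min 1 (norm H ^ M)"
      by (intro LIMSEQ_le_const2[OF tendsto_rabs]) auto
  qed
qed

end

section \<open>Approximation by the coarse projections and telescoping over the levels\<close>

lemma one_plus_sum_le_prod:
  fixes a :: "'i \<Rightarrow> real"
  assumes "finite S" "\<And>i. i \<in> S \<Longrightarrow> 0 \<le> a i"
  shows "1 + (\<Sum>i\<in>S. a i) \<le> (\<Prod>i\<in>S. 1 + a i)"
  using assms
proof (induction S rule: finite_induct)
  case (insert i S)
  have "1 + (a i + (\<Sum>i\<in>S. a i)) \<le> (1 + a i) * (1 + (\<Sum>i\<in>S. a i))"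
    using insert.prems sum_nonneg[of S a] by (simp add: algebra_simps)
  also have "\<dots> \<le> (1 + a i) * (\<Prod>i\<in>S. 1 + a i)"
    using insert by (intro mult_left_mono) auto
  finally show ?case using insert.hyps by simp
qed simp

text \<open>Crude but of product form, so that it can be absorbed factor by factor into the weights
  of the kernel.\<close>

lemma norm_powr_le_prod:
  fixes z :: "real^'d"
  assumes "0 < a" "a < 1"
  shows "norm z powr a \<le> (\<Prod>m\<in>UNIV. 1 + \<bar>z $ m\<bar>)"
proof -
  have "norm z powr a \<le> 1 + norm z"
  proof (cases "norm z \<le> 1")
    case True
    then have "norm z powr a \<le> 1 powr a" using assms by (intro powr_mono2) auto
    then show ?thesis by (simp add: add_increasing2)
  next
    case False
    then have "norm z powr a \<le> norm z powr 1" using assms by (intro powr_mono) auto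
    then show ?thesis by simp
  qed
  also have "\<dots> \<le> 1 + (\<Sum>m\<in>UNIV. \<bar>z $ m\<bar>)" using norm_le_l1_cart[of z] by simp
  also have "\<dots> \<le> (\<Prod>m\<in>UNIV. 1 + \<bar>z $ m\<bar>)" by (rule one_plus_sum_le_prod) auto
  finally show ?thesis .
qed

context mra
begin

abbreviation coarse :: "'d::finite \<Rightarrow> bool" where "coarse \<equiv> \<lambda>_. False"

lemma integral_prod_kern_coarse:
  fixes X :: "real^'d"
  shows "(\<integral>Y. (\<Prod>m\<in>UNIV. kern (coarse m) (X $ m) ((Y::real^'d) $ m)) \<partial>lebesgue) = 1"
proof -
  have "integrable lebesgue (P.ker x)" for x
  proof -
    obtain K where K: "K > 0" "\<And>x y. \<bar>P.ker x y\<bar> \<le> K * wt (y - x)" by (rule P.ker_decay) (rule that; assumption)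
    show ?thesis
      by (rule Bochner_Integration.integrable_bound[OF integrable_mult_right[OF integrable_wt, of K x]])
         (use K P.ker_continuous in \<open>auto intro!: continuous_imp_lebesgue_measurable simp: abs_mult\<close>)
  qed
  then show ?thesis
    using integral_prod_vec[of "\<lambda>m. P.ker (X $ m)"] borel_measurable_continuous_onI[OF P.ker_continuous]
    by (simp add: kern_def ker_integral)
qed

text \<open>As the kernel has integral 1, the error is the integral of
  \<open>f x - dil L f Y\<close> against it. The difference is at most
  \<open>K * 2 powr (- (real L * a))\<close> times a power of the distance of \<open>Y\<close> from
  \<open>X\<close>; since \<open>a < 1\<close>, the spare power of the weight absorbs this growth in
  each coordinate.\<close>

lemma approximation:
  obtains C where "C > 0" "\<And>(f :: real^'d::finite \<Rightarrow> real) B K a L x.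
    f \<in> borel_measurable lebesgue \<Longrightarrow> (\<And>x. \<bar>f x\<bar> \<le> B) \<Longrightarrow> K > 0 \<Longrightarrow> 0 < a \<Longrightarrow> a < 1 \<Longrightarrow>
    (\<And>x h. \<bar>f (x + h) - f x\<bar> \<le> K * norm h powr a) \<Longrightarrow>
    \<bar>f x - T coarse (dil L f) (2 ^ L *\<^sub>R x)\<bar> \<le> C * K * 2 powr (- (real L * a))"
proof -
  obtain C where C: "C > 0"
    "\<And>i (X::real^'d) Y. \<bar>\<Prod>m\<in>UNIV. kern (i m) (X $ m) (Y $ m)\<bar> \<le> (\<Prod>m\<in>UNIV. C * wt (Y $ m - X $ m) ^ 2)"
    "\<And>N i (X::real^'d) Y. \<bar>\<Prod>m\<in>UNIV. kern_sum N (i m) (X $ m) (Y $ m)\<bar> \<le> (\<Prod>m\<in>UNIV. C * wt (Y $ m - X $ m) ^ 2)"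
    by (rule prod_kern_bound[where 'd = 'd]) (rule that; assumption)
  show ?thesis
  proof (rule that[of "(C * wt_int) ^ CARD('d) + 1"])
    show "(C * wt_int) ^ CARD('d) + 1 > 0" using C(1) wt_int_nonneg by (intro add_nonneg_pos) auto
    fix f :: "real^'d \<Rightarrow> real" and B K a :: real and L :: nat and x :: "real^'d"
    assume f: "f \<in> borel_measurable lebesgue" "\<And>x. \<bar>f x\<bar> \<le> B" and K: "K > 0" and a: "0 < a" "a < 1"
      and Hoelder: "\<And>x h. \<bar>f (x + h) - f x\<bar> \<le> K * norm h powr a"
    define X where "X = 2 ^ L *\<^sub>R x"
    define p where "p = (2::real) powr (- (real L * a))"
    let ?k = "\<lambda>Y. \<Prod>m\<in>UNIV. kern (coarse m) (X $ m) (Y $ m)"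
    have int1: "integrable lebesgue (\<lambda>Y. f x * ?k Y)"
      by (rule T_integrable[where B = "\<bar>f x\<bar>"]) auto
    have int2: "integrable lebesgue (\<lambda>Y. dil L f Y * ?k Y)"
      by (rule T_integrable[where B = B]) (use f dil_measurable[OF f(1)] in \<open>auto simp: dil_def\<close>)
    have "f x - T coarse (dil L f) X = (\<integral>Y. f x * ?k Y \<partial>lebesgue) - (\<integral>Y. dil L f Y * ?k Y \<partial>lebesgue)"
      by (simp add: T_def integral_prod_kern_coarse[of X])
    also have "\<dots> = (\<integral>Y. f x * ?k Y - dil L f Y * ?k Y \<partial>lebesgue)"
      by (rule Bochner_Integration.integral_diff[symmetric, OF int1 int2])
    finally have "\<bar>f x - T coarse (dil L f) X\<bar> = norm (\<integral>Y. f x * ?k Y - dil L f Y * ?k Y \<partial>lebesgue)"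
      by simp
    also have "\<dots> \<le> (\<integral>Y. K * p * (\<Prod>m\<in>UNIV. C * wt (Y $ m - X $ m)) \<partial>lebesgue)"
    proof (rule norm_integral_le)
      show "integrable lebesgue (\<lambda>Y::real^'d. K * p * (\<Prod>m\<in>UNIV. C * wt (Y $ m - X $ m)))"
        by (intro integrable_mult_right integrable_wt_prod)
      fix Y :: "real^'d"
      define h where "h = (1 / 2 ^ L) *\<^sub>R (Y - X)"
      have xh: "x + h = (1 / 2 ^ L) *\<^sub>R Y" by (simp add: h_def X_def scaleR_diff_right)
      have "norm h powr a = (1 / 2 ^ L) powr a * norm (Y - X) powr a"
      proof -
        have "norm h = (1 / 2 ^ L) * norm (Y - X)" by (simp add: h_def)
        then show ?thesis by (simp only: powr_mult)
      qed
      also have "(1 / 2 ^ L) powr a = p"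
      proof -
        have "1 / 2 ^ L = (2::real) powr (- real L)" by (simp add: powr_minus powr_realpow divide_inverse)
        then show ?thesis by (simp add: p_def powr_powr)
      qed
      finally have "\<bar>f (x + h) - f x\<bar> \<le> K * (p * norm (Y - X) powr a)" using Hoelder[of x h] by simp
      also have "\<dots> \<le> K * (p * (\<Prod>m\<in>UNIV. 1 + \<bar>Y $ m - X $ m\<bar>))"
        using K norm_powr_le_prod[OF a, of "Y - X"] by (intro mult_left_mono) (auto simp: p_def)
      finally have 1: "\<bar>f x - dil L f Y\<bar> \<le> K * p * (\<Prod>m\<in>UNIV. 1 + \<bar>Y $ m - X $ m\<bar>)"
        unfolding xh dil_def by (simp add: abs_minus_commute)
      have "norm (f x * ?k Y - dil L f Y * ?k Y) = \<bar>f x - dil L f Y\<bar> * \<bar>?k Y\<bar>"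
        by (simp add: left_diff_distrib[symmetric] abs_mult)
      also have "\<dots> \<le> (K * p * (\<Prod>m\<in>UNIV. 1 + \<bar>Y $ m - X $ m\<bar>)) * (\<Prod>m\<in>UNIV. C * wt (Y $ m - X $ m) ^ 2)"
        using K by (intro mult_mono 1 C(2)) (auto simp: p_def intro!: mult_nonneg_nonneg prod_nonneg)
      also have "\<dots> = K * p * (\<Prod>m\<in>UNIV. (1 + \<bar>Y $ m - X $ m\<bar>) * (C * wt (Y $ m - X $ m) ^ 2))"
        by (simp only: prod.distrib mult.assoc)
      also have "\<dots> \<le> K * p * (\<Prod>m\<in>UNIV. C * wt (Y $ m - X $ m))"
      proof (intro mult_left_mono prod_mono conjI)
        fix m
        let ?z = "Y $ m - X $ m"
        have "1 + \<bar>?z\<bar> \<le> (1 + \<bar>?z\<bar>)\<^sup>2" by (simp add: self_le_power)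
        then have "(1 + \<bar>?z\<bar>) * wt ?z \<le> 1" by (simp add: wt_def divide_le_eq_1_pos)
        then have "((1 + \<bar>?z\<bar>) * wt ?z) * (C * wt ?z) \<le> 1 * (C * wt ?z)"
          using C(1) by (intro mult_right_mono) auto
        then show "(1 + \<bar>?z\<bar>) * (C * wt ?z ^ 2) \<le> C * wt ?z" by (simp add: power2_eq_square mult_ac)
      qed (use K C(1) in \<open>auto simp: p_def\<close>)
      finally show "norm (f x * ?k Y - dil L f Y * ?k Y) \<le> K * p * (\<Prod>m\<in>UNIV. C * wt (Y $ m - X $ m))" .
    qed (rule borel_measurable_integrable[OF Bochner_Integration.integrable_diff[OF int1 int2]])
    also have "\<dots> = (C * wt_int) ^ CARD('d) * (K * p)"
      by (subst integral_mult_right_zero) (simp add: integral_wt_prod)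
    also have "\<dots> \<le> ((C * wt_int) ^ CARD('d) + 1) * (K * p)"
      using K by (intro mult_right_mono) (auto simp: p_def)
    finally show "\<bar>f x - T coarse (dil L f) (2 ^ L *\<^sub>R x)\<bar> \<le> ((C * wt_int) ^ CARD('d) + 1) * K * 2 powr (- (real L * a))"
      by (simp add: X_def p_def mult.assoc)
  qed
qed

text \<open>The substitution of \<open>2 *\<^sub>R Y\<close> gives one factor 2 per coordinate, just
  what \<open>ker_two_scale\<close> requires. Multiplying out the product of
  \<open>P.ker + Q.ker\<close> over the coordinates yields one summand for each index
  \<open>i\<close>.\<close>

lemma T_two_scale:
  fixes g :: "real^'d \<Rightarrow> real"
  assumes g: "g \<in> borel_measurable lebesgue" "\<And>x. \<bar>g x\<bar> \<le> B"
  shows "T coarse g (2 *\<^sub>R X) = (\<Sum>i\<in>UNIV. T i (\<lambda>Y. g (2 *\<^sub>R Y)) X)"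
proof -
  let ?h = "\<lambda>Y. g Y * (\<Prod>m\<in>UNIV. kern (coarse m) ((2 *\<^sub>R X) $ m) (Y $ m))"
  have g2: "(\<lambda>Y. g (2 *\<^sub>R Y)) \<in> borel_measurable lebesgue"
    using borel_measurable_affine[of 2 g 0] g(1) by simp
  have "?h \<in> borel_measurable lebesgue"
    by (intro borel_measurable_times g prod_kern_measurable)
  from integral_affine[OF _ this, of 2 0]
  have "T coarse g (2 *\<^sub>R X) = 2 ^ CARD('d) * (\<integral>Y. ?h (2 *\<^sub>R Y) \<partial>lebesgue)"
    by (simp add: T_def)
  also have "\<dots> = (\<integral>Y. 2 ^ CARD('d) * ?h (2 *\<^sub>R Y) \<partial>lebesgue)"
    by (rule integral_mult_right_zero[symmetric])
  also have "(\<lambda>Y. 2 ^ CARD('d) * ?h (2 *\<^sub>R Y)) = (\<lambda>Y. \<Sum>i\<in>UNIV. g (2 *\<^sub>R Y) * (\<Prod>m\<in>UNIV. kern (i m) (X $ m) (Y $ m)))"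
  proof
    fix Y
    have "2 ^ CARD('d) * (\<Prod>m\<in>UNIV. kern (coarse m) ((2 *\<^sub>R X) $ m) ((2 *\<^sub>R Y) $ m))
        = (\<Prod>m\<in>(UNIV :: 'd set). 2 * P.ker (2 * X $ m) (2 * Y $ m))"
      by (simp add: prod.distrib kern_def)
    also have "\<dots> = (\<Prod>m\<in>(UNIV :: 'd set). \<Sum>b\<in>UNIV. kern b (X $ m) (Y $ m))"
      by (intro prod.cong refl) (simp add: ker_two_scale UNIV_bool kern_def)
    also have "\<dots> = (\<Sum>i\<in>UNIV. \<Prod>m\<in>UNIV. kern (i m) (X $ m) (Y $ m))"
      by (subst prod_sum_PiE) (auto simp: PiE_UNIV_domain)
    finally show "2 ^ CARD('d) * ?h (2 *\<^sub>R Y) = (\<Sum>i\<in>UNIV. g (2 *\<^sub>R Y) * (\<Prod>m\<in>UNIV. kern (i m) (X $ m) (Y $ m)))"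
      by (simp only: sum_distrib_left[symmetric] mult.left_commute[of _ "g _"])
  qed
  also have "(\<integral>Y. (\<Sum>i\<in>UNIV. g (2 *\<^sub>R Y) * (\<Prod>m\<in>UNIV. kern (i m) (X $ m) (Y $ m))) \<partial>lebesgue)
      = (\<Sum>i\<in>UNIV. T i (\<lambda>Y. g (2 *\<^sub>R Y)) X)"
    unfolding T_def by (rule Bochner_Integration.integral_sum) (intro T_integrable[where B = B] g2 g)
  finally show ?thesis .
qed

text \<open>In the two-scale relation the index \<open>coarse\<close> gives back the projection at
  the previous level, and the other indices form the wavelet layer of that level.\<close>

lemma T_telescope:
  fixes f :: "real^'d \<Rightarrow> real"
  assumes f: "f \<in> borel_measurable lebesgue" "\<And>x. \<bar>f x\<bar> \<le> B"
  shows "T coarse (dil L f) (2 ^ L *\<^sub>R x)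
    = T coarse (dil 0 f) x + (\<Sum>l<L. \<Sum>i\<in>UNIV - {coarse}. T i (dil l f) (2 ^ l *\<^sub>R x))"
proof (induction L)
  case (Suc L)
  have "T coarse (dil (Suc L) f) (2 *\<^sub>R (2 ^ L *\<^sub>R x)) = (\<Sum>i\<in>UNIV. T i (\<lambda>Y. dil (Suc L) f (2 *\<^sub>R Y)) (2 ^ L *\<^sub>R x))"
    by (rule T_two_scale[where B = B]) (use f dil_measurable[OF f(1)] in \<open>auto simp: dil_def\<close>)
  also have "\<dots> = T coarse (dil L f) (2 ^ L *\<^sub>R x) + (\<Sum>i\<in>UNIV - {coarse}. T i (dil L f) (2 ^ L *\<^sub>R x))"
    unfolding dil_Suc by (rule sum.remove) auto
  finally show ?case using Suc.IH by simp
qed simp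

lemma ipr_bound:
  obtains C where "C > 0" "\<And>i (g :: real^'d::finite \<Rightarrow> real) B k.
    g \<in> borel_measurable lebesgue \<Longrightarrow> (\<And>x. \<bar>g x\<bar> \<le> B) \<Longrightarrow> \<bar>ipr i g k\<bar> \<le> C * B"
proof -
  obtain C where C: "C > 0" "\<And>i (X::real^'d). \<bar>psi i X\<bar> \<le> (\<Prod>m\<in>UNIV. C * wt (X $ m))"
    by (rule psi_bound[where 'd = 'd]) (rule that; assumption)
  show ?thesis
  proof (rule that[of "(C * wt_int) ^ CARD('d) + 1"])
    show "(C * wt_int) ^ CARD('d) + 1 > 0" using C(1) wt_int_nonneg by (intro add_nonneg_pos) auto
    fix i and g :: "real^'d \<Rightarrow> real" and B k
    assume g: "g \<in> borel_measurable lebesgue" "\<And>x. \<bar>g x\<bar> \<le> B"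
    have B: "0 \<le> B" using order_trans[OF abs_ge_zero g(2)] .
    have "norm (ipr i g k) \<le> (\<integral>Y. B * (\<Prod>m\<in>UNIV. C * wt (Y $ m - kv k $ m)) \<partial>lebesgue)"
      unfolding ipr_def
    proof (rule norm_integral_le)
      fix Y :: "real^'d"
      have "\<bar>psi i (Y - kv k)\<bar> \<le> (\<Prod>m\<in>UNIV. C * wt (Y $ m - kv k $ m))" using C(2)[of i "Y - kv k"] by simp
      then show "norm (g Y * psi i (Y - kv k)) \<le> B * (\<Prod>m\<in>UNIV. C * wt (Y $ m - kv k $ m))"
        unfolding real_norm_def abs_mult using g(2) B by (intro mult_mono) auto
    qed (intro borel_measurable_times g continuous_imp_lebesgue_measurable psi_continuous
        integrable_mult_right integrable_wt_prod)+
    also have "\<dots> = (C * wt_int) ^ CARD('d) * B"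
      by (subst integral_mult_right_zero) (simp only: integral_wt_prod mult.commute)
    also have "\<dots> \<le> ((C * wt_int) ^ CARD('d) + 1) * B" using B by (intro mult_right_mono) auto
    finally show "\<bar>ipr i g k\<bar> \<le> ((C * wt_int) ^ CARD('d) + 1) * B" by simp
  qed
qed

lemma wavelet_coeff_eq_ipr:
  fixes f :: "real^'d \<Rightarrow> real"
  assumes "f \<in> borel_measurable lebesgue"
  shows "wavelet_coeff \<phi> \<psi> f i l k = ipr (($) i) (dil l f) (($) k)"
  using wavelet_coeff_eq[OF assms, of "($) i" l "($) k"] by simp

lemma wavelet_indices_nonempty: "(wavelet_indices :: (bool^'d) set) \<noteq> {}"
  unfolding wavelet_indices_def by (auto intro!: exI[of _ "\<chi> _. True"])

lemma
  fixes f :: "real^'d \<Rightarrow> real"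
  assumes f: "f \<in> borel_measurable lebesgue" "\<And>x. \<bar>f x\<bar> \<le> B"
  shows wavelet_coeff_le_coeff_norm: "i \<in> wavelet_indices \<Longrightarrow> \<bar>wavelet_coeff \<phi> \<psi> f i l k\<bar> \<le> coeff_norm \<phi> \<psi> f l"
    and coeff_norm_bounded: "\<exists>D. \<forall>l. coeff_norm \<phi> \<psi> f l \<le> D"
    and coeff_norm_nonneg: "0 \<le> coeff_norm \<phi> \<psi> f l"
proof -
  obtain C where C: "C > 0" "\<And>i (g :: real^'d::finite \<Rightarrow> real) B k.
    g \<in> borel_measurable lebesgue \<Longrightarrow> (\<And>x. \<bar>g x\<bar> \<le> B) \<Longrightarrow> \<bar>ipr i g k\<bar> \<le> C * B"
    by (rule ipr_bound[where 'd = 'd]) (rule that, assumption, blast)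
  have le: "\<bar>wavelet_coeff \<phi> \<psi> f i l k\<bar> \<le> C * B" for i l k
    unfolding wavelet_coeff_eq_ipr[OF f(1)]
    by (rule C(2)[OF dil_measurable[OF f(1)]]) (simp add: dil_def f(2))
  have bdd1: "bdd_above (range (\<lambda>k. \<bar>wavelet_coeff \<phi> \<psi> f i l k\<bar>))" for i l
    using le by (intro bdd_aboveI2)
  have le2: "(SUP k. \<bar>wavelet_coeff \<phi> \<psi> f i l k\<bar>) \<le> C * B" for i l
    by (rule cSUP_least) (auto intro: le)
  have bdd2: "bdd_above ((\<lambda>i. SUP k. \<bar>wavelet_coeff \<phi> \<psi> f i l k\<bar>) ` wavelet_indices)" for l
    using le2 by (intro bdd_aboveI2)
  show 1: "\<bar>wavelet_coeff \<phi> \<psi> f i l k\<bar> \<le> coeff_norm \<phi> \<psi> f l" if "i \<in> wavelet_indices" for i l k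
    unfolding coeff_norm_def
    by (rule cSUP_upper2[OF bdd2 that]) (rule cSUP_upper[OF UNIV_I bdd1])
  show "\<exists>D. \<forall>l. coeff_norm \<phi> \<psi> f l \<le> D"
    unfolding coeff_norm_def
    by (intro exI[of _ "C * B"] allI cSUP_least wavelet_indices_nonempty le2)
  obtain i :: "bool^'d" where "i \<in> wavelet_indices" using wavelet_indices_nonempty by blast
  from order_trans[OF abs_ge_zero 1[OF this]] show "0 \<le> coeff_norm \<phi> \<psi> f l" .
qed

lemma coeff_norm_least:
  fixes f :: "real^'d \<Rightarrow> real"
  assumes "\<And>i k. i \<in> wavelet_indices \<Longrightarrow> \<bar>wavelet_coeff \<phi> \<psi> f i l k\<bar> \<le> c"
  shows "coeff_norm \<phi> \<psi> f l \<le> c"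
  unfolding coeff_norm_def by (intro cSUP_least wavelet_indices_nonempty) (auto intro: assms)

text \<open>The coarse projection is a layer at unit scale with bounded coefficients, which gives
  \<open>norm h ^ M\<close>. The difference of the remainder is estimated by its values alone,
  without any gain from \<open>h\<close>; hence \<open>L\<close> is left free, to be chosen in terms
  of the step.\<close>

lemma fdiff_le_coeff_norms:
  fixes f :: "real^'d \<Rightarrow> real"
  assumes f: "f \<in> borel_measurable lebesgue" "\<And>x. \<bar>f x\<bar> \<le> B"
    and Hoelder: "K > 0" "0 < a" "a < 1" "\<And>x h. \<bar>f (x + h) - f x\<bar> \<le> K * norm h powr a"
  obtains C where "C > 0" "\<And>L h x. norm h \<le> 1 \<Longrightarrow> \<bar>fdiff h M f x\<bar> \<le>
    C * (norm h ^ M + (\<Sum>l<L. coeff_norm \<phi> \<psi> f l * min 1 ((2 ^ l * norm h) ^ M)) + 2 powr (- (real L * a)))"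
proof -
  obtain C1 where C1: "C1 > 0" "\<And>i (g :: real^'d \<Rightarrow> real) B c H X.
    g \<in> borel_measurable lebesgue \<Longrightarrow> (\<And>x. \<bar>g x\<bar> \<le> B) \<Longrightarrow> (\<And>k. \<bar>ipr i g k\<bar> \<le> c) \<Longrightarrow>
    \<bar>fdiff H M (T i g) X\<bar> \<le> C1 * c * min 1 (norm H ^ M)"
    by (rule fdiff_T_le[where 'd = 'd]) (rule that, assumption, blast)
  obtain C2 where C2: "C2 > 0" "\<And>(f :: real^'d \<Rightarrow> real) B K a L x.
    f \<in> borel_measurable lebesgue \<Longrightarrow> (\<And>x. \<bar>f x\<bar> \<le> B) \<Longrightarrow> K > 0 \<Longrightarrow> 0 < a \<Longrightarrow> a < 1 \<Longrightarrow>
    (\<And>x h. \<bar>f (x + h) - f x\<bar> \<le> K * norm h powr a) \<Longrightarrow>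
    \<bar>f x - T coarse (dil L f) (2 ^ L *\<^sub>R x)\<bar> \<le> C2 * K * 2 powr (- (real L * a))"
    by (rule approximation[where 'd = 'd]) (rule that, assumption, blast)
  obtain C3 where C3: "C3 > 0" "\<And>i (g :: real^'d \<Rightarrow> real) B k.
    g \<in> borel_measurable lebesgue \<Longrightarrow> (\<And>x. \<bar>g x\<bar> \<le> B) \<Longrightarrow> \<bar>ipr i g k\<bar> \<le> C3 * B"
    by (rule ipr_bound[where 'd = 'd]) (rule that, assumption, blast)
  have B: "0 \<le> B" using order_trans[OF abs_ge_zero f(2)] .
  have dil: "dil l f \<in> borel_measurable lebesgue" "\<And>x. \<bar>dil l f x\<bar> \<le> B" for l
    using dil_measurable[OF f(1)] f(2) by (auto simp: dil_def)
  let ?D = "coeff_norm \<phi> \<psi> f"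
  define I where "I = UNIV - {coarse :: 'd \<Rightarrow> bool}"
  define Ca where "Ca = C1 * (C3 * B)"
  define Cb where "Cb = real (card I) * C1"
  define Cc where "Cc = 2 ^ M * (C2 * K)"
  have nn: "0 \<le> Ca" "0 \<le> Cb" "0 < Cc" using C1(1) C2(1) C3(1) B Hoelder(1) by (auto simp: Ca_def Cb_def Cc_def)
  show ?thesis
  proof (rule that[of "Ca + Cb + Cc"])
    show "Ca + Cb + Cc > 0" using nn by simp
    fix L :: nat and h x :: "real^'d"
    assume h: "norm h \<le> 1"
    let ?r = "\<lambda>x. f x - T coarse (dil L f) (2 ^ L *\<^sub>R x)"
    let ?S = "\<Sum>l<L. ?D l * min 1 ((2 ^ l * norm h) ^ M)"
    have "f = (\<lambda>x. (T coarse (dil 0 f) x + (\<Sum>l<L. \<Sum>i\<in>I. T i (dil l f) (2 ^ l *\<^sub>R x))) + ?r x)"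
      unfolding T_telescope[OF f, folded I_def] by simp
    then have "fdiff h M f x = fdiff h M (\<lambda>x. (T coarse (dil 0 f) x + (\<Sum>l<L. \<Sum>i\<in>I. T i (dil l f) (2 ^ l *\<^sub>R x))) + ?r x) x"
      by simp
    also have "\<dots> = fdiff h M (T coarse (dil 0 f)) x
       + (\<Sum>l<L. \<Sum>i\<in>I. fdiff h M (\<lambda>x. T i (dil l f) (2 ^ l *\<^sub>R x)) x) + fdiff h M ?r x"
      unfolding fdiff_add fdiff_sum by simp
    finally have eq: "fdiff h M f x = fdiff h M (T coarse (dil 0 f)) x
       + (\<Sum>l<L. \<Sum>i\<in>I. fdiff h M (\<lambda>x. T i (dil l f) (2 ^ l *\<^sub>R x)) x) + fdiff h M ?r x" .
    have 1: "\<bar>fdiff h M (T coarse (dil 0 f)) x\<bar> \<le> Ca * norm h ^ M"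
    proof -
      have "\<bar>fdiff h M (T coarse (dil 0 f)) x\<bar> \<le> C1 * (C3 * B) * min 1 (norm h ^ M)"
        by (rule C1(2)[OF dil C3(2)[OF dil]])
      also have "min 1 (norm h ^ M) = norm h ^ M" using h by (simp add: power_le_one min_absorb2)
      finally show ?thesis by (simp add: Ca_def)
    qed
    have 2: "\<bar>fdiff h M (\<lambda>x. T i (dil l f) (2 ^ l *\<^sub>R x)) x\<bar> \<le> C1 * (?D l * min 1 ((2 ^ l * norm h) ^ M))"
      if "i \<in> I" for i l
    proof -
      have "\<bar>ipr i (dil l f) k\<bar> \<le> ?D l" for k
      proof -
        have "(\<chi> m. i m) \<in> wavelet_indices"
          using \<open>i \<in> I\<close> by (auto simp: I_def wavelet_indices_def fun_eq_iff)
        from wavelet_coeff_le_coeff_norm[OF f this, of l "\<chi> m. k m"] show ?thesis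
          unfolding wavelet_coeff_eq[OF f(1)] .
      qed
      from C1(2)[OF dil this, of "2 ^ l *\<^sub>R h" "2 ^ l *\<^sub>R x"] show ?thesis
        by (subst fdiff_scaleR) (simp_all add: mult.assoc)
    qed
    have "\<bar>\<Sum>l<L. \<Sum>i\<in>I. fdiff h M (\<lambda>x. T i (dil l f) (2 ^ l *\<^sub>R x)) x\<bar>
        \<le> (\<Sum>l<L. \<Sum>i\<in>I. \<bar>fdiff h M (\<lambda>x. T i (dil l f) (2 ^ l *\<^sub>R x)) x\<bar>)"
      by (intro order_trans[OF sum_abs] sum_mono sum_abs)
    also have "\<dots> \<le> (\<Sum>l<L. \<Sum>i\<in>I. C1 * (?D l * min 1 ((2 ^ l * norm h) ^ M)))"
      by (intro sum_mono 2)
    also have "\<dots> = Cb * ?S"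
      by (simp add: Cb_def sum_distrib_left mult.assoc)
    finally have 2: "\<bar>\<Sum>l<L. \<Sum>i\<in>I. fdiff h M (\<lambda>x. T i (dil l f) (2 ^ l *\<^sub>R x)) x\<bar> \<le> Cb * ?S" .
    have 3: "\<bar>fdiff h M ?r x\<bar> \<le> Cc * 2 powr (- (real L * a))"
    proof -
      have "\<bar>?r y\<bar> \<le> C2 * K * 2 powr (- (real L * a))" for y
        by (rule C2(2)[OF f Hoelder])
      from abs_fdiff_le[of ?r, OF this] show ?thesis by (simp add: Cc_def mult.assoc)
    qed
    have S: "0 \<le> ?S" by (intro sum_nonneg mult_nonneg_nonneg coeff_norm_nonneg[OF f]) auto
    have "\<bar>fdiff h M f x\<bar> \<le> Ca * norm h ^ M + Cb * ?S + Cc * 2 powr (- (real L * a))"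
      unfolding eq using 1 2 3 by linarith
    also have "\<dots> \<le> (Ca + Cb + Cc) * norm h ^ M + (Ca + Cb + Cc) * ?S + (Ca + Cb + Cc) * 2 powr (- (real L * a))"
      using nn S by (intro add_mono mult_right_mono) auto
    finally show "\<bar>fdiff h M f x\<bar> \<le> (Ca + Cb + Cc) * (norm h ^ M + ?S + 2 powr (- (real L * a)))"
      by (simp only: distrib_left)
  qed
qed

text \<open>Every wavelet index has a direction with the factor \<psi>; its iterated primitives feed
  \<open>ridge_integral_le\<close> in that direction. The constants depend on the index, so they are
  summed over the finitely many indices.\<close>

lemma coeff_norm_le_modulus:
  fixes f :: "real^'d \<Rightarrow> real"
  assumes f: "f \<in> borel_measurable lebesgue" "bounded (range f)" and M: "M \<ge> 1"
  obtains C where "C > 0" "\<And>l. coeff_norm \<phi> \<psi> f l \<le> C * modulus M f (1 / 2 ^ l)"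
proof -
  obtain \<theta> where prim_all: "\<theta> 0 = \<psi> \<and> (\<forall>n\<le>M. rapid (\<theta> n) \<and> continuous_on UNIV (\<theta> n)) \<and>
    (\<forall>n<M. \<forall>x. (\<theta> (Suc n) has_real_derivative \<theta> n x) (at x))"
    using rapid_iterated_primitives[OF Q.rapid Q.cont moments] by (rule exE)
  then have prim: "\<theta> 0 = \<psi>" "\<And>n. n \<le> M \<Longrightarrow> rapid (\<theta> n)" "\<And>n. n \<le> M \<Longrightarrow> continuous_on UNIV (\<theta> n)"
    "\<And>n x. n < M \<Longrightarrow> (\<theta> (Suc n) has_real_derivative \<theta> n x) (at x)"
    by simp_all
  have "\<exists>C>0. \<forall>l k. \<bar>wavelet_coeff \<phi> \<psi> f i l k\<bar> \<le> C * modulus M f (1 / 2 ^ l)"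
    if i: "i \<in> wavelet_indices" for i :: "bool^'d"
  proof -
    obtain m where m: "i $ m" using i by (auto simp: wavelet_indices_def)
    interpret ridge_chain m M \<theta> "\<lambda>j. fac (i $ j)"
      by unfold_locales (use prim M fac_cont fac_rapid in auto)
    have psi: "\<theta> 0 (x $ m) * R x = psi (($) i) x" for x
      unfolding R_def psi_def prim(1) by (subst (2) prod.remove[of _ m]) (use m in \<open>auto simp: fac_def\<close>)
    obtain C where C: "C > 0" "\<And>g W. g \<in> borel_measurable lebesgue \<Longrightarrow> bounded (range g) \<Longrightarrow>
        (\<And>\<tau> x. 0 \<le> \<tau> \<Longrightarrow> \<tau> \<le> 1 \<Longrightarrow> \<bar>fdiff (\<tau> *\<^sub>R e) M g x\<bar> \<le> W) \<Longrightarrow>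
        \<bar>\<integral>x. g x * psi (($) i) x \<partial>lebesgue\<bar> \<le> C * W"
      using ridge_integral_le unfolding psi by (elim exE conjE) (rule that, assumption, blast)
    have "\<bar>wavelet_coeff \<phi> \<psi> f i l k\<bar> \<le> C * modulus M f (1 / 2 ^ l)" for l k
    proof -
      let ?k = "kv (($) k)"
      \<comment> \<open>In these coordinates the wavelet is fixed and the level and position are in
        the function, whose differences with steps at most 1 are differences of \<open>f\<close>
        with steps at most \<open>1 / 2 ^ l\<close>.\<close>
      define g where "g Y = dil l f (Y + ?k)" for Y
      have gm: "g \<in> borel_measurable lebesgue"
        using borel_measurable_affine[of 1 "dil l f" ?k] dil_measurable[OF f(1)]
        by (simp add: g_def[abs_def] add.commute)
      have gb: "bounded (range g)"
        by (rule bounded_subset[OF f(2)]) (auto simp: g_def dil_def)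
      have "(\<lambda>Y. dil l f Y * psi (($) i) (Y - ?k)) \<in> borel_measurable lebesgue"
        by (intro borel_measurable_times dil_measurable f continuous_imp_lebesgue_measurable psi_continuous)
      from integral_affine[OF _ this, of 1 ?k]
      have eq: "wavelet_coeff \<phi> \<psi> f i l k = (\<integral>x. g x * psi (($) i) x \<partial>lebesgue)"
        unfolding wavelet_coeff_eq_ipr[OF f(1)] ipr_def by (simp add: g_def add.commute)
      have "\<bar>fdiff (\<tau> *\<^sub>R e) M g x\<bar> \<le> modulus M f (1 / 2 ^ l)" if "0 \<le> \<tau>" "\<tau> \<le> 1" for \<tau> x
      proof -
        have "fdiff (\<tau> *\<^sub>R e) M g x = fdiff (\<tau> *\<^sub>R e) M (dil l f) (x + ?k)"
          unfolding g_def by (rule fdiff_shift)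
        also have "\<dots> = fdiff ((1 / 2 ^ l) *\<^sub>R (\<tau> *\<^sub>R e)) M f ((1 / 2 ^ l) *\<^sub>R (x + ?k))"
          unfolding dil_def[abs_def] by (rule fdiff_scaleR) simp
        also have "\<bar>\<dots>\<bar> \<le> modulus M f (1 / 2 ^ l)"
          by (rule fdiff_le_modulus[OF f(2)]) (use that in \<open>simp add: norm_axis_1 divide_right_mono\<close>)
        finally show ?thesis .
      qed
      from C(2)[OF gm gb this] show ?thesis unfolding eq .
    qed
    with C(1) show ?thesis by blast
  qed
  then obtain c where c: "\<And>i :: bool^'d. i \<in> wavelet_indices \<Longrightarrow> c i > 0"
    "\<And>(i :: bool^'d) l k. i \<in> wavelet_indices \<Longrightarrow> \<bar>wavelet_coeff \<phi> \<psi> f i l k\<bar> \<le> c i * modulus M f (1 / 2 ^ l)"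
    by metis
  define C where "C = (\<Sum>i\<in>(wavelet_indices :: (bool^'d) set). c i)"
  have fin: "finite (wavelet_indices :: (bool^'d) set)" by simp
  have mod: "0 \<le> modulus M f (1 / 2 ^ l)" for l
    using fdiff_le_modulus[OF f(2), of 0 "1 / 2 ^ l" M 0] by (auto intro: order_trans[OF abs_ge_zero])
  show ?thesis
  proof (rule that[of C])
    show "C > 0" unfolding C_def by (intro sum_pos fin wavelet_indices_nonempty c)
    show "coeff_norm \<phi> \<psi> f l \<le> C * modulus M f (1 / 2 ^ l)" for l
    proof (rule coeff_norm_least)
      fix i :: "bool^'d" and k
      assume i: "i \<in> wavelet_indices"
      have "c i \<le> C" unfolding C_def by (rule member_le_sum[OF i _ fin]) (use c in \<open>auto intro: less_imp_le\<close>)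
      then show "\<bar>wavelet_coeff \<phi> \<psi> f i l k\<bar> \<le> C * modulus M f (1 / 2 ^ l)"
        using c(2)[OF i, of l k] mod[of l] by (meson mult_right_mono order_trans)
    qed
  qed
qed

end

section \<open>The irregularity criterion\<close>

lemma translate_basis_nonzero:
  assumes "orthogonal_basis_of (\<lambda>k::int. \<lambda>x. u (x - of_int k)) S"
  obtains a where "u a \<noteq> 0"
proof -
  have "l2_norm (\<lambda>x. u (x - of_int 0)) \<noteq> 0"
    using assms unfolding orthogonal_basis_of_def by blast
  moreover have "l2_norm (\<lambda>x. u (x - of_int 0)) = 0" if "\<forall>a. u a = 0"
    using that by (simp add: l2_norm_def l2_inner_def)
  ultimately have "\<not> (\<forall>a. u a = 0)" by blast
  then show ?thesis using that by blast
qed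

lemma regular_wavelets_mra:
  assumes "regular_wavelets TYPE('d::finite) \<gamma> \<phi> \<psi>" "\<gamma> > real M"
  obtains V where "mra V \<phi> \<psi> M"
proof -
  obtain V where V: "multiresolution_analysis V \<phi>"
    "orthogonal_basis_of (\<lambda>k::int. \<lambda>x. \<psi> (x - of_int k)) {g \<in> V 1. \<forall>h\<in>V 0. l2_inner g h = 0}"
    using assms(1) unfolding regular_wavelets_def scaling_function_and_wavelet_def by blast
  have "orthogonal_basis_of (\<lambda>k::int. \<lambda>x. \<phi> (x - of_int k)) (V 0)"
    using V(1) unfolding multiresolution_analysis_def by (elim conjE)
  then obtain a where a: "\<phi> a \<noteq> 0" by (rule translate_basis_nonzero)
  obtain b where b: "\<psi> b \<noteq> 0" using V(2) by (rule translate_basis_nonzero)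
  have "smooth_rapid M \<phi>" by (rule smooth_rapid_tensor_factor[OF assms, where b = False]) (use a in auto)
  moreover have "smooth_rapid M \<psi>" by (rule smooth_rapid_tensor_factor[OF assms, where b = True]) (use b in auto)
  ultimately show ?thesis using that V by (simp add: mra_def)
qed

lemma powr_neg_mult: "2 powr (- (real j * \<alpha>)) = (1 / 2 ^ j) powr \<alpha>"
proof -
  have "1 / 2 ^ j = (2::real) powr (- real j)" by (simp add: powr_minus powr_realpow divide_inverse)
  then show ?thesis by (simp add: powr_powr)
qed

lemma powr_neg_mult_nat: "(2::real) powr (- real (j * M)) = 1 / 2 ^ (j * M)"
  by (simp only: powr_minus powr_realpow divide_inverse mult_1 zero_less_numeral)

context mra
begin

lemma coeff_max_le_modulus:
  fixes f :: "real^'d \<Rightarrow> real"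
  assumes f: "f \<in> borel_measurable lebesgue" "bounded (range f)" and M: "M \<ge> 1"
  obtains C where "C > 0" "\<And>j. max (SUP l\<in>{j..}. coeff_norm \<phi> \<psi> f l)
      (2 powr (- real (j * M)) * (SUP l\<in>{0..j}. 2 ^ (l * M) * coeff_norm \<phi> \<psi> f l)) \<le> C * modulus M f (1 / 2 ^ j)"
proof -
  obtain C where C: "C > 0" "\<And>l. coeff_norm \<phi> \<psi> f l \<le> C * modulus M f (1 / 2 ^ l)"
    by (rule coeff_norm_le_modulus[OF f M]) (rule that; assumption)
  show ?thesis
  proof (rule that[OF C(1)])
    fix j
    have "coeff_norm \<phi> \<psi> f l \<le> C * modulus M f (1 / 2 ^ j)" if "j \<le> l" for l
    proof -
      have "modulus M f (1 / 2 ^ l) \<le> modulus M f (1 / 2 ^ j)"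
        using that by (intro modulus_mono f divide_left_mono power_increasing) auto
      then show ?thesis using C by (meson mult_left_mono less_imp_le order_trans)
    qed
    then have 1: "(SUP l\<in>{j..}. coeff_norm \<phi> \<psi> f l) \<le> C * modulus M f (1 / 2 ^ j)"
      by (intro cSUP_least) auto
    have "2 ^ (l * M) * coeff_norm \<phi> \<psi> f l \<le> 2 ^ (j * M) * (C * modulus M f (1 / 2 ^ j))" if "l \<le> j" for l
    proof -
      have eq: "1 / 2 ^ l = 2 ^ (j - l) * (1 / (2::real) ^ j)"
        using that by (simp add: power_diff)
      have "coeff_norm \<phi> \<psi> f l \<le> C * modulus M f (2 ^ (j - l) * (1 / 2 ^ j))" using C(2)[of l] unfolding eq .
      also have "\<dots> \<le> C * (2 ^ ((j - l) * M) * modulus M f (1 / 2 ^ j))"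
        using C(1) by (intro mult_left_mono modulus_power2 f) auto
      finally have "2 ^ (l * M) * coeff_norm \<phi> \<psi> f l \<le> 2 ^ (l * M) * (C * (2 ^ ((j - l) * M) * modulus M f (1 / 2 ^ j)))"
        by (rule mult_left_mono) simp
      also have "\<dots> = 2 ^ (l * M + (j - l) * M) * (C * modulus M f (1 / 2 ^ j))"
        by (simp add: power_add mult_ac)
      also have "l * M + (j - l) * M = j * M" using that by (simp flip: distrib_right)
      finally show ?thesis .
    qed
    then have "(SUP l\<in>{0..j}. 2 ^ (l * M) * coeff_norm \<phi> \<psi> f l) \<le> 2 ^ (j * M) * (C * modulus M f (1 / 2 ^ j))"
      by (intro cSUP_least) auto
    then have 2: "2 powr (- real (j * M)) * (SUP l\<in>{0..j}. 2 ^ (l * M) * coeff_norm \<phi> \<psi> f l) \<le> C * modulus M f (1 / 2 ^ j)"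
      unfolding powr_neg_mult_nat by (simp add: field_simps)
    show "max (SUP l\<in>{j..}. coeff_norm \<phi> \<psi> f l)
      (2 powr (- real (j * M)) * (SUP l\<in>{0..j}. 2 ^ (l * M) * coeff_norm \<phi> \<psi> f l)) \<le> C * modulus M f (1 / 2 ^ j)"
      using 1 2 by (rule max.boundedI)
  qed
qed

lemma coeff_lower_bound_imp_UI:
  fixes f :: "real^'d \<Rightarrow> real"
  assumes f: "f \<in> borel_measurable lebesgue" "bounded (range f)" and \<alpha>: "\<alpha> > 0" and M: "M = nat \<lfloor>\<alpha>\<rfloor> + 1"
    and lower: "coeff_lower_bound \<phi> \<psi> M \<alpha> f"
  shows "f \<in> UI \<alpha>"
proof -
  have M1: "M \<ge> 1" unfolding M by simp
  obtain C where C: "C > 0" "\<And>j. max (SUP l\<in>{j..}. coeff_norm \<phi> \<psi> f l)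
      (2 powr (- real (j * M)) * (SUP l\<in>{0..j}. 2 ^ (l * M) * coeff_norm \<phi> \<psi> f l)) \<le> C * modulus M f (1 / 2 ^ j)"
    by (rule coeff_max_le_modulus[OF f M1]) (rule that; assumption)
  obtain c where c: "c > 0" "\<And>j. c * 2 powr (- (real j * \<alpha>)) \<le> max (SUP l\<in>{j..}. coeff_norm \<phi> \<psi> f l)
      (2 powr (- real (j * M)) * (SUP l\<in>{0..j}. 2 ^ (l * M) * coeff_norm \<phi> \<psi> f l))"
    using lower unfolding coeff_lower_bound_def by blast
  have mod: "c / C * (1 / 2 ^ j) powr \<alpha> \<le> modulus M f (1 / 2 ^ j)" for j
  proof -
    have "c * (1 / 2 ^ j) powr \<alpha> \<le> C * modulus M f (1 / 2 ^ j)"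
      using order_trans[OF c(2) C(2), of j] unfolding powr_neg_mult .
    then show ?thesis using C(1) by (simp add: field_simps)
  qed
  \<comment> \<open>Rounding a radius down to a power \<open>1 / 2 ^ j\<close> costs at most a
    factor 2, hence \<open>2 powr \<alpha>\<close> in the constant.\<close>
  define c' where "c' = c / C / 2 powr \<alpha>"
  have "c' * r powr \<alpha> * \<bar>ln r\<bar> powr 0 \<le> modulus M f r" if r: "0 < r" "r \<le> 1 / 2" for r
  proof -
    define j where "j = nat \<lceil>- log 2 r\<rceil>"
    have "log 2 r < 0" using r by (simp add: log_less_zero_cancel_iff)
    then have j: "- log 2 r \<le> real j" "real j < - log 2 r + 1" unfolding j_def by linarith+
    have "2 powr (- real j) \<le> 2 powr (log 2 r)" using j by (intro powr_mono) auto
    moreover have "2 powr (log 2 r - 1) \<le> 2 powr (- real j)" using j by (intro powr_mono) auto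
    moreover have "2 powr (- real j) = (1::real) / 2 ^ j" by (simp add: powr_minus powr_realpow divide_inverse)
    ultimately have rj: "1 / 2 ^ j \<le> r" "r / 2 \<le> 1 / 2 ^ j"
      using r by (simp_all add: powr_diff)
    have "c' * r powr \<alpha> = c / C * (r / 2) powr \<alpha>"
      using r by (simp add: c'_def powr_divide)
    also have "\<dots> \<le> c / C * (1 / 2 ^ j) powr \<alpha>"
      using c(1) C(1) \<alpha> r rj(2) by (intro mult_left_mono powr_mono2) auto
    also have "\<dots> \<le> modulus M f (1 / 2 ^ j)" by (rule mod)
    also have "\<dots> \<le> modulus M f r" by (rule modulus_mono[OF f(2) _ rj(1)]) simp
    \<comment> \<open>Since \<open>r \<le> 1 / 2\<close>, the logarithm is not zero and its power
      with exponent 0 equals 1.\<close>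
    finally show ?thesis using r by simp
  qed
  moreover have "c' > 0" using c(1) C(1) by (simp add: c'_def)
  ultimately show ?thesis
    unfolding UI_def UI_log_def M[symmetric] mem_Collect_eq
    by (intro conjI f(2) exI[of _ c'] exI[of _ "1 / 2 :: real"]) auto
qed

text \<open>The number of layers at level \<open>j\<close> is proportional to \<open>j\<close>, so
  any exponent greater than 1 on the logarithm would win; 2 makes the comparison one between a
  square and a linear term.\<close>

lemma UI_imp_coeff_lower_bound:
  fixes f :: "real^'d \<Rightarrow> real"
  assumes f: "f \<in> borel_measurable lebesgue" "bounded (range f)" and \<alpha>: "\<alpha> > 0" and M: "M = nat \<lfloor>\<alpha>\<rfloor> + 1"
    and Hoelder: "uniformly_Hoelderian f" and UI: "f \<in> UI_log \<alpha> 2"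
  shows "coeff_lower_bound \<phi> \<psi> M \<alpha> f"
proof -
  obtain B where B: "\<And>x. \<bar>f x\<bar> \<le> B" using f(2) by (auto simp: bounded_iff)
  obtain a K where a: "0 < a" "a < 1" and K: "K > 0" "\<And>x h. \<bar>f (x + h) - f x\<bar> \<le> K * norm h powr a"
    by (rule uniformly_Hoelderian_imp_Hoelder[OF Hoelder]) (rule that; assumption)
  let ?D = "coeff_norm \<phi> \<psi> f"
  define A where "A j = (SUP l\<in>{j..}. ?D l)" for j
  define E where "E j = (SUP l\<in>{0..j}. 2 ^ (l * M) * ?D l)" for j
  define mx where "mx j = max (A j) (2 powr (- real (j * M)) * E j)" for j
  obtain C where C: "C > 0" "\<And>L h x. norm h \<le> 1 \<Longrightarrow> \<bar>fdiff h M f x\<bar> \<le>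
    C * (norm h ^ M + (\<Sum>l<L. ?D l * min 1 ((2 ^ l * norm h) ^ M)) + 2 powr (- (real L * a)))"
    by (rule fdiff_le_coeff_norms[OF f(1) B K(1) a K(2)]) (rule that, assumption, blast)
  obtain c R where c: "c > 0" "R > 0"
    "\<And>r. 0 < r \<Longrightarrow> r \<le> R \<Longrightarrow> c * r powr \<alpha> * \<bar>ln r\<bar> powr 2 \<le> modulus M f r"
    using UI unfolding UI_log_def M[symmetric] by blast
  \<comment> \<open>The supremum over all levels from \<open>j\<close> on runs over an infinite set;
    a uniform bound is needed before its members can be compared with it.\<close>
  obtain D0 where D0: "\<And>l. ?D l \<le> D0" using coeff_norm_bounded[OF f(1) B] by blast
  have D_nonneg: "0 \<le> ?D l" for l by (rule coeff_norm_nonneg[OF f(1) B])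
  have D_le_A: "?D l \<le> A j" if "j \<le> l" for j l
    unfolding A_def using that D0 by (intro cSUP_upper bdd_aboveI2[where M = D0]) auto
  have D_le_E: "2 ^ (l * M) * ?D l \<le> E j" if "l \<le> j" for j l
    unfolding E_def using that by (intro cSUP_upper) auto
  have \<alpha>M: "\<alpha> \<le> real M" using \<alpha> M by linarith
  \<comment> \<open>With about \<open>j * q\<close> levels the remainder is at most
    \<open>2 powr (- (real L * a)) \<le> 2 powr (- (real j * \<alpha>))\<close> up to a
    constant.\<close>
  define q where "q = \<alpha> / a"
  have q: "q > 0" using \<alpha> a by (simp add: q_def)
  have small: "c * (real j * ln 2)\<^sup>2 \<le> C * (3 + real j * q)"
    if less: "mx j < 2 powr (- (real j * \<alpha>))" and R: "1 / 2 ^ j \<le> R" for j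
  proof -
    define e where "e = (1 / 2 ^ j) powr \<alpha>"
    have e: "e > 0" by (simp add: e_def)
    have "A j \<le> e" "2 powr (- real (j * M)) * E j \<le> e"
      using less unfolding mx_def powr_neg_mult e_def by auto
    then have Ae: "A j \<le> e" and Ee: "E j / 2 ^ (j * M) \<le> e" unfolding powr_neg_mult_nat by auto
    define L where "L = nat \<lceil>real j * q\<rceil>"
    have "0 \<le> real j * q" using q by simp
    then have L: "real j * q \<le> real L" "real L \<le> real j * q + 1" unfolding L_def by linarith+
    have tail: "2 powr (- (real L * a)) \<le> e"
    proof -
      have "real j * \<alpha> \<le> real L * a" using mult_right_mono[OF L(1), of a] a by (simp add: q_def)
      then have "(2::real) powr (- (real L * a)) \<le> 2 powr (- (real j * \<alpha>))" by (intro powr_mono) auto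
      then show ?thesis unfolding e_def powr_neg_mult .
    qed
    \<comment> \<open>The 3 collects one \<open>e\<close> each from the coarse projection, from the
      remainder and from rounding \<open>j * q\<close> up to an integer; each of the
      \<open>L\<close> layers adds one more.\<close>
    have "modulus M f (1 / 2 ^ j) \<le> C * e * (3 + real j * q)"
    proof (rule modulus_le)
      fix h x :: "real^'d"
      assume h: "norm h \<le> 1 / 2 ^ j"
      have h1: "norm h \<le> 1" by (rule order_trans[OF h]) simp
      have "norm h ^ M \<le> (1 / 2 ^ j) ^ M" by (rule power_mono[OF h]) simp
      also have "\<dots> = (1 / 2 ^ j) powr real M" by (simp add: powr_realpow)
      also have "\<dots> \<le> e" unfolding e_def by (rule powr_mono'[OF \<alpha>M]) auto
      finally have hM: "norm h ^ M \<le> e" .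
      have level: "?D l * min 1 ((2 ^ l * norm h) ^ M) \<le> e" for l
      proof (cases "j \<le> l")
        case True
        have "?D l * min 1 ((2 ^ l * norm h) ^ M) \<le> ?D l * 1" by (intro mult_left_mono D_nonneg) simp
        also have "\<dots> \<le> e" using D_le_A[OF True] Ae by simp
        finally show ?thesis .
      next
        case False
        have "?D l * min 1 ((2 ^ l * norm h) ^ M) \<le> ?D l * (2 ^ l * (1 / 2 ^ j)) ^ M"
        proof (intro mult_left_mono D_nonneg)
          have "(2 ^ l * norm h) ^ M \<le> (2 ^ l * (1 / 2 ^ j)) ^ M" by (intro power_mono mult_left_mono h) auto
          then show "min 1 ((2 ^ l * norm h) ^ M) \<le> (2 ^ l * (1 / 2 ^ j)) ^ M" by simp
        qed
        also have "\<dots> = (2 ^ (l * M) * ?D l) / 2 ^ (j * M)"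
          by (simp add: power_mult_distrib power_divide power_mult)
        also have "\<dots> \<le> E j / 2 ^ (j * M)" using D_le_E[of l j] False by (intro divide_right_mono) auto
        also have "\<dots> \<le> e" by (rule Ee)
        finally show ?thesis .
      qed
      have "(\<Sum>l<L. ?D l * min 1 ((2 ^ l * norm h) ^ M)) \<le> real L * e"
        using sum_mono[of "{..<L}", OF level] by simp
      also have "\<dots> \<le> (real j * q + 1) * e" using L(2) e by (intro mult_right_mono) auto
      finally have S: "(\<Sum>l<L. ?D l * min 1 ((2 ^ l * norm h) ^ M)) \<le> (real j * q + 1) * e" .
      have "\<bar>fdiff h M f x\<bar> \<le> C * (norm h ^ M + (\<Sum>l<L. ?D l * min 1 ((2 ^ l * norm h) ^ M)) + 2 powr (- (real L * a)))"
        by (rule C(2)[OF h1])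
      also have "\<dots> \<le> C * (e + (real j * q + 1) * e + e)"
        using C(1) by (intro mult_left_mono add_mono hM S tail) auto
      also have "\<dots> = C * e * (3 + real j * q)" by (simp add: algebra_simps)
      finally show "\<bar>fdiff h M f x\<bar> \<le> C * e * (3 + real j * q)" .
    qed simp
    moreover have "c * e * \<bar>ln (1 / 2 ^ j)\<bar> powr 2 \<le> modulus M f (1 / 2 ^ j)"
      unfolding e_def by (rule c(3)[OF _ R]) simp
    moreover have "\<bar>ln (1 / 2 ^ j)\<bar> powr 2 = (real j * ln 2)\<^sup>2"
      by (simp add: ln_div ln_realpow powr_numeral abs_mult)
    ultimately have "e * (c * (real j * ln 2)\<^sup>2) \<le> e * (C * (3 + real j * q))" by (simp add: mult_ac)
    then show ?thesis using e by simp
  qed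
  obtain J1 where J1: "C * (3 + q) / (c * (ln 2)\<^sup>2) < real J1" using reals_Archimedean2 by blast
  obtain J2 where J2: "(1 / 2) ^ J2 < R" using real_arch_pow_inv[OF c(2), of "1 / 2"] by auto
  \<comment> \<open>\<open>J1\<close> makes the quadratic lower bound exceed the linear upper one,
    \<open>J2\<close> puts \<open>1 / 2 ^ j\<close> in the range where the lower bound on the
    modulus is valid, and \<open>1 \<le> j\<close> allows 3 to be replaced by
    \<open>j * 3\<close>.\<close>
  define J where "J = max 1 (max J1 J2)"
  have large: "2 powr (- (real j * \<alpha>)) \<le> mx j" if "J \<le> j" for j
  proof (rule ccontr)
    assume "\<not> ?thesis"
    then have less: "mx j < 2 powr (- (real j * \<alpha>))" by simp
    have j: "1 \<le> j" "J1 \<le> j" "J2 \<le> j" using that by (auto simp: J_def)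
    have "1 / 2 ^ j = (1 / 2 :: real) ^ j" by (simp add: power_one_over)
    also have "\<dots> \<le> (1 / 2) ^ J2" using j by (intro power_decreasing) auto
    finally have R: "1 / 2 ^ j \<le> R" using J2 by simp
    have "C * (3 + q) < real j * (c * (ln 2)\<^sup>2)"
      using J1 j c(1) by (simp add: divide_less_eq less_le_trans)
    then have "real j * (C * (3 + q)) < real j * (real j * (c * (ln 2)\<^sup>2))"
      using j by (intro mult_strict_left_mono) auto
    also have "\<dots> = c * (real j * ln 2)\<^sup>2" by (simp add: power2_eq_square mult_ac)
    also have "\<dots> \<le> C * (3 + real j * q)" by (rule small[OF less R])
    also have "\<dots> \<le> C * (real j * 3 + real j * q)" using C(1) j by (intro mult_left_mono add_right_mono) auto
    also have "\<dots> = real j * (C * (3 + q))" by (simp add: algebra_simps)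
    finally show False by simp
  qed
  \<comment> \<open>Each level enters \<open>mx j\<close>, through \<open>E j\<close> up to
    \<open>j\<close> and through \<open>A j\<close> from \<open>j\<close> on. Were
    \<open>mx j\<close> not positive, no coefficient norm would be positive, and then
    \<open>mx J\<close> could not be positive either, against \<open>large\<close>.\<close>
  have pos: "mx j > 0" for j
  proof (rule ccontr)
    assume "\<not> 0 < mx j"
    then have le: "A j \<le> 0" "2 powr (- real (j * M)) * E j \<le> 0" by (auto simp: mx_def)
    have D_le: "?D l \<le> 0" for l
    proof (cases "j \<le> l")
      case True
      then show ?thesis using D_le_A[OF True] le(1) by simp
    next
      case False
      have "E j \<le> 0" using le(2) by (simp add: mult_le_0_iff)
      then have "2 ^ (l * M) * ?D l \<le> 2 ^ (l * M) * 0" using D_le_E[of l j] False by simp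
      then show ?thesis by (rule mult_left_le_imp_le) simp
    qed
    have "A J \<le> 0" unfolding A_def by (intro cSUP_least D_le) auto
    moreover have "E J \<le> 0" unfolding E_def by (intro cSUP_least) (auto simp: mult_le_0_iff D_le)
    ultimately have "mx J \<le> 0" by (simp add: mx_def mult_le_0_iff)
    moreover have "0 < mx J" using large[of J] by (rule less_le_trans[rotated]) auto
    ultimately show False by simp
  qed
  \<comment> \<open>The entry 1 serves the levels from \<open>J\<close> on, the finitely many
    positive quotients serve the levels below.\<close>
  define c' where "c' = Min (insert 1 ((\<lambda>j. mx j * 2 powr (real j * \<alpha>)) ` {..J}))"
  have c': "c' > 0" unfolding c'_def using pos by (subst Min_gr_iff) auto
  have "c' * 2 powr (- (real j * \<alpha>)) \<le> mx j" for j
  proof (cases "J \<le> j")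
    case True
    have "c' \<le> 1" unfolding c'_def by (rule Min_le) auto
    then have "c' * 2 powr (- (real j * \<alpha>)) \<le> 1 * 2 powr (- (real j * \<alpha>))" by (intro mult_right_mono) auto
    also have "\<dots> \<le> mx j" using large[OF True] by simp
    finally show ?thesis .
  next
    case False
    have "c' \<le> mx j * 2 powr (real j * \<alpha>)" unfolding c'_def by (rule Min_le) (use False in auto)
    then have "c' * 2 powr (- (real j * \<alpha>)) \<le> mx j * 2 powr (real j * \<alpha>) * 2 powr (- (real j * \<alpha>))"
      by (intro mult_right_mono) auto
    also have "\<dots> = mx j" by (simp add: mult.assoc flip: powr_add)
    finally show ?thesis .
  qed
  with c' show ?thesis unfolding coeff_lower_bound_def mx_def A_def E_def by blast
qed

end

theorem theorem3:
  fixes f :: "real^'d \<Rightarrow> real" and \<phi> \<psi> :: "real \<Rightarrow> real" and \<alpha> \<gamma> :: real and M :: nat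
  assumes "\<alpha> > 0" and "M = nat \<lfloor>\<alpha>\<rfloor> + 1"
    and "\<gamma> > real M"
    and "regular_wavelets TYPE('d) \<gamma> \<phi> \<psi>"
    and "f \<in> borel_measurable lebesgue" and "bounded (range f)"
  shows "(coeff_lower_bound \<phi> \<psi> M \<alpha> f \<longrightarrow> f \<in> UI \<alpha>) \<and>
         (uniformly_Hoelderian f \<and> (\<forall>\<beta>>1. f \<in> UI_log \<alpha> \<beta>)
            \<longrightarrow> coeff_lower_bound \<phi> \<psi> M \<alpha> f)"
proof -
  obtain V where "mra V \<phi> \<psi> M" by (rule regular_wavelets_mra[OF assms(4,3)])
  then interpret mra V \<phi> \<psi> M .
  show ?thesis
    using coeff_lower_bound_imp_UI[OF assms(5,6,1,2)] UI_imp_coeff_lower_bound[OF assms(5,6,1,2)] by auto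
qed

end
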